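(* For any connected directed graph $G$ on the $n+1$ vertices $[n+1]$ and for any nonnegative net flow vector $\mathbf{a}=(a_1,\ldots,a_n)\in\mathbb{Z}^n$, $$\operatorname{vol}\mathcal{F}_G(\mathbf{a})=\big|\mathcal{U}_G(\mathbf{a})\big|,$$ where $\mathcal{U}_G(\mathbf{a})$ is the set of unified diagrams for $G$ and $\mathbf{a}$.
   Context: Directed graphs $G$ have vertex set $[n+1]=\{1,\ldots,n+1\}$, may have multiple edges, and every edge $(i,j)$ is directed from a smaller vertex $i$ to a larger vertex $j$; $m=|E(G)|$. Flow polytope: $\mathcal{F}_G(\mathbf{a})\subset\mathbb{R}^m$ is the set of tuples $(b_e)_{e\in E(G)}$ of nonnegative reals such that for each $j=1,\ldots,n$, (sum of $b_e$ over edges leaving $j$) minus (sum of $b_e$ over edges entering $j$) equals $a_j$. It lies in an affine subspace of dimension $m-n$, and $\operatorname{vol}$ is normalized volume: $(m-n)!$ times the $(m-n)$-dimensional volume, normalized so that a fundamental cell of the lattice of integer points of the linear subspace parallel to this affine subspace has volume $1$ (so $\operatorname{vol}=0$ if the polytope has dimension less than $m-n$). Shifted out-degree vector: $\mathbf{t}=(t_1,\ldots,t_n)$, $t_i=(\text{out-degree of } i)-1$; $|\mathbf{t}|=\sum t_i=m-n$. $G|_n$ is the restriction of $G$ to the vertices $1,\ldots,n$. $\mathbf{t}$-Dyck paths: weak compositions (sequences of nonnegative integers) $\mathbf{s}=(s_1,\ldots,s_n)$ of $|\mathbf{t}|$ with $\sum_{i=1}^k s_i\ge\sum_{i=1}^k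 t_i$ for all $k$; $\mathbf{s}$ is identified with the lattice path $N^{s_1}EN^{s_2}E\cdots N^{s_n}E$, which has $s_i$ north steps with $x$-coordinate $i-1$. A labeled $\mathbf{t}$-Dyck path $(\mathbf{s},\sigma)$ is a $\mathbf{t}$-Dyck path whose north steps are labeled (in order along the path) by a permutation $\sigma$ of $[|\mathbf{t}|]$ so that labels increase along consecutive north steps (i.e. within each column). Gravity diagrams: for $\mathbf{v}\in\mathbb{Z}^n$ with entry sum $0$, write $\mathbf{v}=\sum_{i=1}^{n-1}d_i\boldsymbol{\alpha}_i$ with $\boldsymbol{\alpha}_i=\mathbf{e}_i-\mathbf{e}_{i+1}$. A line-dot diagram for $G|_n$ and $\mathbf{v}$ is a partition of an array of dots with $d_i$ dots in column $i$ (none exists if some $d_i<0$) into lines, each line assigned to an edge $(i,j)$ of $G|_n$ and consisting of exactly one dot from each of the columns $i,\ldots,j-1$. Two such diagrams are equivalent if each edge is assigned the same number of lines in both. $\mathcal{GD}_{G|_n}(\mathbf{v})$ is the set of equivalence classes (gravity diagrams). Unified diagrams: $\mathcal{U}_G(\mathbf{a})$ is the set of tuples $(\mathbf{s},\sigma,\boldsymbol{\varphi},D)$ where $(\mathbf{s},\sigma)$ is a labeled $\mathbf{t}$-Dyck path, $\boldsymbol{\varphi}\in[a_1]^{s_1}\times\cdots\times[a_n]^{s_n}$ (a net flow label in $\{1,\ldots,a_i\}$ for each north step with $x$-coordinate $i-1$; $[0]=\emptyset$, $[0]^0$ is a one-point set), and $D\in\mathcal{GD}_{G|_n}(\mathb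f{s}-\mathbf{t})$.
   Formalization: Added assumption: every vertex i in [n] with a_i = 0 has at least one outgoing edge; without it the claim fails, e.g. n = 2, edges (1,2),(1,3),(1,3), a = (1,0), where the volume is 1 but there are no unified diagrams. *)

theory Defs
  imports
    "HOL-Analysis.Analysis"
    "HOL-Combinatorics.Permutations"
    "Graph_Theory.Digraph_Component"
begin

section \<open>Flow polytopes\<close>

text \<open>
  A vector in \<open>\<real>\<^sup>m\<close>, with coordinates indexed by the arcs of \<open>G\<close>, is an extensional function on
  \<^term>\<open>arcs G\<close>; parallel arcs are distinct coordinates. Net flow is only prescribed at the
  vertices \<open>1, \<dots>, n\<close>; its value at \<open>n + 1\<close> is then forced.
\<close>

definition net_flow :: "(nat, 'e) pre_digraph \<Rightarrow> ('e \<Rightarrow> real) \<Rightarrow> nat \<Rightarrow> real" where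
  "net_flow G b j = (\<Sum>e\<in>out_arcs G j. b e) - (\<Sum>e\<in>in_arcs G j. b e)"

definition flow_space :: "(nat, 'e) pre_digraph \<Rightarrow> nat \<Rightarrow> (nat \<Rightarrow> real) \<Rightarrow> ('e \<Rightarrow> real) set" where
  "flow_space G n a = {b \<in> arcs G \<rightarrow>\<^sub>E UNIV. \<forall>j\<in>{1..n}. net_flow G b j = a j}"

definition flow_polytope :: "(nat, 'e) pre_digraph \<Rightarrow> nat \<Rightarrow> (nat \<Rightarrow> real) \<Rightarrow> ('e \<Rightarrow> real) set" where
  "flow_polytope G n a = {b \<in> flow_space G n a. \<forall>e\<in>arcs G. 0 \<le> b e}"

definition integer_points :: "'e set \<Rightarrow> ('e \<Rightarrow> real) set \<Rightarrow> ('e \<Rightarrow> real) set" where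
  "integer_points E W = {v \<in> W. \<forall>e\<in>E. v e \<in> \<int>}"

text \<open>
  The points \<open>w 0, \<dots>, w (d - 1)\<close> form a \<open>\<int>\<close>-basis of the lattice \<open>L\<close>: integer coefficient vectors
  correspond bijectively to the points of \<open>L\<close>.
\<close>

definition lattice_basis ::
    "'e set \<Rightarrow> ('e \<Rightarrow> real) set \<Rightarrow> nat \<Rightarrow> (nat \<Rightarrow> 'e \<Rightarrow> real) \<Rightarrow> bool" where
  "lattice_basis E L d w \<longleftrightarrow>
     bij_betw (\<lambda>c. \<lambda>e\<in>E. \<Sum>i<d. real_of_int (c i) * w i e) ({..<d} \<rightarrow>\<^sub>E (UNIV :: int set)) L"

text \<open>
  Normalized volume. Linear coordinates with respect to a lattice basis \<open>w\<close> of the integer points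
  of the parallel subspace \<^term>\<open>flow_space G n (\<lambda>_. 0)\<close>, and with origin \<open>p\<close> in the affine
  subspace, identify the affine subspace with \<open>\<real>\<^sup>d\<close>, \<open>d = m - n\<close>, in such a way that a fundamental
  cell becomes the unit cube. Any two lattice bases differ by a matrix of determinant \<open>\<plusminus>1\<close> and any
  two origins by a translation, so the choices made by \<open>SOME\<close> do not affect the value. For connected
  \<open>G\<close> the affine subspace is nonempty and has dimension \<open>m - n\<close>, so that both choices are possible.
\<close>

definition flow_volume :: "(nat, 'e) pre_digraph \<Rightarrow> nat \<Rightarrow> (nat \<Rightarrow> real) \<Rightarrow> real" where
  "flow_volume G n a =
    (let d = card (arcs G) - n;
         p = (SOME p. p \<in> flow_space G n a);
         w = (SOME w. lattice_basis (arcs G) (integer_points (arcs G) (flow_space G n (\<lambda>_. 0))) d w)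
     in fact d * measure (\<Pi>\<^sub>M i\<in>{..<d}. lborel)
          {x \<in> {..<d} \<rightarrow>\<^sub>E UNIV.
             (\<lambda>e\<in>arcs G. p e + (\<Sum>i<d. x i * w i e)) \<in> flow_polytope G n a})"


section \<open>Labeled Dyck paths\<close>

definition shifted_out_degree :: "(nat, 'e) pre_digraph \<Rightarrow> nat \<Rightarrow> int" where
  "shifted_out_degree G i = int (out_degree G i) - 1"

definition dyck_paths :: "nat \<Rightarrow> (nat \<Rightarrow> int) \<Rightarrow> (nat \<Rightarrow> nat) set" where
  "dyck_paths n t = {s \<in> {1..n} \<rightarrow>\<^sub>E UNIV.
     (\<Sum>i=1..n. int (s i)) = (\<Sum>i=1..n. t i) \<and>
     (\<forall>k\<in>{1..n}. (\<Sum>i=1..k. int (s i)) \<ge> (\<Sum>i=1..k. t i))}"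

text \<open>
  The north steps of the path of \<open>s\<close> are numbered from 1 in order along the path, so that those
  with \<open>x\<close>-coordinate \<open>i - 1\<close> have the numbers in \<^term>\<open>column_steps s i\<close>; step number \<open>j\<close> carries
  the label \<open>\<sigma> j\<close>.
\<close>

definition column_steps :: "(nat \<Rightarrow> nat) \<Rightarrow> nat \<Rightarrow> nat set" where
  "column_steps s i = {(\<Sum>h=1..<i. s h)<..(\<Sum>h=1..i. s h)}"

definition labeled_dyck_paths ::
    "nat \<Rightarrow> (nat \<Rightarrow> int) \<Rightarrow> ((nat \<Rightarrow> nat) \<times> (nat \<Rightarrow> nat)) set" where
  "labeled_dyck_paths n t = {(s, \<sigma>). s \<in> dyck_paths n t \<and>
     \<sigma> permutes {1..(\<Sum>i=1..n. s i)} \<and>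
     (\<forall>i\<in>{1..n}. strict_mono_on (column_steps s i) \<sigma>)}"


section \<open>Gravity diagrams\<close>

text \<open>
  The coefficient of \<open>\<alpha>\<^sub>i = e\<^sub>i - e\<^sub>i\<^sub>+\<^sub>1\<close> in a vector \<open>v\<close> with entry sum 0 is \<open>v\<^sub>1 + \<dots> + v\<^sub>i\<close>; see
  \<open>root_coeff_unique\<close> below.
\<close>

definition simple_root :: "nat \<Rightarrow> nat \<Rightarrow> int" where
  "simple_root i j = (if j = i then 1 else if j = i + 1 then -1 else 0)"

definition root_coeff :: "(nat \<Rightarrow> int) \<Rightarrow> nat \<Rightarrow> int" where
  "root_coeff v i = (\<Sum>h=1..i. v h)"

lemma sum_simple_root:
  assumes "j \<in> {1..n}"
  shows "(\<Sum>i=1..<n. d i * simple_root i j) =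
    (if j < n then d j else 0) - (if 1 < j then d (j - 1) else 0)"
proof -
  have "d i * simple_root i j = (if i = j then d j else 0)
      - (if i = j - 1 then d (j - 1) else 0)" if "i \<in> {1..<n}" for i
    using that assms by (auto simp: simple_root_def)
  then have "(\<Sum>i=1..<n. d i * simple_root i j) =
      (\<Sum>i=1..<n. (if i = j then d j else 0) - (if i = j - 1 then d (j - 1) else 0))"
    by (intro sum.cong) auto
  also have "\<dots> = (if j < n then d j else 0) - (if 1 < j then d (j - 1) else 0)"
    using assms by (auto simp: sum_subtractf)
  finally show ?thesis .
qed

lemma root_coeff_expansion:
  assumes "(\<Sum>h=1..n. v h) = 0" and "j \<in> {1..n}"
  shows "v j = (\<Sum>i=1..<n. root_coeff v i * simple_root i j)"
proof -
  have 1: "root_coeff v j = root_coeff v (j - 1) + v j"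
    using assms(2) by (cases j) (auto simp: root_coeff_def)
  have 2: "root_coeff v j = 0" if "\<not> j < n"
    using that assms by (auto simp: root_coeff_def)
  have 3: "root_coeff v (j - 1) = 0" if "\<not> 1 < j"
    using that by (auto simp: root_coeff_def)
  show ?thesis
    unfolding sum_simple_root[OF assms(2)] using 1 2 3 by auto
qed

lemma root_coeff_unique:
  assumes "\<And>j. j \<in> {1..n} \<Longrightarrow> v j = (\<Sum>i=1..<n. d i * simple_root i j)"
    and "1 \<le> i" and "i < n"
  shows "d i = root_coeff v i"
  using assms(2,3)
proof (induction i rule: dec_induct)
  case base
  then show ?case
    using assms(1)[of 1] sum_simple_root[of 1 n d] by (auto simp: root_coeff_def)
next
  case (step k)
  then show ?case
    using assms(1)[of "Suc k"] sum_simple_root[of "Suc k" n d] by (auto simp: root_coeff_def)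
qed

definition dots :: "nat \<Rightarrow> (nat \<Rightarrow> int) \<Rightarrow> (nat \<times> nat) set" where
  "dots n v = (SIGMA i:{1..<n}. {1..nat (root_coeff v i)})"

text \<open>
  A line-dot diagram is a pair of a partition \<open>P\<close> of the dots into lines and the assignment \<open>f\<close> of
  arcs to lines. Dots are pairs whose first component is the column.
\<close>

definition line_dot_diagrams ::
    "(nat, 'e) pre_digraph \<Rightarrow> nat \<Rightarrow> (nat \<Rightarrow> int) \<Rightarrow>
      ((nat \<times> nat) set set \<times> ((nat \<times> nat) set \<Rightarrow> 'e)) set" where
  "line_dot_diagrams H n v = {(P, f).
     (\<forall>i\<in>{1..<n}. 0 \<le> root_coeff v i) \<and>
     partition_on (dots n v) P \<and>
     f \<in> P \<rightarrow>\<^sub>E arcs H \<and>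
     (\<forall>l\<in>P. bij_betw fst l {tail H (f l)..<head H (f l)})}"

definition diagram_equiv ::
    "(nat, 'e) pre_digraph \<Rightarrow> nat \<Rightarrow> (nat \<Rightarrow> int) \<Rightarrow>
      ((nat \<times> nat) set set \<times> ((nat \<times> nat) set \<Rightarrow> 'e)) rel" where
  "diagram_equiv H n v = {((P, f), (P', f')).
     (P, f) \<in> line_dot_diagrams H n v \<and> (P', f') \<in> line_dot_diagrams H n v \<and>
     (\<forall>e\<in>arcs H. card {l \<in> P. f l = e} = card {l \<in> P'. f' l = e})}"

definition gravity_diagrams ::
    "(nat, 'e) pre_digraph \<Rightarrow> nat \<Rightarrow> (nat \<Rightarrow> int) \<Rightarrow>
      ((nat \<times> nat) set set \<times> ((nat \<times> nat) set \<Rightarrow> 'e)) set set" where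
  "gravity_diagrams H n v = line_dot_diagrams H n v // diagram_equiv H n v"

lemma equiv_diagram_equiv: "equiv (line_dot_diagrams H n v) (diagram_equiv H n v)"
  by (rule equivI) (auto simp: diagram_equiv_def refl_on_def sym_def trans_def)

lemma finite_gravity_diagrams:
  assumes "finite (arcs H)"
  shows "finite (gravity_diagrams H n v)"
proof -
  have fin: "finite (dots n v)"
    by (auto simp: dots_def)
  have "line_dot_diagrams H n v \<subseteq> (SIGMA P:Pow (Pow (dots n v)). P \<rightarrow>\<^sub>E arcs H)"
    by (auto simp: line_dot_diagrams_def partition_on_def)
  moreover have "finite (SIGMA P:Pow (Pow (dots n v)). P \<rightarrow>\<^sub>E arcs H)"
    using fin assms by (intro finite_SigmaI finite_PiE) (auto intro: finite_subset)
  ultimately have "finite (line_dot_diagrams H n v)"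
    by (rule finite_subset)
  then show ?thesis
    unfolding gravity_diagrams_def
    by (rule finite_quotient) (auto simp: diagram_equiv_def)
qed


section \<open>Unified diagrams\<close>

definition unified_diagrams ::
    "(nat, 'e) pre_digraph \<Rightarrow> nat \<Rightarrow> (nat \<Rightarrow> int) \<Rightarrow>
      ((nat \<Rightarrow> nat) \<times> (nat \<Rightarrow> nat) \<times> (nat \<Rightarrow> nat \<Rightarrow> int) \<times>
       ((nat \<times> nat) set set \<times> ((nat \<times> nat) set \<Rightarrow> 'e)) set) set" where
  "unified_diagrams G n a = {(s, \<sigma>, \<phi>, D).
     (s, \<sigma>) \<in> labeled_dyck_paths n (shifted_out_degree G) \<and>
     \<phi> \<in> (\<Pi>\<^sub>E i\<in>{1..n}. {1..s i} \<rightarrow>\<^sub>E {1..a i}) \<and>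
     D \<in> gravity_diagrams (G \<restriction> {1..n}) n (\<lambda>i. int (s i) - shifted_out_degree G i)}"

lemma finite_dyck_paths: "finite (dyck_paths n t)"
proof (rule finite_subset)
  show "dyck_paths n t \<subseteq> {1..n} \<rightarrow>\<^sub>E {..nat (\<Sum>i=1..n. t i)}"
  proof
    fix s assume s: "s \<in> dyck_paths n t"
    have "s i \<le> nat (\<Sum>i=1..n. t i)" if "i \<in> {1..n}" for i
    proof -
      have "int (s i) \<le> (\<Sum>i=1..n. int (s i))"
        using that by (intro member_le_sum) auto
      then show ?thesis
        using s by (simp add: dyck_paths_def)
    qed
    then show "s \<in> {1..n} \<rightarrow>\<^sub>E {..nat (\<Sum>i=1..n. t i)}"
      using s by (auto simp: dyck_paths_def PiE_iff)
  qed
qed (intro finite_PiE; simp)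

text \<open>In particular, \<^const>\<open>card\<close> is the true cardinality of the set of unified diagrams.\<close>

lemma finite_unified_diagrams:
  assumes "finite (arcs G)"
  shows "finite (unified_diagrams G n a)"
proof -
  let ?t = "shifted_out_degree G"
  let ?S = "SIGMA s:dyck_paths n ?t.
      {\<sigma>. \<sigma> permutes {1..(\<Sum>i=1..n. s i)}} \<times>
      (\<Pi>\<^sub>E i\<in>{1..n}. {1..s i} \<rightarrow>\<^sub>E {1..a i}) \<times>
      gravity_diagrams (G \<restriction> {1..n}) n (\<lambda>i. int (s i) - ?t i)"
  have "unified_diagrams G n a \<subseteq> ?S"
    by (auto simp: unified_diagrams_def labeled_dyck_paths_def)
  moreover have "finite ?S"
  proof (rule finite_SigmaI[OF finite_dyck_paths])
    fix s :: "nat \<Rightarrow> nat"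
    have "finite (\<Pi>\<^sub>E i\<in>{1..n}. {1..s i} \<rightarrow>\<^sub>E {1..a i})"
      by (intro finite_PiE finite_atLeastAtMost finite_atLeastAtMost_int)
    moreover have "finite (gravity_diagrams (G \<restriction> {1..n}) n (\<lambda>i. int (s i) - ?t i))"
      using assms by (intro finite_gravity_diagrams) simp
    ultimately show "finite ({\<sigma>. \<sigma> permutes {1..(\<Sum>i=1..n. s i)}} \<times>
        (\<Pi>\<^sub>E i\<in>{1..n}. {1..s i} \<rightarrow>\<^sub>E {1..a i}) \<times>
        gravity_diagrams (G \<restriction> {1..n}) n (\<lambda>i. int (s i) - ?t i))"
      by (intro finite_cartesian_product finite_permutations) auto
  qed
  ultimately show ?thesis
    by (rule finite_subset)
qed

end

theory Submission
  imports Defs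
begin

text \<open>
  If some vertex \<open>i \<le> n\<close> has no outgoing arc, then \<open>a\<^sub>i > 0\<close>, so the polytope is empty; and
  \<open>s\<^sub>i + 1 \<le> 0\<close> in every unified diagram, so there are none. Otherwise choose one outgoing arc
  for each vertex \<open>1, \<dots>, n\<close>. These arcs form a spanning tree, and a flow is determined by its values
  on the remaining arcs, integrally so. Hence the normalized volume is \<open>(m - n)!\<close> times the Lebesgue
  measure of the projection of the polytope to the non-tree coordinates: the coordinate change is a
  linear map that matches the integer lattices, and such a map preserves Lebesgue measure.

  That measure is computed by inserting the arcs one at a time, from the largest tail down, with the
  tree arc first at each vertex. Inserting a non-tree arc \<open>(k, j)\<close> integrates over the flow
  \<open>y \<in> [0, a\<^sub>k]\<close> on it, which moves \<open>y\<close> units of net flow from \<open>k\<close> to \<open>j\<close>; inserting a tree arc moves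
  all of \<open>a\<^sub>k\<close>. By the binomial theorem and the beta integral, the measure is the sum of
  \<open>\<Prod> a\<^sub>i ^ s\<^sub>i / s\<^sub>i!\<close> over the arc multiplicities \<open>\<kappa>\<close> whose net flow is \<open>s - t\<close> for some \<open>s \<ge> 0\<close>
  (Lidskii's formula). Gravity diagrams are the same as such \<open>\<kappa>\<close>, and there are
  \<open>(m - n)! / \<Prod> s\<^sub>i!\<close> labelings of the path of \<open>s\<close>.
\<close>

section \<open>Unimodular maps preserve product Lebesgue measure\<close>

text \<open>\<open>flow_volume\<close> takes its basis and origin from \<open>SOME\<close>, so only
  their defining properties are available: there is no explicit matrix and no determinant. Measure
  preservation is therefore derived from the matching of integer lattices alone: Fubini and
  translation invariance fix the image measure up to a factor, and a fundamental domain fixes the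
  factor.

  The order of insertion is what makes the recursion close. The arcs present before \<open>e\<close>
  have tails no smaller than that of \<open>e\<close>, so none of them enters its tail. That vertex
  then disposes of its current net flow and nothing else; the flow on a new nontree arc ranges over
  exactly the interval from 0 to that value, and the changed net flow is again nonnegative there.
  The tree arc takes whatever the other arcs leave.

  The vector t appears because vertex i has out-degree minus 1 nontree arcs, and the integration
  over each of them adds 1 to the exponent of a_i.\<close>

abbreviation lborel_on :: "'i set \<Rightarrow> ('i \<Rightarrow> real) measure" where
  "lborel_on I \<equiv> \<Pi>\<^sub>M i\<in>I. lborel"

interpretation lborel_on: product_sigma_finite "\<lambda>_::'i. lborel :: real measure"
  by standard

lemma space_lborel_on: "space (lborel_on I) = I \<rightarrow>\<^sub>E UNIV"
  by (simp add: space_PiM)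

lemma sigma_finite_lborel_on: "finite I \<Longrightarrow> sigma_finite_measure (lborel_on I)"
  by (rule lborel_on.sigma_finite)

lemma measurable_translate [measurable]:
  "(\<lambda>x. \<lambda>i\<in>I. x i + u i) \<in> lborel_on I \<rightarrow>\<^sub>M lborel_on I"
  by measurable

text \<open>A product measure is determined by its values on boxes. Translation pulls a box back to
  a box whose sides have the same Lebesgue measure as before.\<close>

lemma distr_translate:
  fixes u :: "'i \<Rightarrow> real"
  assumes [simp]: "finite I"
  shows "distr (lborel_on I) (lborel_on I) (\<lambda>x. \<lambda>i\<in>I. x i + u i) = lborel_on I"
proof (rule lborel_on.PiM_eqI)
  fix A :: "'i \<Rightarrow> real set"
  assume A: "\<And>i. i \<in> I \<Longrightarrow> A i \<in> sets lborel"
  then have [measurable]: "\<And>i. i \<in> I \<Longrightarrow> A i \<in> sets borel"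
    by simp
  define B where "B i = (\<lambda>x. u i + x) -` A i" for i
  have B: "B i \<in> sets lborel" "emeasure lborel (B i) = emeasure lborel (A i)" if "i \<in> I" for i
  proof -
    show Bm: "B i \<in> sets lborel"
      using measurable_sets_borel[of "\<lambda>x. u i + x" borel "A i"] that A unfolding B_def by simp
    have "emeasure lborel (A i) = emeasure (distr lborel borel ((+) (u i))) (A i)"
      by (simp add: lborel_distr_plus)
    also have "\<dots> = emeasure lborel (B i)"
      using that A by (subst emeasure_distr) (auto simp: B_def)
    finally show "emeasure lborel (B i) = emeasure lborel (A i)" ..
  qed
  have PA: "Pi\<^sub>E I A \<in> sets (lborel_on I)"
    using A by (intro sets_PiM_I_finite) auto
  have "emeasure (distr (lborel_on I) (lborel_on I) (\<lambda>x. \<lambda>i\<in>I. x i + u i)) (Pi\<^sub>E I A) =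
      emeasure (lborel_on I) ((\<lambda>x. \<lambda>i\<in>I. x i + u i) -` Pi\<^sub>E I A \<inter> space (lborel_on I))"
    using PA by (subst emeasure_distr) auto
  also have "(\<lambda>x. \<lambda>i\<in>I. x i + u i) -` Pi\<^sub>E I A \<inter> space (lborel_on I) = Pi\<^sub>E I B"
    by (auto simp: space_lborel_on PiE_iff B_def add.commute)
  also have "emeasure (lborel_on I) (Pi\<^sub>E I B) = (\<Prod>i\<in>I. emeasure lborel (A i))"
    using B by (subst lborel_on.emeasure_PiM) auto
  finally show "emeasure (distr (lborel_on I) (lborel_on I) (\<lambda>x. \<lambda>i\<in>I. x i + u i)) (Pi\<^sub>E I A) =
      (\<Prod>i\<in>I. emeasure lborel (A i))" .
qed auto

lemma nn_integral_translate:
  assumes "finite I" and f: "f \<in> borel_measurable (lborel_on I)"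
  shows "(\<integral>\<^sup>+x. f (\<lambda>i\<in>I. x i + u i) \<partial>lborel_on I) = (\<integral>\<^sup>+x. f x \<partial>lborel_on I)"
proof -
  have "(\<integral>\<^sup>+x. f x \<partial>lborel_on I) =
      (\<integral>\<^sup>+x. f x \<partial>distr (lborel_on I) (lborel_on I) (\<lambda>x. \<lambda>i\<in>I. x i + u i))"
    by (simp only: distr_translate[OF assms(1)])
  also have "\<dots> = (\<integral>\<^sup>+x. f (\<lambda>i\<in>I. x i + u i) \<partial>lborel_on I)"
    using f by (subst nn_integral_distr) auto
  finally show ?thesis ..
qed

text \<open>Fubini and translation invariance, as in the uniqueness proof for Haar measure.\<close>

lemma nn_integral_additive_exchange:
  fixes M :: "('i \<Rightarrow> real) \<Rightarrow> ('j \<Rightarrow> real)"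
  assumes fin: "finite I" "finite J"
    and M [measurable]: "M \<in> lborel_on I \<rightarrow>\<^sub>M lborel_on J"
    and add: "\<And>x y. x \<in> I \<rightarrow>\<^sub>E UNIV \<Longrightarrow> y \<in> I \<rightarrow>\<^sub>E UNIV \<Longrightarrow>
      M (\<lambda>i\<in>I. x i + y i) = (\<lambda>j\<in>J. M x j + M y j)"
    and surj: "J \<rightarrow>\<^sub>E UNIV \<subseteq> M ` (I \<rightarrow>\<^sub>E UNIV)"
    and f [measurable]: "f \<in> borel_measurable (lborel_on J)"
    and g [measurable]: "g \<in> borel_measurable (lborel_on J)"
  shows "(\<integral>\<^sup>+x. f (M x) \<partial>lborel_on I) * (\<integral>\<^sup>+y. g y \<partial>lborel_on J) =
    (\<integral>\<^sup>+x. g (M x) \<partial>lborel_on I) * (\<integral>\<^sup>+y. f (\<lambda>j\<in>J. - y j) \<partial>lborel_on J)"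
proof -
  interpret I: sigma_finite_measure "lborel_on I" by (rule sigma_finite_lborel_on[OF fin(1)])
  interpret J: sigma_finite_measure "lborel_on J" by (rule sigma_finite_lborel_on[OF fin(2)])
  interpret IJ: pair_sigma_finite "lborel_on I" "lborel_on J" ..
  have Mj: "(\<lambda>x. M x j) \<in> borel_measurable (lborel_on I)" if "j \<in> J" for j
    using measurable_comp[OF M measurable_component_singleton[OF that]] by (simp add: o_def)
  then have Mc: "(\<lambda>x. M (fst x) j) \<in> borel_measurable (lborel_on I \<Otimes>\<^sub>M lborel_on J)" if "j \<in> J" for j
    using that by measurable
  have Mp [measurable]:
    "(\<lambda>(x, y). \<lambda>j\<in>J. y j + M x j) \<in> lborel_on I \<Otimes>\<^sub>M lborel_on J \<rightarrow>\<^sub>M lborel_on J"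
    "(\<lambda>(x, y). \<lambda>j\<in>J. - y j + M x j) \<in> lborel_on I \<Otimes>\<^sub>M lborel_on J \<rightarrow>\<^sub>M lborel_on J"
    using Mc by (auto simp: split_beta' intro!: measurable_restrict borel_measurable_add
        borel_measurable_uminus measurable_compose[OF measurable_snd measurable_component_singleton])
  have neg [measurable]: "(\<lambda>y. \<lambda>j\<in>J. - y j) \<in> lborel_on J \<rightarrow>\<^sub>M lborel_on J"
    by measurable
  have Mx: "M x \<in> J \<rightarrow>\<^sub>E UNIV" if "x \<in> I \<rightarrow>\<^sub>E UNIV" for x
    using measurable_space[OF M] that by (simp add: space_lborel_on)
  have "(\<integral>\<^sup>+x. f (M x) \<partial>lborel_on I) * (\<integral>\<^sup>+y. g y \<partial>lborel_on J) =
      (\<integral>\<^sup>+x. \<integral>\<^sup>+y. f (M x) * g (\<lambda>j\<in>J. y j + M x j) \<partial>lborel_on J \<partial>lborel_on I)"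
    by (simp add: nn_integral_cmult nn_integral_multc nn_integral_translate[OF fin(2)])
  \<comment> \<open>Translation invariance in \<open>y\<close> made the shift by \<open>M x\<close>
    inside \<open>g\<close> free; it couples the two variables before the order of integration is
    exchanged.\<close>
  also have "\<dots> = (\<integral>\<^sup>+y. \<integral>\<^sup>+x. f (M x) * g (\<lambda>j\<in>J. y j + M x j) \<partial>lborel_on I \<partial>lborel_on J)"
    by (rule IJ.Fubini'[symmetric]) measurable
  also have "\<dots> = (\<integral>\<^sup>+y. \<integral>\<^sup>+x. f (\<lambda>j\<in>J. - y j + M x j) * g (M x) \<partial>lborel_on I \<partial>lborel_on J)"
  proof (rule nn_integral_cong)
    fix y assume "y \<in> space (lborel_on J)"
    then have y: "y \<in> J \<rightarrow>\<^sub>E UNIV" by (simp add: space_lborel_on)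
    then have "(\<lambda>j\<in>J. - y j) \<in> J \<rightarrow>\<^sub>E UNIV" by auto
    \<comment> \<open>For fixed \<open>y\<close>, translating \<open>x\<close> by a preimage
      \<open>u\<close> of \<open>-y\<close> replaces \<open>M x\<close> by \<open>M x - y\<close>:
      the argument of \<open>g\<close> becomes \<open>M x\<close>, and \<open>-y\<close> moves into
      \<open>f\<close>.\<close>
    then obtain u where u: "u \<in> I \<rightarrow>\<^sub>E UNIV" "M u = (\<lambda>j\<in>J. - y j)"
      using surj by (metis imageE subsetD)
    have [measurable]: "(\<lambda>x. \<lambda>j\<in>J. y j + M x j) \<in> lborel_on I \<rightarrow>\<^sub>M lborel_on J"
      using Mj by (auto intro!: measurable_restrict)
    have "(\<integral>\<^sup>+x. f (M x) * g (\<lambda>j\<in>J. y j + M x j) \<partial>lborel_on I) =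
        (\<integral>\<^sup>+x. f (M (\<lambda>i\<in>I. x i + u i)) * g (\<lambda>j\<in>J. y j + M (\<lambda>i\<in>I. x i + u i) j) \<partial>lborel_on I)"
      by (rule nn_integral_translate[OF fin(1), symmetric]) measurable
    also have "\<dots> = (\<integral>\<^sup>+x. f (\<lambda>j\<in>J. - y j + M x j) * g (M x) \<partial>lborel_on I)"
    proof (rule nn_integral_cong)
      fix x assume "x \<in> space (lborel_on I)"
      then have x: "x \<in> I \<rightarrow>\<^sub>E UNIV" by (simp add: space_lborel_on)
      have 1: "M (\<lambda>i\<in>I. x i + u i) = (\<lambda>j\<in>J. - y j + M x j)"
        unfolding add[OF x u(1)] u(2) by (auto simp: fun_eq_iff)
      have 2: "(\<lambda>j\<in>J. y j + M (\<lambda>i\<in>I. x i + u i) j) = M x"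
        unfolding 1 using Mx[OF x] by (auto simp: fun_eq_iff PiE_iff extensional_def)
      show "f (M (\<lambda>i\<in>I. x i + u i)) * g (\<lambda>j\<in>J. y j + M (\<lambda>i\<in>I. x i + u i) j) =
          f (\<lambda>j\<in>J. - y j + M x j) * g (M x)"
        using 1 2 by simp
    qed
    finally show "(\<integral>\<^sup>+x. f (M x) * g (\<lambda>j\<in>J. y j + M x j) \<partial>lborel_on I) =
        (\<integral>\<^sup>+x. f (\<lambda>j\<in>J. - y j + M x j) * g (M x) \<partial>lborel_on I)" .
  qed
  also have "\<dots> = (\<integral>\<^sup>+x. \<integral>\<^sup>+y. f (\<lambda>j\<in>J. - y j + M x j) * g (M x) \<partial>lborel_on J \<partial>lborel_on I)"
    by (rule IJ.Fubini') measurable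
  also have "\<dots> = (\<integral>\<^sup>+x. (\<integral>\<^sup>+y. f (\<lambda>j\<in>J. - y j) \<partial>lborel_on J) * g (M x) \<partial>lborel_on I)"
  proof (rule nn_integral_cong)
    fix x assume "x \<in> space (lborel_on I)"
    then have x: "x \<in> I \<rightarrow>\<^sub>E UNIV" by (simp add: space_lborel_on)
    have [measurable]: "(\<lambda>y. f (\<lambda>j\<in>J. - y j + M x j)) \<in> borel_measurable (lborel_on J)"
      by measurable
    have "(\<integral>\<^sup>+y. f (\<lambda>j\<in>J. - y j + M x j) * g (M x) \<partial>lborel_on J) =
        (\<integral>\<^sup>+y. f (\<lambda>j\<in>J. - y j + M x j) \<partial>lborel_on J) * g (M x)"
      by (rule nn_integral_multc) measurable
    \<comment> \<open>\<open>-y + M x\<close> is the negative of \<open>y - M x\<close>, so a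
      translation of \<open>y\<close> removes the dependence on \<open>x\<close>.\<close>
    also have "(\<integral>\<^sup>+y. f (\<lambda>j\<in>J. - y j + M x j) \<partial>lborel_on J) =
        (\<integral>\<^sup>+y. f (\<lambda>j\<in>J. - (\<lambda>j\<in>J. y j + - M x j) j) \<partial>lborel_on J)"
      by (intro nn_integral_cong arg_cong[where f=f]) (auto simp: fun_eq_iff)
    also have "\<dots> = (\<integral>\<^sup>+y. f (\<lambda>j\<in>J. - y j) \<partial>lborel_on J)"
      by (rule nn_integral_translate[OF fin(2)]) measurable
    finally show "(\<integral>\<^sup>+y. f (\<lambda>j\<in>J. - y j + M x j) * g (M x) \<partial>lborel_on J) =
        (\<integral>\<^sup>+y. f (\<lambda>j\<in>J. - y j) \<partial>lborel_on J) * g (M x)" .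
  qed
  also have "\<dots> = (\<integral>\<^sup>+x. g (M x) \<partial>lborel_on I) * (\<integral>\<^sup>+y. f (\<lambda>j\<in>J. - y j) \<partial>lborel_on J)"
    by (subst nn_integral_cmult) (auto simp: mult.commute)
  finally show ?thesis .
qed

section \<open>Fundamental domains of the integer lattice\<close>

lemma emeasure_unit_cube: "finite I \<Longrightarrow> emeasure (lborel_on I) (I \<rightarrow>\<^sub>E {0..<1}) = 1"
  by (subst lborel_on.emeasure_PiM) auto

lemma countable_integer_functions: "finite I \<Longrightarrow> countable (I \<rightarrow>\<^sub>E (\<int> :: real set))"
  by (intro countable_PiE) (auto simp: Ints_def)

text \<open>The unit cube \<open>C\<close> and the preimage \<open>D\<close> of the target cube both
  meet every orbit of translation by integer vectors exactly once; for \<open>D\<close> this holds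
  because \<open>M\<close> matches the integer vectors of \<open>I\<close> with those of
  \<open>J\<close>. Cutting \<open>D\<close> into countably many pieces according to the translation
  that moves a point into \<open>C\<close>, and moving each piece there, reassembles
  \<open>C\<close>.\<close>

lemma emeasure_fundamental_domain:
  fixes M :: "('i \<Rightarrow> real) \<Rightarrow> ('j \<Rightarrow> real)"
  assumes fin: "finite I" "finite J"
    and M [measurable]: "M \<in> lborel_on I \<rightarrow>\<^sub>M lborel_on J"
    and add: "\<And>x y. x \<in> I \<rightarrow>\<^sub>E UNIV \<Longrightarrow> y \<in> I \<rightarrow>\<^sub>E UNIV \<Longrightarrow>
      M (\<lambda>i\<in>I. x i + y i) = (\<lambda>j\<in>J. M x j + M y j)"
    and bij: "bij_betw M (I \<rightarrow>\<^sub>E \<int>) (J \<rightarrow>\<^sub>E \<int>)"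
  shows "emeasure (lborel_on I) (M -` (J \<rightarrow>\<^sub>E {0..<1}) \<inter> space (lborel_on I)) = 1"
proof -
  let ?P = "lborel_on I"
  define Z where "Z = I \<rightarrow>\<^sub>E (\<int> :: real set)"
  define C where "C = I \<rightarrow>\<^sub>E {0..<1::real}"
  define D where "D = M -` (J \<rightarrow>\<^sub>E {0..<1}) \<inter> space ?P"
  define tr where "tr z = (\<lambda>x. \<lambda>i\<in>I. x i + z i :: real)" for z :: "'i \<Rightarrow> real"
  have Zc: "countable Z" unfolding Z_def by (rule countable_integer_functions[OF fin(1)])
  have ZU: "z \<in> I \<rightarrow>\<^sub>E UNIV" if "z \<in> Z" for z
    using that by (auto simp: Z_def PiE_iff)
  have Cm [measurable]: "C \<in> sets ?P"
    unfolding C_def using fin by (intro sets_PiM_I_finite) auto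
  have "(J \<rightarrow>\<^sub>E {0..<1}) \<in> sets (lborel_on J)"
    using fin by (intro sets_PiM_I_finite) auto
  then have Dm [measurable]: "D \<in> sets ?P"
    unfolding D_def by measurable
  have trm [measurable]: "tr z \<in> ?P \<rightarrow>\<^sub>M ?P" for z
    unfolding tr_def by (rule measurable_translate)
  have CU: "x \<in> space ?P" if "x \<in> C" for x
    using that by (auto simp: C_def space_lborel_on PiE_iff)
  have Mx: "M x \<in> J \<rightarrow>\<^sub>E UNIV" if "x \<in> I \<rightarrow>\<^sub>E UNIV" for x
    using measurable_space[OF M] that by (simp add: space_lborel_on)
  have floorC: "{0..<1::real} = {x. \<lfloor>x\<rfloor> = 0}"
    by (auto simp: floor_eq_iff)
  \<comment> \<open>The translation into a half-open unit cube is forced: it subtracts the integer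
    part of each coordinate.\<close>
  have inC: "tr z x \<in> C \<longleftrightarrow> (\<forall>i\<in>I. z i = - of_int \<lfloor>x i\<rfloor>)" if "z \<in> Z" for z x
  proof -
    have "x i + z i \<in> {0..<1} \<longleftrightarrow> z i = - of_int \<lfloor>x i\<rfloor>" if "i \<in> I" for i
    proof -
      have "z i \<in> \<int>" using that \<open>z \<in> Z\<close> by (auto simp: Z_def)
      then obtain k where "z i = of_int k" by (auto elim: Ints_cases)
      then show ?thesis unfolding floorC by (auto simp flip: of_int_minus)
    qed
    then show ?thesis by (auto simp: tr_def C_def PiE_iff)
  qed
  have MzI: "M z j \<in> \<int>" if "z \<in> Z" "j \<in> J" for z j
    using bij that unfolding Z_def by (auto dest!: bij_betwE simp: PiE_iff)
  have inD: "tr z x \<in> D \<longleftrightarrow> (\<forall>j\<in>J. M z j = - of_int \<lfloor>M x j\<rfloor>)"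
    if "z \<in> Z" "x \<in> I \<rightarrow>\<^sub>E UNIV" for z x
  proof -
    have "M x j + M z j \<in> {0..<1} \<longleftrightarrow> M z j = - of_int \<lfloor>M x j\<rfloor>" if j: "j \<in> J" for j
    proof -
      obtain k where "M z j = of_int k" using MzI[OF \<open>z \<in> Z\<close> j] by (auto elim: Ints_cases)
      then show ?thesis unfolding floorC by (auto simp flip: of_int_minus)
    qed
    moreover have "M (tr z x) = (\<lambda>j\<in>J. M x j + M z j)"
      unfolding tr_def by (rule add[OF that(2) ZU[OF that(1)]])
    moreover have "tr z x \<in> space ?P" by (simp add: tr_def space_lborel_on)
    ultimately show ?thesis by (auto simp: D_def PiE_iff)
  qed
  have exC: "\<exists>!z. z \<in> Z \<and> tr z x \<in> C" for x
  proof (rule ex1I[of _ "\<lambda>i\<in>I. - of_int \<lfloor>x i\<rfloor>"])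
    show "(\<lambda>i\<in>I. - of_int \<lfloor>x i\<rfloor>) \<in> Z \<and> tr (\<lambda>i\<in>I. - of_int \<lfloor>x i\<rfloor>) x \<in> C"
      by (subst inC) (auto simp: Z_def)
    fix z assume "z \<in> Z \<and> tr z x \<in> C"
    then show "z = (\<lambda>i\<in>I. - of_int \<lfloor>x i\<rfloor>)"
      using inC[of z x] by (auto simp: Z_def fun_eq_iff PiE_iff extensional_def)
  qed
  have exD: "\<exists>!z. z \<in> Z \<and> tr z x \<in> D" if x: "x \<in> I \<rightarrow>\<^sub>E UNIV" for x
  proof -
    have "(\<lambda>j\<in>J. - of_int \<lfloor>M x j\<rfloor>) \<in> J \<rightarrow>\<^sub>E (\<int> :: real set)" by auto
    with bij obtain z where z: "z \<in> Z" "M z = (\<lambda>j\<in>J. - of_int \<lfloor>M x j\<rfloor>)"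
      unfolding Z_def bij_betw_def by (metis imageE)
    show ?thesis
    proof (rule ex1I[of _ z])
      show "z \<in> Z \<and> tr z x \<in> D" using z by (simp add: inD[OF z(1) x])
      fix z' assume z': "z' \<in> Z \<and> tr z' x \<in> D"
      have "M z' \<in> J \<rightarrow>\<^sub>E UNIV" using z' by (intro Mx ZU) simp
      moreover have "\<forall>j\<in>J. M z' j = - of_int \<lfloor>M x j\<rfloor>"
        using z' inD[of z' x] x by blast
      ultimately have "M z' = M z"
        unfolding z(2) by (intro ext) (auto simp: PiE_iff extensional_def)
      then show "z' = z"
        using bij z z' unfolding Z_def bij_betw_def inj_on_def by blast
    qed
  qed
  have C_ex: "\<exists>z\<in>Z. tr z x \<in> C" for x
    using exC[of x] by metis
  have C_unique: "z = z'" if "z \<in> Z" "tr z x \<in> C" "z' \<in> Z" "tr z' x \<in> C" for z z' x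
    using that by (metis exC)
  have D_ex: "\<exists>z\<in>Z. tr z x \<in> D" if "x \<in> space ?P" for x
    using exD[of x] that unfolding space_lborel_on by (metis)
  have D_unique: "z = z'"
    if "x \<in> space ?P" "z \<in> Z" "tr z x \<in> D" "z' \<in> Z" "tr z' x \<in> D" for z z' x
    using that exD[of x] unfolding space_lborel_on by (metis)
  have DP: "x \<in> space ?P" if "x \<in> D" for x
    using that by (simp add: D_def)
  have "emeasure ?P D = emeasure ?P (\<Union>z\<in>Z. D \<inter> (tr z -` C \<inter> space ?P))"
  proof (rule arg_cong[where f="emeasure ?P"])
    show "D = (\<Union>z\<in>Z. D \<inter> (tr z -` C \<inter> space ?P))"
      using C_ex DP by auto
  qed
  also have "\<dots> = (\<integral>\<^sup>+z. emeasure ?P (D \<inter> (tr z -` C \<inter> space ?P)) \<partial>count_space Z)"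
  proof (rule emeasure_UN_countable[OF _ Zc])
    show "disjoint_family_on (\<lambda>z. D \<inter> (tr z -` C \<inter> space ?P)) Z"
      unfolding disjoint_family_on_def using C_unique by auto
  qed measurable
  \<comment> \<open>Moved by \<open>z\<close>, the piece of \<open>D\<close> becomes the part of
    \<open>C\<close> that the opposite translation sends into \<open>D\<close>.\<close>
  also have "\<dots> = (\<integral>\<^sup>+z. emeasure ?P (C \<inter> (tr (\<lambda>i\<in>I. - z i) -` D \<inter> space ?P)) \<partial>count_space Z)"
  proof (rule nn_integral_cong)
    fix z assume "z \<in> space (count_space Z)"
    then have z: "z \<in> Z" by simp
    let ?z = "\<lambda>i\<in>I. - z i"
    have zz: "tr z (tr ?z x) = x" "tr ?z (tr z x) = x" if "x \<in> I \<rightarrow>\<^sub>E UNIV" for x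
      using that by (auto simp: tr_def fun_eq_iff PiE_iff extensional_def)
    have "emeasure ?P (D \<inter> (tr z -` C \<inter> space ?P)) =
        emeasure (distr ?P ?P (tr ?z)) (D \<inter> (tr z -` C \<inter> space ?P))"
      unfolding tr_def by (simp only: distr_translate[OF fin(1)])
    also have "\<dots> = emeasure ?P (tr ?z -` (D \<inter> (tr z -` C \<inter> space ?P)) \<inter> space ?P)"
      by (rule emeasure_distr) measurable
    also have "tr ?z -` (D \<inter> (tr z -` C \<inter> space ?P)) \<inter> space ?P = C \<inter> (tr ?z -` D \<inter> space ?P)"
      using CU zz by (auto simp: space_lborel_on tr_def)
    finally show "emeasure ?P (D \<inter> (tr z -` C \<inter> space ?P)) =
        emeasure ?P (C \<inter> (tr ?z -` D \<inter> space ?P))" .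
  qed
  also have "\<dots> = (\<integral>\<^sup>+z. emeasure ?P (C \<inter> (tr z -` D \<inter> space ?P)) \<partial>count_space Z)"
  proof -
    have "bij_betw (\<lambda>z. \<lambda>i\<in>I. - z i) Z Z"
      by (rule bij_betwI[where g="\<lambda>z. \<lambda>i\<in>I. - z i"])
        (auto simp: Z_def fun_eq_iff PiE_iff extensional_def)
    from nn_integral_bij_count_space[OF this] show ?thesis .
  qed
  also have "\<dots> = emeasure ?P (\<Union>z\<in>Z. C \<inter> (tr z -` D \<inter> space ?P))"
  proof (rule emeasure_UN_countable[OF _ Zc, symmetric])
    show "disjoint_family_on (\<lambda>z. C \<inter> (tr z -` D \<inter> space ?P)) Z"
      unfolding disjoint_family_on_def using D_unique by auto
  qed measurable
  also have "\<dots> = emeasure ?P C"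
  proof (rule arg_cong[where f="emeasure ?P"])
    show "(\<Union>z\<in>Z. C \<inter> (tr z -` D \<inter> space ?P)) = C"
      using D_ex CU by auto
  qed
  also have "\<dots> = 1"
    unfolding C_def by (rule emeasure_unit_cube[OF fin(1)])
  finally show ?thesis unfolding D_def .
qed

text \<open>In the exchange identity take \<open>g\<close> to be the indicator of the unit cube:
  both integrals of \<open>g\<close> equal 1, one of them by the fundamental domain. This identifies
  the image measure with Lebesgue measure reflected at the origin. The two index types may differ,
  as no matrix is involved.\<close>

theorem distr_unimodular:
  fixes M :: "('i \<Rightarrow> real) \<Rightarrow> ('j \<Rightarrow> real)"
  assumes fin: "finite I" "finite J"
    and M [measurable]: "M \<in> lborel_on I \<rightarrow>\<^sub>M lborel_on J"
    and add: "\<And>x y. x \<in> I \<rightarrow>\<^sub>E UNIV \<Longrightarrow> y \<in> I \<rightarrow>\<^sub>E UNIV \<Longrightarrow>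
      M (\<lambda>i\<in>I. x i + y i) = (\<lambda>j\<in>J. M x j + M y j)"
    and surj: "J \<rightarrow>\<^sub>E UNIV \<subseteq> M ` (I \<rightarrow>\<^sub>E UNIV)"
    and bij: "bij_betw M (I \<rightarrow>\<^sub>E \<int>) (J \<rightarrow>\<^sub>E \<int>)"
  shows "distr (lborel_on I) (lborel_on J) M = lborel_on J"
proof (rule measure_eqI)
  fix A assume "A \<in> sets (distr (lborel_on I) (lborel_on J) M)"
  then have A [measurable]: "A \<in> sets (lborel_on J)" by simp
  define C where "C = J \<rightarrow>\<^sub>E {0..<1::real}"
  have C [measurable]: "C \<in> sets (lborel_on J)"
    unfolding C_def using fin by (intro sets_PiM_I_finite) auto
  have C1: "(\<integral>\<^sup>+y. indicator C y \<partial>lborel_on J) = 1"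
    using emeasure_unit_cube[OF fin(2)] unfolding nn_integral_indicator[OF C] by (simp add: C_def)
  have ind: "(\<integral>\<^sup>+x. indicator B (M x) \<partial>lborel_on I) =
      emeasure (lborel_on I) (M -` B \<inter> space (lborel_on I))" if [measurable]: "B \<in> sets (lborel_on J)" for B
  proof -
    have "(\<integral>\<^sup>+x. indicator B (M x) \<partial>lborel_on I) =
        (\<integral>\<^sup>+x. indicator (M -` B \<inter> space (lborel_on I)) x \<partial>lborel_on I)"
      by (intro nn_integral_cong) (auto simp: indicator_def)
    then show ?thesis by simp
  qed
  have "emeasure (distr (lborel_on I) (lborel_on J) M) A = (\<integral>\<^sup>+x. indicator A (M x) \<partial>lborel_on I)"
    unfolding ind[OF A] by (rule emeasure_distr) measurable
  also have "\<dots> = (\<integral>\<^sup>+y. indicator A (\<lambda>j\<in>J. - y j) \<partial>lborel_on J)"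
  proof -
    have "(\<integral>\<^sup>+x. indicator C (M x) \<partial>lborel_on I) = 1"
      unfolding ind[OF C] unfolding C_def by (rule emeasure_fundamental_domain[OF fin M add bij])
    moreover have "(\<integral>\<^sup>+x. indicator A (M x) \<partial>lborel_on I) * (\<integral>\<^sup>+y. indicator C y \<partial>lborel_on J) =
        (\<integral>\<^sup>+x. indicator C (M x) \<partial>lborel_on I) * (\<integral>\<^sup>+y. indicator A (\<lambda>j\<in>J. - y j) \<partial>lborel_on J)"
      by (rule nn_integral_additive_exchange[OF fin M add surj]) measurable
    ultimately show ?thesis unfolding C1 by simp
  qed
  \<comment> \<open>The exchange identity for the identity map shows that reflection preserves the
    measure.\<close>
  also have "\<dots> = (\<integral>\<^sup>+y. indicator A y \<partial>lborel_on J)"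
  proof -
    have "(\<integral>\<^sup>+y. indicator A y \<partial>lborel_on J) * (\<integral>\<^sup>+y. indicator C y \<partial>lborel_on J) =
        (\<integral>\<^sup>+y. indicator C y \<partial>lborel_on J) * (\<integral>\<^sup>+y. indicator A (\<lambda>j\<in>J. - y j) \<partial>lborel_on J)"
      by (rule nn_integral_additive_exchange[OF fin(2,2), of "\<lambda>x. x"]) (auto simp: C A)
    then show ?thesis unfolding C1 by simp
  qed
  also have "\<dots> = emeasure (lborel_on J) A"
    by simp
  finally show "emeasure (distr (lborel_on I) (lborel_on J) M) A = emeasure (lborel_on J) A" .
qed simp

section \<open>Flows with respect to a spanning tree\<close>

locale arc_ends =
  fixes src tgt :: "'e \<Rightarrow> nat"
begin

text \<open>Every vertex that is the tail of an arc has exactly one tree arc going out; sinks have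
  none. Phrased through tails only, the condition survives at every stage of the arc-by-arc
  induction, when most vertices still have no arc.\<close>

definition rooted :: "'e set \<Rightarrow> 'e set \<Rightarrow> bool" where
  "rooted E T \<longleftrightarrow> finite E \<and> T \<subseteq> E \<and> (\<forall>e\<in>E. src e < tgt e) \<and> inj_on src T \<and> src ` E \<subseteq> src ` T"

definition divergence :: "'e set \<Rightarrow> ('e \<Rightarrow> real) \<Rightarrow> nat \<Rightarrow> real" where
  "divergence E b j = (\<Sum>e | e \<in> E \<and> src e = j. b e) - (\<Sum>e | e \<in> E \<and> tgt e = j. b e)"

text \<open>
  The flow on the tree arc out of \<open>j\<close>, given the flow \<open>x\<close> on the other arcs and the net flow \<open>a\<close>. The
  guard \<open>src e < j\<close> only serves termination: it holds for all arcs of a \<open>rooted\<close> set.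
\<close>

function tree_flow :: "'e set \<Rightarrow> 'e set \<Rightarrow> (nat \<Rightarrow> real) \<Rightarrow> ('e \<Rightarrow> real) \<Rightarrow> nat \<Rightarrow> real" where
  "tree_flow E T a x j = a j
    + (\<Sum>e | e \<in> E \<and> tgt e = j \<and> src e < j. if e \<in> T then tree_flow E T a x (src e) else x e)
    - (\<Sum>e | e \<in> E \<and> src e = j \<and> e \<notin> T. x e)"
  by pat_completeness auto
termination
  by (relation "Wellfounded.measure (\<lambda>(E, T, a, x, j). j)") auto

declare tree_flow.simps [simp del]

definition flow_of :: "'e set \<Rightarrow> 'e set \<Rightarrow> (nat \<Rightarrow> real) \<Rightarrow> ('e \<Rightarrow> real) \<Rightarrow> 'e \<Rightarrow> real" where
  "flow_of E T a x = (\<lambda>e\<in>E. if e \<in> T then tree_flow E T a x (src e) else x e)"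

text \<open>Remove an arc whose tail is the smallest tail \<open>k\<close>, preferring a nontree
  arc. No arc enters \<open>k\<close>, since its tail would be smaller still. Read backwards, this
  inserts arcs from the largest tail down, the tree arc first at each vertex.\<close>

lemma rooted_induct [consumes 1, case_names empty tree nontree]:
  assumes "rooted E T"
    and "P {} {}"
    and "\<And>E T e. rooted E T \<Longrightarrow> e \<notin> E \<Longrightarrow> src e < tgt e \<Longrightarrow> src e \<notin> tgt ` E \<Longrightarrow> src e \<notin> src ` E \<Longrightarrow>
      P E T \<Longrightarrow> P (insert e E) (insert e T)"
    and "\<And>E T e. rooted E T \<Longrightarrow> e \<notin> E \<Longrightarrow> src e < tgt e \<Longrightarrow> src e \<notin> tgt ` E \<Longrightarrow> src e \<in> src ` T \<Longrightarrow>
      P E T \<Longrightarrow> P (insert e E) T"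
  shows "P E T"
  using assms(1)
proof (induction "card E" arbitrary: E T rule: less_induct)
  case less
  note r = less.prems[unfolded rooted_def]
  have fin: "finite E" using r by blast
  show ?case
  proof (cases "E = {}")
    case True
    then show ?thesis using r assms(2) by auto
  next
    case False
    define k where "k = Min (src ` E)"
    have k: "k \<in> src ` E" unfolding k_def using False fin by (intro Min_in) auto
    have kmin: "k \<le> src e" if "e \<in> E" for e
      unfolding k_def using that fin by (intro Min_le) auto
    have ktgt: "k \<notin> tgt ` E" using r kmin by fastforce
    show ?thesis
    proof (cases "\<exists>e\<in>E. src e = k \<and> e \<notin> T")
      case True
      then obtain e where e: "e \<in> E" "src e = k" "e \<notin> T" by blast
      have rE: "rooted (E - {e}) T"
        using r e unfolding rooted_def by auto
      have "P (insert e (E - {e})) T"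
      proof (rule assms(4)[OF rE])
        show "src e \<in> src ` T" using r e by blast
        show "P (E - {e}) T"
          by (rule less.hyps[OF card_Diff1_less[OF fin e(1)] rE])
      qed (use r e ktgt in auto)
      then show ?thesis using e by (simp add: insert_absorb)
    next
      case nonT: False
      from k obtain e where e: "e \<in> E" "src e = k" by blast
      with nonT have eT: "e \<in> T" by blast
      \<comment> \<open>The tree arc at \<open>k\<close> is removed only when no other arc leaves
        \<open>k\<close>, so every remaining tail keeps its tree arc.\<close>
      have other: "src e' \<noteq> k" if "e' \<in> E" "e' \<noteq> e" for e'
        using nonT that e eT r by (metis inj_onD)
      have rE: "rooted (E - {e}) (T - {e})"
        unfolding rooted_def
      proof (intro conjI)
        show "src ` (E - {e}) \<subseteq> src ` (T - {e})"
        proof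
          fix v assume "v \<in> src ` (E - {e})"
          then obtain e' where e': "e' \<in> E" "e' \<noteq> e" "v = src e'" by blast
          then obtain e'' where "e'' \<in> T" "src e'' = v" using r by (metis imageE imageI subsetD)
          then have "e'' \<noteq> e" using other[OF e'(1,2)] e(2) e'(3) by metis
          then show "v \<in> src ` (T - {e})" using \<open>e'' \<in> T\<close> \<open>src e'' = v\<close> by blast
        qed
        show "inj_on src (T - {e})" using r by (blast intro: inj_on_subset)
      qed (use r in auto)
      have "P (insert e (E - {e})) (insert e (T - {e}))"
      proof (rule assms(3)[OF rE])
        show "src e \<notin> src ` (E - {e})" using other e(2) by (metis DiffE imageE singletonI)
        show "P (E - {e}) (T - {e})"
          by (rule less.hyps[OF card_Diff1_less[OF fin e(1)] rE])
      qed (use r e ktgt in auto)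
      then show ?thesis using e eT by (simp add: insert_absorb)
    qed
  qed
qed

lemma divergence_flow_of:
  assumes "rooted E T" and "j \<in> src ` T"
  shows "divergence E (flow_of E T a x) j = a j"
proof -
  note r = assms(1)[unfolded rooted_def]
  obtain e where e: "e \<in> T" "src e = j" using assms(2) by blast
  have "{e' \<in> E. src e' = j} = insert e {e \<in> E. src e = j \<and> e \<notin> T}"
    using e r by (auto dest: inj_onD)
  then have "(\<Sum>e | e \<in> E \<and> src e = j. flow_of E T a x e) =
      flow_of E T a x e + (\<Sum>e | e \<in> E \<and> src e = j \<and> e \<notin> T. flow_of E T a x e)"
    using e r by simp
  moreover have "(\<Sum>e | e \<in> E \<and> src e = j \<and> e \<notin> T. flow_of E T a x e) =
      (\<Sum>e | e \<in> E \<and> src e = j \<and> e \<notin> T. x e)"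
    by (intro sum.cong) (auto simp: flow_of_def)
  moreover have "flow_of E T a x e = tree_flow E T a x j"
    using e r by (auto simp: flow_of_def)
  moreover have "(\<Sum>e | e \<in> E \<and> tgt e = j. flow_of E T a x e) =
      (\<Sum>e | e \<in> E \<and> tgt e = j \<and> src e < j. if e \<in> T then tree_flow E T a x (src e) else x e)"
    using r by (intro sum.cong) (auto simp: flow_of_def)
  ultimately show ?thesis
    unfolding divergence_def using tree_flow.simps[of E T a x j] by simp
qed

text \<open>Strong induction on the tail: the arcs entering \<open>j\<close> have smaller tails, so
  conservation at \<open>j\<close> leaves only the tree arc out of \<open>j\<close> to be
  determined.\<close>

lemma flow_of_unique:
  assumes "rooted E T" and b: "b \<in> E \<rightarrow>\<^sub>E UNIV"
    and div: "\<And>j. j \<in> src ` T \<Longrightarrow> divergence E b j = a j"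
    and x: "\<And>e. e \<in> E \<Longrightarrow> e \<notin> T \<Longrightarrow> x e = b e"
  shows "b = flow_of E T a x"
proof -
  note r = assms(1)[unfolded rooted_def]
  have tree: "b e = tree_flow E T a x (src e)" if "e \<in> T" for e
    using that
  proof (induction "src e" arbitrary: e rule: less_induct)
    case less
    define j where "j = src e"
    have "{e' \<in> E. src e' = j} = insert e {e \<in> E. src e = j \<and> e \<notin> T}"
      using less.prems r by (auto dest: inj_onD simp: j_def)
    then have "(\<Sum>e | e \<in> E \<and> src e = j. b e) = b e + (\<Sum>e | e \<in> E \<and> src e = j \<and> e \<notin> T. b e)"
      using less.prems r by simp
    also have "(\<Sum>e | e \<in> E \<and> src e = j \<and> e \<notin> T. b e) = (\<Sum>e | e \<in> E \<and> src e = j \<and> e \<notin> T. x e)"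
      using x by (intro sum.cong) auto
    finally have out: "(\<Sum>e | e \<in> E \<and> src e = j. b e) =
        b e + (\<Sum>e | e \<in> E \<and> src e = j \<and> e \<notin> T. x e)" .
    have "(\<Sum>e | e \<in> E \<and> tgt e = j. b e) =
      (\<Sum>e | e \<in> E \<and> tgt e = j \<and> src e < j. if e \<in> T then tree_flow E T a x (src e) else x e)"
      using r x less.hyps by (intro sum.cong) (auto simp: j_def)
    with out div[of j] less.prems show ?case
      using tree_flow.simps[of E T a x j] unfolding divergence_def j_def by simp
  qed
  show ?thesis
    using b tree x by (auto simp: flow_of_def fun_eq_iff PiE_iff extensional_def)
qed

text \<open>The recursion adds and subtracts but never divides. This is why the nontree coordinates
  of integer flows form the full integer lattice.\<close>

lemma tree_flow_Ints:
  assumes "\<And>j. a j \<in> \<int>" and "\<And>e. e \<in> E \<Longrightarrow> e \<notin> T \<Longrightarrow> x e \<in> \<int>"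
  shows "tree_flow E T a x j \<in> \<int>"
proof (induction j rule: less_induct)
  case (less j)
  show ?case
    by (subst tree_flow.simps) (use assms less in \<open>auto intro!: Ints_add Ints_diff Ints_sum\<close>)
qed

lemma measurable_tree_flow [measurable]:
  "(\<lambda>x. tree_flow E T a x j) \<in> borel_measurable (lborel_on (E - T))"
proof (induction j rule: less_induct)
  case (less j)
  show ?case
  proof (subst tree_flow.simps, intro borel_measurable_add borel_measurable_diff
      borel_measurable_sum borel_measurable_const)
    fix e assume e: "e \<in> {e \<in> E. tgt e = j \<and> src e < j}"
    show "(\<lambda>x. if e \<in> T then tree_flow E T a x (src e) else x e) \<in> borel_measurable (lborel_on (E - T))"
      using less[of "src e"] e by (cases "e \<in> T") auto
  next
    fix e assume e: "e \<in> {e \<in> E. src e = j \<and> e \<notin> T}"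
    then show "(\<lambda>x. x e) \<in> borel_measurable (lborel_on (E - T))"
      by auto
  qed
qed

section \<open>Tree flows after the insertion of one arc\<close>

lemma tree_flow_insert_nontree:
  assumes "finite E" "e \<notin> E" "e \<notin> T" "src e < tgt e"
  shows "tree_flow (insert e E) T a (x(e := y)) v =
    tree_flow E T (a(src e := a (src e) - y, tgt e := a (tgt e) + y)) x v"
proof (induction v rule: less_induct)
  case (less v)
  let ?a = "a(src e := a (src e) - y, tgt e := a (tgt e) + y)"
  let ?f = "\<lambda>e'. if e' \<in> T then tree_flow (insert e E) T a (x(e := y)) (src e') else (x(e := y)) e'"
  have "(\<Sum>e' | e' \<in> insert e E \<and> tgt e' = v \<and> src e' < v. ?f e') =
      (\<Sum>e' | e' \<in> E \<and> tgt e' = v \<and> src e' < v. ?f e') + (if tgt e = v then y else 0)"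
  proof -
    have "{e' \<in> insert e E. tgt e' = v \<and> src e' < v} = (if tgt e = v
        then insert e {e' \<in> E. tgt e' = v \<and> src e' < v} else {e' \<in> E. tgt e' = v \<and> src e' < v})"
      using assms by auto
    then show ?thesis using assms by (simp del: fun_upd_apply add: fun_upd_same)
  qed
  also have "(\<Sum>e' | e' \<in> E \<and> tgt e' = v \<and> src e' < v. ?f e') =
      (\<Sum>e' | e' \<in> E \<and> tgt e' = v \<and> src e' < v. if e' \<in> T then tree_flow E T ?a x (src e') else x e')"
  proof (intro sum.cong refl)
    fix e' assume e': "e' \<in> {e' \<in> E. tgt e' = v \<and> src e' < v}"
    then have "e' \<noteq> e" using assms by auto
    moreover have "tree_flow (insert e E) T a (x(e := y)) (src e') = tree_flow E T ?a x (src e')"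
      using e' by (intro less) simp
    ultimately show "?f e' = (if e' \<in> T then tree_flow E T ?a x (src e') else x e')"
      by (simp del: fun_upd_apply add: fun_upd_other)
  qed
  finally have 1: "(\<Sum>e' | e' \<in> insert e E \<and> tgt e' = v \<and> src e' < v. ?f e') =
      (\<Sum>e' | e' \<in> E \<and> tgt e' = v \<and> src e' < v. if e' \<in> T then tree_flow E T ?a x (src e') else x e') + (if tgt e = v then y else 0)" .
  have "(\<Sum>e' | e' \<in> insert e E \<and> src e' = v \<and> e' \<notin> T. (x(e := y)) e') =
      (\<Sum>e' | e' \<in> E \<and> src e' = v \<and> e' \<notin> T. (x(e := y)) e') + (if src e = v then y else 0)"
  proof -
    have "{e' \<in> insert e E. src e' = v \<and> e' \<notin> T} = (if src e = v
        then insert e {e' \<in> E. src e' = v \<and> e' \<notin> T} else {e' \<in> E. src e' = v \<and> e' \<notin> T})"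
      using assms by auto
    then show ?thesis using assms by (simp del: fun_upd_apply add: fun_upd_same)
  qed
  also have "(\<Sum>e' | e' \<in> E \<and> src e' = v \<and> e' \<notin> T. (x(e := y)) e') =
      (\<Sum>e' | e' \<in> E \<and> src e' = v \<and> e' \<notin> T. x e')"
    using assms by (intro sum.cong) auto
  finally have 2: "(\<Sum>e' | e' \<in> insert e E \<and> src e' = v \<and> e' \<notin> T. (x(e := y)) e') =
      (\<Sum>e' | e' \<in> E \<and> src e' = v \<and> e' \<notin> T. x e') + (if src e = v then y else 0)" .
  have 3: "?a v = a v + (if tgt e = v then y else 0) - (if src e = v then y else 0)"
    using assms(4) by auto
  show ?case
    unfolding tree_flow.simps[of "insert e E" T a "x(e := y)" v] tree_flow.simps[of E T ?a x v] 1 2 3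
    by simp
qed

text \<open>No arc of \<open>E\<close> touches \<open>src e\<close>, so the new tree arc carries all
  of \<open>a (src e)\<close>. That entry is not cleared in the changed vector: at
  \<open>src e\<close> both sides equal \<open>a (src e)\<close>, and no other vertex reads
  it.\<close>

lemma tree_flow_insert_tree:
  assumes "finite E" "e \<notin> E" "T \<subseteq> E" "src e < tgt e" "src e \<notin> tgt ` E" "src e \<notin> src ` E"
  shows "tree_flow (insert e E) (insert e T) a x v =
    tree_flow E T (a(tgt e := a (tgt e) + a (src e))) x v"
proof (induction v rule: less_induct)
  case (less v)
  let ?a = "a(tgt e := a (tgt e) + a (src e))"
  have src: "tree_flow E T ?a x (src e) = a (src e)"
  proof -
    have 1: "{e' \<in> E. tgt e' = src e \<and> src e' < src e} = {}" using assms by (auto simp: image_iff)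
    have 2: "{e' \<in> E. src e' = src e \<and> e' \<notin> T} = {}" using assms by (auto simp: image_iff)
    show ?thesis using assms(4) by (subst tree_flow.simps) (simp only: 1 2, simp)
  qed
  let ?f = "\<lambda>e'. if e' \<in> insert e T then tree_flow (insert e E) (insert e T) a x (src e') else x e'"
  have "(\<Sum>e' | e' \<in> insert e E \<and> tgt e' = v \<and> src e' < v. ?f e') =
      (\<Sum>e' | e' \<in> E \<and> tgt e' = v \<and> src e' < v. ?f e') + (if tgt e = v then ?f e else 0)"
  proof -
    have "{e' \<in> insert e E. tgt e' = v \<and> src e' < v} = (if tgt e = v
        then insert e {e' \<in> E. tgt e' = v \<and> src e' < v} else {e' \<in> E. tgt e' = v \<and> src e' < v})"
      using assms by auto
    then show ?thesis using assms by (simp del: fun_upd_apply add: fun_upd_same)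
  qed
  also have "(\<Sum>e' | e' \<in> E \<and> tgt e' = v \<and> src e' < v. ?f e') =
      (\<Sum>e' | e' \<in> E \<and> tgt e' = v \<and> src e' < v. if e' \<in> T then tree_flow E T ?a x (src e') else x e')"
  proof (intro sum.cong refl)
    fix e' assume e': "e' \<in> {e' \<in> E. tgt e' = v \<and> src e' < v}"
    then have "e' \<noteq> e" using assms by auto
    moreover have "tree_flow (insert e E) (insert e T) a x (src e') = tree_flow E T ?a x (src e')"
      using e' by (intro less) simp
    ultimately show "?f e' = (if e' \<in> T then tree_flow E T ?a x (src e') else x e')"
      by (simp del: fun_upd_apply)
  qed
  also have "(if tgt e = v then ?f e else 0) = (if tgt e = v then a (src e) else 0)"
    using less[of "src e"] src assms(4) by (simp del: fun_upd_apply)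
  finally have 1: "(\<Sum>e' | e' \<in> insert e E \<and> tgt e' = v \<and> src e' < v. ?f e') =
      (\<Sum>e' | e' \<in> E \<and> tgt e' = v \<and> src e' < v. if e' \<in> T then tree_flow E T ?a x (src e') else x e') + (if tgt e = v then a (src e) else 0)" .
  have 2: "{e' \<in> insert e E. src e' = v \<and> e' \<notin> insert e T} = {e' \<in> E. src e' = v \<and> e' \<notin> T}"
    using assms by auto
  have 3: "?a v = a v + (if tgt e = v then a (src e) else 0)"
    by auto
  show ?case
    unfolding tree_flow.simps[of "insert e E" "insert e T" a x v] tree_flow.simps[of E T ?a x v] 1 2 3
    by simp
qed

definition reduced :: "'e set \<Rightarrow> 'e set \<Rightarrow> (nat \<Rightarrow> real) \<Rightarrow> ('e \<Rightarrow> real) set" where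
  "reduced E T a = {x \<in> E - T \<rightarrow>\<^sub>E UNIV. (\<forall>e\<in>E - T. 0 \<le> x e) \<and> (\<forall>e\<in>T. 0 \<le> tree_flow E T a x (src e))}"

lemma sets_reduced [measurable]:
  assumes "finite E" "T \<subseteq> E"
  shows "reduced E T a \<in> sets (lborel_on (E - T))"
proof -
  have [simp]: "finite T" using assms by (rule finite_subset[rotated])
  have "reduced E T a = {x \<in> space (lborel_on (E - T)).
      (\<forall>e\<in>E - T. 0 \<le> x e) \<and> (\<forall>e\<in>T. 0 \<le> tree_flow E T a x (src e))}"
    by (auto simp: reduced_def space_lborel_on)
  also have "\<dots> \<in> sets (lborel_on (E - T))"
    using assms by (intro sets.sets_Collect_conj sets.sets_Collect_finite_All borel_measurable_le
        measurable_tree_flow measurable_component_singleton borel_measurable_const) auto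
  finally show ?thesis .
qed

end

section \<open>Divided powers\<close>

text \<open>With the factorial in the denominator, the binomial theorem and the beta integral have
  no numerical coefficients, hence neither has the resulting sum.\<close>

definition divpow :: "real \<Rightarrow> nat \<Rightarrow> real" where
  "divpow x k = x ^ k / fact k"

lemma divpow_0 [simp]: "divpow x 0 = 1"
  by (simp add: divpow_def)

lemma divpow_zero: "divpow 0 k = (if k = 0 then 1 else 0)"
  by (simp add: divpow_def)

lemma divpow_nonneg: "0 \<le> x \<Longrightarrow> 0 \<le> divpow x k"
  by (simp add: divpow_def)

lemma divpow_add: "divpow (x + y) r = (\<Sum>c\<le>r. divpow x c * divpow y (r - c))"
proof -
  have "divpow (x + y) r = (\<Sum>c\<le>r. of_nat (r choose c) * x ^ c * y ^ (r - c) / fact r)"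
    unfolding divpow_def binomial_ring by (simp add: sum_divide_distrib)
  also have "\<dots> = (\<Sum>c\<le>r. divpow x c * divpow y (r - c))"
    by (intro sum.cong) (auto simp: divpow_def binomial_fact field_simps)
  finally show ?thesis .
qed

lemma divpow_has_field_derivative:
  "((\<lambda>y. divpow y (Suc k)) has_field_derivative divpow y k) (at y within S)"
proof -
  have "((\<lambda>y. y ^ Suc k / fact (Suc k)) has_field_derivative
      real (Suc k) * y ^ (Suc k - Suc 0) / fact (Suc k)) (at y within S)"
    by (rule DERIV_cdivide[OF DERIV_pow])
  moreover have "real (Suc k) * y ^ (Suc k - Suc 0) / fact (Suc k) = divpow y k"
    unfolding divpow_def fact_Suc of_nat_mult by (simp del: of_nat_Suc)
  ultimately show ?thesis by (simp add: divpow_def del: fact_Suc power_Suc)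
qed

text \<open>Induction on \<open>s\<close> by integration by parts, each step trading one power of
  \<open>A - y\<close> for one of \<open>y\<close>.\<close>

lemma has_integral_divpow_beta:
  assumes "0 \<le> A"
  shows "((\<lambda>y. divpow y c * divpow (A - y) s) has_integral divpow A (c + s + 1)) {0..A}"
proof (induction s arbitrary: c)
  case 0
  have "((\<lambda>y. divpow y c) has_integral divpow A (Suc c) - divpow 0 (Suc c)) {0..A}"
    by (rule fundamental_theorem_of_calculus[OF assms])
      (simp add: divpow_has_field_derivative flip: has_real_derivative_iff_has_vector_derivative)
  then show ?case by (simp add: divpow_zero)
next
  case (Suc s)
  have D: "((\<lambda>y. divpow (A - y) (Suc s)) has_field_derivative - divpow (A - y) s) (at y within S)" for y S
  proof -
    have "((\<lambda>y. A - y) has_field_derivative -1) (at y within S)"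
      by (auto intro!: derivative_eq_intros)
    from DERIV_chain2[OF divpow_has_field_derivative this] show ?thesis by simp
  qed
  \<comment> \<open>The derivative of \<open>divpow y (Suc c) * divpow (A - y) (Suc s)\<close>. Both
    boundary terms vanish, since each contains a positive power of 0. Adding the induction
    hypothesis for \<open>Suc c\<close> cancels the negative summand.\<close>
  have "((\<lambda>y. divpow y (Suc c) * (- divpow (A - y) s) + divpow y c * divpow (A - y) (Suc s))
      has_integral divpow A (Suc c) * divpow (A - A) (Suc s) - divpow 0 (Suc c) * divpow (A - 0) (Suc s)) {0..A}"
  proof (rule fundamental_theorem_of_calculus[OF assms])
    fix y
    have "((\<lambda>y. divpow y (Suc c) * divpow (A - y) (Suc s)) has_field_derivative
        divpow y (Suc c) * (- divpow (A - y) s) + divpow y c * divpow (A - y) (Suc s)) (at y within {0..A})"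
      by (rule DERIV_mult'[OF divpow_has_field_derivative D])
    then show "((\<lambda>y. divpow y (Suc c) * divpow (A - y) (Suc s)) has_vector_derivative
        divpow y (Suc c) * (- divpow (A - y) s) + divpow y c * divpow (A - y) (Suc s)) (at y within {0..A})"
      by (simp add: has_real_derivative_iff_has_vector_derivative)
  qed
  from has_integral_add[OF this Suc[of "Suc c"]] show ?case
    by (simp add: divpow_zero)
qed

text \<open>Expand the second factor by the binomial theorem and apply the beta integral termwise.
  The index \<open>c\<close> becomes the multiplicity of the inserted nontree arc, and the extra 1
  in the exponent is the one counted in \<open>excess\<close> for such an arc.\<close>

lemma has_integral_divpow_shift:
  assumes "0 \<le> A"
  shows "((\<lambda>y. divpow (A - y) s * divpow (B + y) r) has_integral
    (\<Sum>c\<le>r. divpow A (s + c + 1) * divpow B (r - c))) {0..A}"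
proof -
  have "((\<lambda>y. \<Sum>c\<le>r. divpow y c * divpow (A - y) s * divpow B (r - c)) has_integral
    (\<Sum>c\<le>r. divpow A (c + s + 1) * divpow B (r - c))) {0..A}"
    by (intro has_integral_sum has_integral_mult_left has_integral_divpow_beta assms) auto
  moreover have "(\<Sum>c\<le>r. divpow y c * divpow (A - y) s * divpow B (r - c)) =
      divpow (A - y) s * divpow (B + y) r" for y
    unfolding add.commute[of B] divpow_add sum_distrib_left by (simp add: ac_simps)
  ultimately show ?thesis by (simp add: add.commute)
qed

section \<open>The volume of the polytope of reduced flows\<close>

context arc_ends
begin

text \<open>
  \<open>\<kappa> e\<close> is the power of the flow on \<open>e\<close> that the binomial expansion selects when \<open>e\<close> is inserted. It
  lowers the exponent at the head of \<open>e\<close> and raises the one at the tail, where integration over the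
  flow on a non-tree arc adds 1 more; the resulting exponent at \<open>v\<close> is \<open>excess E T \<kappa> v\<close>.
\<close>

definition excess :: "'e set \<Rightarrow> 'e set \<Rightarrow> ('e \<Rightarrow> nat) \<Rightarrow> nat \<Rightarrow> int" where
  "excess E T \<kappa> v = (\<Sum>e | e \<in> E \<and> src e = v. int (\<kappa> e) + (if e \<in> T then 0 else 1))
    - (\<Sum>e | e \<in> E \<and> tgt e = v. int (\<kappa> e))"

definition admissible :: "'e set \<Rightarrow> 'e set \<Rightarrow> ('e \<Rightarrow> nat) set" where
  "admissible E T = {\<kappa> \<in> E \<rightarrow>\<^sub>E UNIV. \<forall>v. 0 \<le> excess E T \<kappa> v}"

text \<open>\<open>V\<close> is a separate parameter so that it stays fixed while arcs are inserted;
  a vertex that no arc touches yet has excess 0 and contributes the factor 1.\<close>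

definition lidskii_sum :: "'e set \<Rightarrow> 'e set \<Rightarrow> nat set \<Rightarrow> (nat \<Rightarrow> real) \<Rightarrow> real" where
  "lidskii_sum E T V a = (\<Sum>\<kappa>\<in>admissible E T. \<Prod>v\<in>V. divpow (a v) (nat (excess E T \<kappa> v)))"

section \<open>The Lidskii sum under the insertion of one arc\<close>

lemma excess_insert:
  assumes "finite E" "e \<notin> E"
  shows "excess (insert e E) T (\<kappa>(e := c)) v = excess E T \<kappa> v
    + (if src e = v then int c + (if e \<in> T then 0 else 1) else 0) - (if tgt e = v then int c else 0)"
proof -
  have 1: "{e' \<in> insert e E. src e' = v} =
      (if src e = v then insert e {e' \<in> E. src e' = v} else {e' \<in> E. src e' = v})" by auto
  have 2: "{e' \<in> insert e E. tgt e' = v} =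
      (if tgt e = v then insert e {e' \<in> E. tgt e' = v} else {e' \<in> E. tgt e' = v})" by auto
  have 3: "(\<Sum>e' | e' \<in> E \<and> src e' = v. int ((\<kappa>(e := c)) e') + (if e' \<in> T then 0 else 1)) =
      (\<Sum>e' | e' \<in> E \<and> src e' = v. int (\<kappa> e') + (if e' \<in> T then 0 else 1))"
    using assms by (intro sum.cong) auto
  have 4: "(\<Sum>e' | e' \<in> E \<and> tgt e' = v. int ((\<kappa>(e := c)) e')) = (\<Sum>e' | e' \<in> E \<and> tgt e' = v. int (\<kappa> e'))"
    using assms by (intro sum.cong) auto
  show ?thesis
    using assms 3 4 unfolding excess_def 1 2 by (simp del: fun_upd_apply add: fun_upd_same)
qed

lemma excess_cong:
  assumes "\<And>e. e \<in> E \<Longrightarrow> \<kappa> e = \<kappa>' e" "\<And>e. e \<in> E \<Longrightarrow> e \<in> T \<longleftrightarrow> e \<in> T'"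
  shows "excess E T \<kappa> v = excess E T' \<kappa>' v"
  unfolding excess_def using assms by (intro arg_cong2[where f="(-)"] sum.cong) auto

lemma excess_nonneg:
  assumes "v \<notin> tgt ` E"
  shows "0 \<le> excess E T \<kappa> v"
proof -
  have "{e \<in> E. tgt e = v} = {}" using assms by auto
  then show ?thesis unfolding excess_def by (simp only: sum.empty) (simp add: sum_nonneg)
qed

lemma excess_eq_0:
  assumes "v \<notin> tgt ` E" "v \<notin> src ` E"
  shows "excess E T \<kappa> v = 0"
proof -
  have "{e \<in> E. tgt e = v} = {}" "{e \<in> E. src e = v} = {}" using assms by auto
  then show ?thesis unfolding excess_def by (simp only: sum.empty)
qed

text \<open>Multiplicity \<open>c\<close> on the new arc raises the excess at its tail and lowers it
  by \<open>c\<close> at its head, so the only new constraint is that \<open>c\<close> does not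
  exceed the old excess at the head.\<close>

lemma admissible_insert:
  assumes fin: "finite E" and e: "e \<notin> E" "src e < tgt e" and src: "src e \<notin> tgt ` E"
  shows "bij_betw (\<lambda>(\<kappa>, c). \<kappa>(e := c))
    (SIGMA \<kappa>:admissible E T. {..nat (excess E T \<kappa> (tgt e))}) (admissible (insert e E) T)"
proof (rule bij_betwI[where g="\<lambda>\<kappa>. (restrict \<kappa> E, \<kappa> e)"])
  let ?S = "SIGMA \<kappa>:admissible E T. {..nat (excess E T \<kappa> (tgt e))}"
  note ins = excess_insert[OF fin e(1), of T]
  have upd: "(restrict \<kappa> E)(e := \<kappa> e) = \<kappa>" if "\<kappa> \<in> admissible (insert e E) T" for \<kappa>
  proof -
    have "\<kappa> \<in> insert e E \<rightarrow>\<^sub>E UNIV" using that by (simp add: admissible_def)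
    from PiE_arb[OF this] show ?thesis by (auto simp: fun_eq_iff)
  qed
  have res: "restrict (\<kappa>(e := c)) E = \<kappa>" if "\<kappa> \<in> admissible E T" for \<kappa> c
  proof -
    have "\<kappa> \<in> E \<rightarrow>\<^sub>E UNIV" using that by (simp add: admissible_def)
    from PiE_arb[OF this] show ?thesis using e(1) by (auto simp: fun_eq_iff)
  qed
  show "(\<lambda>(\<kappa>, c). \<kappa>(e := c)) \<in> ?S \<rightarrow> admissible (insert e E) T"
  proof
    fix p assume "p \<in> ?S"
    then obtain \<kappa> c where p: "p = (\<kappa>, c)" and \<kappa>: "\<kappa> \<in> admissible E T"
      and c: "c \<le> nat (excess E T \<kappa> (tgt e))" by auto
    have nn: "0 \<le> excess E T \<kappa> v" for v using \<kappa> by (auto simp: admissible_def)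
    have "0 \<le> excess (insert e E) T (\<kappa>(e := c)) v" for v
      unfolding ins using nn[of v] nn[of "tgt e"] c e(2) by auto
    then show "(\<lambda>(\<kappa>, c). \<kappa>(e := c)) p \<in> admissible (insert e E) T"
      using \<kappa> by (auto simp: p admissible_def PiE_iff extensional_def)
  qed
  show "(\<lambda>\<kappa>. (restrict \<kappa> E, \<kappa> e)) \<in> admissible (insert e E) T \<rightarrow> ?S"
  proof
    fix \<kappa> assume \<kappa>: "\<kappa> \<in> admissible (insert e E) T"
    have nn: "0 \<le> excess E T (restrict \<kappa> E) v
        + (if src e = v then int (\<kappa> e) + (if e \<in> T then 0 else 1) else 0) - (if tgt e = v then int (\<kappa> e) else 0)" for v
    proof -
      have "0 \<le> excess (insert e E) T ((restrict \<kappa> E)(e := \<kappa> e)) v"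
        unfolding upd[OF \<kappa>] using \<kappa> by (simp add: admissible_def)
      then show ?thesis unfolding ins .
    qed
    have "0 \<le> excess E T (restrict \<kappa> E) v" for v
    \<comment> \<open>Deleting \<open>e\<close> lowers the excess at its tail, so nonnegativity
      there is not inherited; it holds because no arc of \<open>E\<close> enters that
      vertex.\<close>
    proof (cases "v = src e")
      case True
      then show ?thesis using excess_nonneg[OF src] by simp
    next
      case False
      then show ?thesis using nn[of v] by (auto split: if_splits)
    qed
    moreover have "int (\<kappa> e) \<le> excess E T (restrict \<kappa> E) (tgt e)"
      using nn[of "tgt e"] e(2) by simp
    ultimately show "(restrict \<kappa> E, \<kappa> e) \<in> ?S"
      by (auto simp: admissible_def)
  qed
  show "(\<lambda>\<kappa>. (restrict \<kappa> E, \<kappa> e)) ((\<lambda>(\<kappa>, c). \<kappa>(e := c)) p) = p" if "p \<in> ?S" for p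
    using that res by auto
  show "(\<lambda>(\<kappa>, c). \<kappa>(e := c)) (restrict \<kappa> E, \<kappa> e) = \<kappa>" if "\<kappa> \<in> admissible (insert e E) T" for \<kappa>
    using upd[OF that] by simp
qed

lemma admissible_insert_tree:
  assumes "e \<notin> E"
  shows "admissible E (insert e T) = admissible E T"
    and "excess E (insert e T) = excess E T"
proof -
  show "excess E (insert e T) = excess E T"
    using assms by (intro ext excess_cong) auto
  then show "admissible E (insert e T) = admissible E T"
    by (simp add: admissible_def)
qed

lemma finite_admissible: "rooted E T \<Longrightarrow> finite (admissible E T)"
proof (induction rule: rooted_induct)
  case empty
  then show ?case by (simp add: admissible_def)
next
  case (tree E T e)
  then have "finite E" by (simp add: rooted_def)
  from bij_betw_finite[OF admissible_insert[OF this tree(2-4), of "insert e T"]] tree show ?case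
    by (auto simp: admissible_insert_tree)
next
  case (nontree E T e)
  then have "finite E" by (simp add: rooted_def)
  from bij_betw_finite[OF admissible_insert[OF this nontree(2-4), of T]] nontree show ?case
    by auto
qed

text \<open>Group the multiplicities by their restriction to the old arcs; only the factors at the
  two ends of \<open>e\<close> see the multiplicity of \<open>e\<close>.\<close>

lemma lidskii_sum_insert:
  assumes fin: "finite E" "finite V" and e: "e \<notin> E" "src e < tgt e" and src: "src e \<notin> tgt ` E"
    and V: "src e \<in> V" "tgt e \<in> V" and adm: "finite (admissible E T)"
  shows "lidskii_sum (insert e E) T V a = (\<Sum>\<kappa>\<in>admissible E T.
    (\<Sum>c\<le>nat (excess E T \<kappa> (tgt e)).
      divpow (a (src e)) (nat (excess E T \<kappa> (src e)) + c + (if e \<in> T then 0 else 1)) *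
      divpow (a (tgt e)) (nat (excess E T \<kappa> (tgt e)) - c)) *
    (\<Prod>v\<in>V - {src e, tgt e}. divpow (a v) (nat (excess E T \<kappa> v))))"
proof -
  let ?\<tau> = "if e \<in> T then 0 else 1 :: nat"
  note ins = excess_insert[OF fin(1) e(1), of T]
  have "lidskii_sum (insert e E) T V a = (\<Sum>(\<kappa>, c)\<in>(SIGMA \<kappa>:admissible E T. {..nat (excess E T \<kappa> (tgt e))}).
      \<Prod>v\<in>V. divpow (a v) (nat (excess (insert e E) T (\<kappa>(e := c)) v)))"
    unfolding lidskii_sum_def
    by (subst sum.reindex_bij_betw[OF admissible_insert[OF fin(1) e src, of T], symmetric])
      (simp add: case_prod_unfold)
  also have "\<dots> = (\<Sum>\<kappa>\<in>admissible E T. \<Sum>c\<le>nat (excess E T \<kappa> (tgt e)).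
      \<Prod>v\<in>V. divpow (a v) (nat (excess (insert e E) T (\<kappa>(e := c)) v)))"
    by (subst sum.Sigma) (auto simp: adm)
  also have "\<dots> = (\<Sum>\<kappa>\<in>admissible E T. \<Sum>c\<le>nat (excess E T \<kappa> (tgt e)).
      divpow (a (src e)) (nat (excess E T \<kappa> (src e)) + c + ?\<tau>) *
      divpow (a (tgt e)) (nat (excess E T \<kappa> (tgt e)) - c) *
      (\<Prod>v\<in>V - {src e, tgt e}. divpow (a v) (nat (excess E T \<kappa> v))))"
  proof (intro sum.cong refl)
    fix \<kappa> c assume \<kappa>: "\<kappa> \<in> admissible E T" and c: "c \<in> {..nat (excess E T \<kappa> (tgt e))}"
    have nn: "0 \<le> excess E T \<kappa> v" for v using \<kappa> by (auto simp: admissible_def)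
    let ?p = "\<lambda>v. divpow (a v) (nat (excess (insert e E) T (\<kappa>(e := c)) v))"
    have "(\<Prod>v\<in>V. ?p v) = ?p (src e) * (?p (tgt e) * (\<Prod>v\<in>V - {src e} - {tgt e}. ?p v))"
      using fin(2) V e(2) by (simp add: prod.remove[of _ "src e"] prod.remove[of _ "tgt e"])
    also have "V - {src e} - {tgt e} = V - {src e, tgt e}" by auto
    also have "(\<Prod>v\<in>V - {src e, tgt e}. ?p v) = (\<Prod>v\<in>V - {src e, tgt e}. divpow (a v) (nat (excess E T \<kappa> v)))"
      by (intro prod.cong) (auto simp: ins)
    also have "?p (src e) = divpow (a (src e)) (nat (excess E T \<kappa> (src e)) + c + ?\<tau>)"
      unfolding ins using e(2) nn[of "src e"]
      by (intro arg_cong[where f="divpow (a (src e))"]) auto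
    also have "?p (tgt e) = divpow (a (tgt e)) (nat (excess E T \<kappa> (tgt e)) - c)"
      unfolding ins using e(2) nn[of "tgt e"]
      by (intro arg_cong[where f="divpow (a (tgt e))"]) auto
    finally show "(\<Prod>v\<in>V. ?p v) = divpow (a (src e)) (nat (excess E T \<kappa> (src e)) + c + ?\<tau>) *
      divpow (a (tgt e)) (nat (excess E T \<kappa> (tgt e)) - c) *
      (\<Prod>v\<in>V - {src e, tgt e}. divpow (a v) (nat (excess E T \<kappa> v)))"
      by (simp only: mult.assoc)
  qed
  finally show ?thesis by (simp only: sum_distrib_right)
qed

text \<open>The tail has excess 0 over \<open>E\<close>, so the exponents at the two ends are
  \<open>c\<close> and \<open>r - c\<close>, and summing over \<open>c\<close> is the binomial
  theorem. The entry at the tail can again stay in place, its exponent being 0.\<close>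

lemma lidskii_sum_insert_tree:
  assumes fin: "finite E" "finite V" and e: "e \<notin> E" "src e < tgt e"
    and src: "src e \<notin> tgt ` E" "src e \<notin> src ` E"
    and V: "src e \<in> V" "tgt e \<in> V" and adm: "finite (admissible E T)"
  shows "lidskii_sum (insert e E) (insert e T) V a =
    lidskii_sum E T V (a(tgt e := a (tgt e) + a (src e)))"
proof -
  let ?a = "a(tgt e := a (tgt e) + a (src e))"
  have "lidskii_sum E T V ?a = (\<Sum>\<kappa>\<in>admissible E T. divpow (a (tgt e) + a (src e)) (nat (excess E T \<kappa> (tgt e))) *
      (\<Prod>v\<in>V - {src e, tgt e}. divpow (a v) (nat (excess E T \<kappa> v))))"
    unfolding lidskii_sum_def
  proof (intro sum.cong refl)
    fix \<kappa>
    let ?p = "\<lambda>v. divpow (?a v) (nat (excess E T \<kappa> v))"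
    have "(\<Prod>v\<in>V. ?p v) = ?p (src e) * (?p (tgt e) * (\<Prod>v\<in>V - {src e} - {tgt e}. ?p v))"
      using fin(2) V e(2) by (simp add: prod.remove[of _ "src e"] prod.remove[of _ "tgt e"])
    also have "V - {src e} - {tgt e} = V - {src e, tgt e}" by auto
    also have "(\<Prod>v\<in>V - {src e, tgt e}. ?p v) = (\<Prod>v\<in>V - {src e, tgt e}. divpow (a v) (nat (excess E T \<kappa> v)))"
      by (intro prod.cong) auto
    also have "?p (src e) = 1"
      using excess_eq_0[OF src] by simp
    finally show "(\<Prod>v\<in>V. ?p v) = divpow (a (tgt e) + a (src e)) (nat (excess E T \<kappa> (tgt e))) *
      (\<Prod>v\<in>V - {src e, tgt e}. divpow (a v) (nat (excess E T \<kappa> v)))"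
      by simp
  qed
  moreover have "(\<Sum>c\<le>nat (excess E T \<kappa> (tgt e)).
      divpow (a (src e)) (nat (excess E T \<kappa> (src e)) + c + 0) *
      divpow (a (tgt e)) (nat (excess E T \<kappa> (tgt e)) - c)) =
      divpow (a (tgt e) + a (src e)) (nat (excess E T \<kappa> (tgt e)))" for \<kappa>
    unfolding add.commute[of "a (tgt e)"] divpow_add using excess_eq_0[OF src] by simp
  ultimately show ?thesis
    using lidskii_sum_insert[OF fin e src(1) V, of "insert e T" a] adm e(1)
    by (simp add: admissible_insert_tree)
qed

text \<open>Only the factors at the two ends of \<open>e\<close> depend on \<open>y\<close>, and
  their product is integrated by \<open>has_integral_divpow_shift\<close>.\<close>

lemma has_integral_lidskii_sum:
  assumes fin: "finite E" "finite V" and e: "e \<notin> E" "e \<notin> T" "src e < tgt e"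
    and src: "src e \<notin> tgt ` E"
    and V: "src e \<in> V" "tgt e \<in> V" and adm: "finite (admissible E T)" and a: "0 \<le> a (src e)"
  shows "((\<lambda>y. lidskii_sum E T V (a(src e := a (src e) - y, tgt e := a (tgt e) + y))) has_integral
    lidskii_sum (insert e E) T V a) {0..a (src e)}"
proof -
  have eq: "lidskii_sum E T V (a(src e := a (src e) - y, tgt e := a (tgt e) + y)) =
    (\<Sum>\<kappa>\<in>admissible E T. divpow (a (src e) - y) (nat (excess E T \<kappa> (src e))) *
      divpow (a (tgt e) + y) (nat (excess E T \<kappa> (tgt e))) *
      (\<Prod>v\<in>V - {src e, tgt e}. divpow (a v) (nat (excess E T \<kappa> v))))" for y
    unfolding lidskii_sum_def
  proof (intro sum.cong refl)
    fix \<kappa>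
    let ?a = "a(src e := a (src e) - y, tgt e := a (tgt e) + y)"
    let ?p = "\<lambda>v. divpow (?a v) (nat (excess E T \<kappa> v))"
    have "(\<Prod>v\<in>V. ?p v) = ?p (src e) * (?p (tgt e) * (\<Prod>v\<in>V - {src e} - {tgt e}. ?p v))"
      using fin(2) V e(3) by (simp add: prod.remove[of _ "src e"] prod.remove[of _ "tgt e"])
    also have "V - {src e} - {tgt e} = V - {src e, tgt e}" by auto
    also have "(\<Prod>v\<in>V - {src e, tgt e}. ?p v) = (\<Prod>v\<in>V - {src e, tgt e}. divpow (a v) (nat (excess E T \<kappa> v)))"
      by (intro prod.cong) auto
    also have "?p (src e) = divpow (a (src e) - y) (nat (excess E T \<kappa> (src e)))"
      using e(3) by simp
    also have "?p (tgt e) = divpow (a (tgt e) + y) (nat (excess E T \<kappa> (tgt e)))"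
      by simp
    finally show "(\<Prod>v\<in>V. ?p v) = divpow (a (src e) - y) (nat (excess E T \<kappa> (src e))) *
      divpow (a (tgt e) + y) (nat (excess E T \<kappa> (tgt e))) *
      (\<Prod>v\<in>V - {src e, tgt e}. divpow (a v) (nat (excess E T \<kappa> v)))"
      by (simp only: mult.assoc)
  qed
  have sum: "lidskii_sum (insert e E) T V a = (\<Sum>\<kappa>\<in>admissible E T.
    (\<Sum>c\<le>nat (excess E T \<kappa> (tgt e)).
      divpow (a (src e)) (nat (excess E T \<kappa> (src e)) + c + 1) *
      divpow (a (tgt e)) (nat (excess E T \<kappa> (tgt e)) - c)) *
    (\<Prod>v\<in>V - {src e, tgt e}. divpow (a v) (nat (excess E T \<kappa> v))))"
    using lidskii_sum_insert[OF fin e(1,3) src V adm] e(2) by simp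
  show ?thesis
    unfolding eq sum
    by (intro has_integral_sum[OF adm] has_integral_mult_left has_integral_divpow_shift a)
qed

lemma lidskii_sum_nonneg: "(\<And>v. v \<in> V \<Longrightarrow> 0 \<le> a v) \<Longrightarrow> 0 \<le> lidskii_sum E T V a"
  unfolding lidskii_sum_def by (intro sum_nonneg prod_nonneg ballI divpow_nonneg) auto

text \<open>The induction is for all \<open>a\<close> at once, because each insertion passes to a
  changed net flow on the same \<open>V\<close>.\<close>

theorem emeasure_reduced:
  assumes "rooted E T" and "finite V" "src ` E \<subseteq> V" "tgt ` E \<subseteq> V" and "\<And>v. v \<in> V \<Longrightarrow> 0 \<le> a v"
  shows "emeasure (lborel_on (E - T)) (reduced E T a) = ennreal (lidskii_sum E T V a)"
  using assms
proof (induction arbitrary: a rule: rooted_induct)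
  case empty
  \<comment> \<open>Without coordinates the measure space is one point of mass 1, and the sum has
    one term, with all exponents 0.\<close>
  have "reduced {} {} a = {\<lambda>_. undefined}"
    by (auto simp: reduced_def)
  moreover have "admissible {} {} = {\<lambda>_. undefined}"
    by (auto simp: admissible_def excess_def)
  ultimately show ?case
    by (simp add: lidskii_sum_def excess_def)
next
  case (tree E T e)
  have fin: "finite E" and TE: "T \<subseteq> E" using tree(1) by (auto simp: rooted_def)
  let ?a = "a(tgt e := a (tgt e) + a (src e))"
  have D: "insert e E - insert e T = E - T" using tree by auto
  have tf: "tree_flow (insert e E) (insert e T) a x v = tree_flow E T ?a x v" for x v
    by (rule tree_flow_insert_tree[OF fin tree(2) TE tree(3-5)])
  have src: "tree_flow E T ?a x (src e) = a (src e)" for x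
  proof -
    have 1: "{e' \<in> E. tgt e' = src e \<and> src e' < src e} = {}" using tree by (auto simp: image_iff)
    have 2: "{e' \<in> E. src e' = src e \<and> e' \<notin> T} = {}" using tree by (auto simp: image_iff)
    show ?thesis using tree(3) by (subst tree_flow.simps) (simp only: 1 2, simp)
  qed
  \<comment> \<open>The new tree arc contributes only the condition
    \<open>0 \<le> a (src e)\<close>, which is assumed.\<close>
  have "reduced (insert e E) (insert e T) a = reduced E T ?a"
    using tree.prems unfolding reduced_def D tf by (auto simp: src)
  moreover have "emeasure (lborel_on (E - T)) (reduced E T ?a) = ennreal (lidskii_sum E T V ?a)"
    using tree.prems by (intro tree.IH) auto
  ultimately show ?case
    unfolding D using lidskii_sum_insert_tree[OF fin tree.prems(1) tree(2-5)] tree.prems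
      finite_admissible[OF tree(1)] by simp
next
  case (nontree E T e)
  have fin: "finite E" and TE: "T \<subseteq> E" using nontree(1) by (auto simp: rooted_def)
  have eT: "e \<notin> T" using TE nontree(2) by auto
  have V: "src e \<in> V" "tgt e \<in> V" and a: "0 \<le> a (src e)" using nontree.prems by auto
  define a' where "a' y = a(src e := a (src e) - y, tgt e := a (tgt e) + y)" for y
  have D: "insert e E - T = insert e (E - T)" using nontree eT by auto
  have R: "reduced (insert e E) T a \<in> sets (lborel_on (insert e (E - T)))"
    using sets_reduced[of "insert e E" T a] fin TE unfolding D by auto
  have tf: "tree_flow (insert e E) T a (x(e := y)) v = tree_flow E T (a' y) x v" for x y v
    unfolding a'_def by (rule tree_flow_insert_nontree[OF fin nontree(2) eT nontree(3)])
  have mem: "x(e := y) \<in> reduced (insert e E) T a \<longleftrightarrow> 0 \<le> y \<and> x \<in> reduced E T (a' y)"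
    if "x \<in> E - T \<rightarrow>\<^sub>E UNIV" for x y
    using that nontree(2) unfolding reduced_def D mem_Collect_eq tf
    by (auto simp: PiE_iff extensional_def)
  \<comment> \<open>Nothing enters \<open>src e\<close>, so more than \<open>a (src e)\<close> on
    the new arc would force negative flow on the tree arc there.\<close>
  have empty: "reduced E T (a' y) = {}" if "a (src e) < y" for y
  proof -
    have "tree_flow E T (a' y) x (src e) < 0" if "x \<in> reduced E T (a' y)" for x
    proof -
      have 1: "{e' \<in> E. tgt e' = src e \<and> src e' < src e} = {}" using nontree by (auto simp: image_iff)
      have "0 \<le> (\<Sum>e' | e' \<in> E \<and> src e' = src e \<and> e' \<notin> T. x e')"
        using that by (intro sum_nonneg) (auto simp: reduced_def)
      moreover have "a' y (src e) < 0" using \<open>a (src e) < y\<close> nontree(3) by (simp add: a'_def)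
      ultimately show ?thesis by (subst tree_flow.simps) (simp only: 1, simp)
    qed
    moreover obtain e' where "e' \<in> T" "src e' = src e" using nontree(5) by (auto simp: image_iff)
    moreover have "0 \<le> tree_flow E T (a' y) x (src e')" if "x \<in> reduced E T (a' y)" for x
      using that \<open>e' \<in> T\<close> by (simp add: reduced_def)
    ultimately show ?thesis by (metis equals0I not_le)
  qed
  have "emeasure (lborel_on (insert e (E - T))) (reduced (insert e E) T a) =
      (\<integral>\<^sup>+x. indicator (reduced (insert e E) T a) x \<partial>lborel_on (insert e (E - T)))"
    using R by simp
  also have "\<dots> = (\<integral>\<^sup>+y. (\<integral>\<^sup>+x. indicator (reduced (insert e E) T a) (x(e := y)) \<partial>lborel_on (E - T)) \<partial>lborel)"
    using fin nontree(2) R by (intro lborel_on.product_nn_integral_insert_rev) auto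
  also have "\<dots> = (\<integral>\<^sup>+y. ennreal (lidskii_sum E T V (a' y)) * indicator {0..a (src e)} y \<partial>lborel)"
  proof (rule nn_integral_cong)
    fix y :: real
    have "(\<integral>\<^sup>+x. indicator (reduced (insert e E) T a) (x(e := y)) \<partial>lborel_on (E - T)) =
        (\<integral>\<^sup>+x. indicator {0..} y * indicator (reduced E T (a' y)) x \<partial>lborel_on (E - T))"
      using mem by (intro nn_integral_cong) (auto simp: space_lborel_on indicator_def)
    also have "\<dots> = indicator {0..} y * emeasure (lborel_on (E - T)) (reduced E T (a' y))"
      using sets_reduced[OF fin TE] by (subst nn_integral_cmult) auto
    \<comment> \<open>On the interval the changed net flow is nonnegative and the induction
      hypothesis applies; outside it both sides vanish.\<close>
    also have "\<dots> = ennreal (lidskii_sum E T V (a' y)) * indicator {0..a (src e)} y"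
    proof (cases "y \<in> {0..a (src e)}")
      case True
      have "emeasure (lborel_on (E - T)) (reduced E T (a' y)) = ennreal (lidskii_sum E T V (a' y))"
        using nontree.prems True V by (intro nontree.IH) (auto simp: a'_def)
      then show ?thesis using True by simp
    next
      case False
      then show ?thesis using empty[of y] by (auto simp: indicator_def not_le)
    qed
    finally show "(\<integral>\<^sup>+x. indicator (reduced (insert e E) T a) (x(e := y)) \<partial>lborel_on (E - T)) =
        ennreal (lidskii_sum E T V (a' y)) * indicator {0..a (src e)} y" .
  qed
  also have "\<dots> = ennreal (lidskii_sum (insert e E) T V a)"
  proof (rule nn_integral_has_integral_lebesgue')
    show "((\<lambda>y. lidskii_sum E T V (a' y)) has_integral lidskii_sum (insert e E) T V a) {0..a (src e)}"
      unfolding a'_def using nontree finite_admissible[OF nontree(1)]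
      by (intro has_integral_lidskii_sum fin eT V a) auto
    fix y assume y: "y \<in> {0..a (src e)}"
    show "0 \<le> lidskii_sum E T V (a' y)"
      using y nontree.prems V by (intro lidskii_sum_nonneg) (auto simp: a'_def)
  qed
  finally show ?case unfolding D .
qed

end

section \<open>Normalized volume in reduced coordinates\<close>

context arc_ends
begin

lemma divergence_cong:
  assumes "\<And>e. e \<in> E \<Longrightarrow> b e = b' e"
  shows "divergence E b j = divergence E b' j"
proof -
  have "(\<Sum>e | e \<in> E \<and> P e. b e) = (\<Sum>e | e \<in> E \<and> P e. b' e)" for P
    by (rule sum.cong) (simp_all add: assms)
  then show ?thesis by (simp only: divergence_def)
qed

lemma divergence_add: "divergence E (\<lambda>e. b e + b' e) j = divergence E b j + divergence E b' j"
  by (simp add: divergence_def sum.distrib)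

lemma divergence_sum:
  "divergence E (\<lambda>e. \<Sum>i\<in>I. x i * w i e) j = (\<Sum>i\<in>I. x i * divergence E (w i) j)"
  unfolding divergence_def right_diff_distrib sum_subtractf sum_distrib_left
  by (intro arg_cong2[where f="(-)"] sum.swap)

definition flows :: "'e set \<Rightarrow> 'e set \<Rightarrow> (nat \<Rightarrow> real) \<Rightarrow> ('e \<Rightarrow> real) set" where
  "flows E T a = {b \<in> E \<rightarrow>\<^sub>E UNIV. \<forall>j\<in>src ` T. divergence E b j = a j}"

lemma flow_of_in_flows: "rooted E T \<Longrightarrow> flow_of E T a x \<in> flows E T a"
  using divergence_flow_of[of E T _ a x] by (auto simp: flows_def flow_of_def)

lemma flows_eq_flow_of:
  "rooted E T \<Longrightarrow> b \<in> flows E T a \<Longrightarrow> (\<And>e. e \<in> E \<Longrightarrow> e \<notin> T \<Longrightarrow> x e = b e) \<Longrightarrow> b = flow_of E T a x"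
  by (rule flow_of_unique) (auto simp: flows_def)

lemma flows_eqI:
  assumes "rooted E T" "b \<in> flows E T a" "b' \<in> flows E T a" "\<And>e. e \<in> E \<Longrightarrow> e \<notin> T \<Longrightarrow> b e = b' e"
  shows "b = b'"
proof -
  have "b = flow_of E T a b'"
    by (rule flows_eq_flow_of[OF assms(1,2)]) (rule assms(4)[symmetric])
  also have "\<dots> = b'"
    by (rule flows_eq_flow_of[OF assms(1,3), symmetric]) (rule refl)
  finally show ?thesis .
qed

text \<open>\<open>flow_of\<close> inverts the restriction to nontree arcs, and by
  \<open>tree_flow_Ints\<close> it keeps integer values integral.\<close>

lemma bij_betw_integer_flows:
  assumes "rooted E T"
  shows "bij_betw (\<lambda>b. restrict b (E - T)) (integer_points E (flows E T (\<lambda>_. 0))) (E - T \<rightarrow>\<^sub>E \<int>)"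
proof (rule bij_betwI[where g="flow_of E T (\<lambda>_. 0)"])
  show "(\<lambda>b. restrict b (E - T)) \<in> integer_points E (flows E T (\<lambda>_. 0)) \<rightarrow> E - T \<rightarrow>\<^sub>E \<int>"
    by (auto simp: integer_points_def)
  show "flow_of E T (\<lambda>_. 0) \<in> (E - T \<rightarrow>\<^sub>E \<int>) \<rightarrow> integer_points E (flows E T (\<lambda>_. 0))"
  proof
    fix x assume x: "x \<in> E - T \<rightarrow>\<^sub>E (\<int> :: real set)"
    have "tree_flow E T (\<lambda>_. 0) x j \<in> \<int>" for j
      using x by (intro tree_flow_Ints) auto
    then show "flow_of E T (\<lambda>_. 0) x \<in> integer_points E (flows E T (\<lambda>_. 0))"
      using flow_of_in_flows[OF assms] x by (auto simp: integer_points_def flow_of_def)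
  qed
  show "flow_of E T (\<lambda>_. 0) (restrict b (E - T)) = b"
    if "b \<in> integer_points E (flows E T (\<lambda>_. 0))" for b
    using that by (intro flows_eq_flow_of[OF assms, symmetric]) (auto simp: integer_points_def)
  show "restrict (flow_of E T (\<lambda>_. 0) x) (E - T) = x" if "x \<in> E - T \<rightarrow>\<^sub>E \<int>" for x
    using PiE_arb[OF that] by (auto simp: flow_of_def fun_eq_iff)
qed

text \<open>Each basis flow sends one unit along a single nontree arc and lets the tree arcs restore
  conservation; for a spanning tree these are the fundamental cycles. Existence is needed for the
  \<open>SOME\<close> in \<open>flow_volume\<close> to meet its specification.\<close>

lemma ex_lattice_basis:
  assumes r: "rooted E T"
  shows "\<exists>w. lattice_basis E (integer_points E (flows E T (\<lambda>_. 0))) (card (E - T)) w"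
proof -
  have fin: "finite (E - T)" using r by (simp add: rooted_def)
  define d where "d = card (E - T)"
  obtain g where g: "bij_betw g {..<d} (E - T)"
    using ex_bij_betw_nat_finite[OF fin] by (auto simp: d_def atLeast0LessThan)
  define w where "w i = flow_of E T (\<lambda>_. 0) (\<lambda>e. if e = g i then 1 else 0)" for i
  define \<Phi> where "\<Phi> c = (\<lambda>e\<in>E. \<Sum>i<d. real_of_int (c i) * w i e)" for c :: "nat \<Rightarrow> int"
  let ?L = "integer_points E (flows E T (\<lambda>_. 0))"
  have gN: "g i \<in> E" "g i \<notin> T" if "i < d" for i using g that by (auto dest: bij_betwE)
  have \<Phi>g: "\<Phi> c (g k) = c k" if "k < d" for c k
  proof -
    have "w i (g k) = (if i = k then 1 else 0)" if "i < d" for i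
      using g that \<open>k < d\<close> gN[OF \<open>k < d\<close>] by (auto simp: w_def flow_of_def bij_betw_def inj_on_def)
    then have "(\<Sum>i<d. real_of_int (c i) * w i (g k)) = (\<Sum>i<d. if i = k then real_of_int (c k) else 0)"
      by (intro sum.cong) auto
    then show ?thesis using gN[OF that] that by (simp add: \<Phi>_def)
  qed
  have w: "w i \<in> ?L" if "i < d" for i
  proof -
    have "tree_flow E T (\<lambda>_. 0) (\<lambda>e. if e = g i then 1 else 0) j \<in> \<int>" for j
      by (intro tree_flow_Ints) auto
    then show ?thesis
      using flow_of_in_flows[OF r] unfolding w_def by (auto simp: integer_points_def flow_of_def)
  qed
  have \<Phi>L: "\<Phi> c \<in> ?L" for c
  proof -
    have "divergence E (\<Phi> c) j = 0" if "j \<in> src ` T" for j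
    proof -
      have "divergence E (\<Phi> c) j = divergence E (\<lambda>e. \<Sum>i<d. real_of_int (c i) * w i e) j"
        by (rule divergence_cong) (simp add: \<Phi>_def)
      also have "\<dots> = 0"
        unfolding divergence_sum
      proof (rule sum.neutral, rule ballI)
        fix i assume "i \<in> {..<d}"
        then have "divergence E (w i) j = 0"
          using w[of i] that by (auto simp: integer_points_def flows_def)
        then show "real_of_int (c i) * divergence E (w i) j = 0" by simp
      qed
      finally show ?thesis .
    qed
    then show ?thesis
      using w by (auto simp: integer_points_def flows_def \<Phi>_def intro!: Ints_sum Ints_mult)
  qed
  \<comment> \<open>No basis flow other than the i-th uses the nontree arc \<open>g i\<close>, so
    the coefficient is the value on that arc; \<open>floor\<close> only converts the integral real
    to an \<open>int\<close>.\<close>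
  have "bij_betw \<Phi> ({..<d} \<rightarrow>\<^sub>E UNIV) ?L"
  proof (rule bij_betwI[where g="\<lambda>b. \<lambda>i\<in>{..<d}. \<lfloor>b (g i)\<rfloor>"])
    show "\<Phi> \<in> ({..<d} \<rightarrow>\<^sub>E UNIV) \<rightarrow> ?L" using \<Phi>L by auto
    show "(\<lambda>i\<in>{..<d}. \<lfloor>\<Phi> c (g i)\<rfloor>) = c" if "c \<in> {..<d} \<rightarrow>\<^sub>E UNIV" for c
      using PiE_arb[OF that] by (auto simp: \<Phi>g fun_eq_iff)
    show "\<Phi> (\<lambda>i\<in>{..<d}. \<lfloor>b (g i)\<rfloor>) = b" if b: "b \<in> ?L" for b
    proof (rule flows_eqI[OF r])
      show "\<Phi> (\<lambda>i\<in>{..<d}. \<lfloor>b (g i)\<rfloor>) \<in> flows E T (\<lambda>_. 0)" "b \<in> flows E T (\<lambda>_. 0)"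
        using \<Phi>L b by (auto simp: integer_points_def)
      fix e assume "e \<in> E" "e \<notin> T"
      then obtain k where k: "k < d" "e = g k" using g by (auto simp: bij_betw_def)
      show "\<Phi> (\<lambda>i\<in>{..<d}. \<lfloor>b (g i)\<rfloor>) e = b e"
        unfolding k(2) \<Phi>g[OF k(1)] using k b gN[OF k(1)] by (auto simp: integer_points_def)
    qed
  qed auto
  then show ?thesis
    unfolding lattice_basis_def \<Phi>_def d_def by blast
qed

lemma bij_betw_of_int_fun:
  "bij_betw (\<lambda>c. \<lambda>i\<in>I. real_of_int (c i)) (I \<rightarrow>\<^sub>E UNIV) (I \<rightarrow>\<^sub>E \<int>)"
proof (rule bij_betwI[where g="\<lambda>x. \<lambda>i\<in>I. \<lfloor>x i\<rfloor>"])
  show "(\<lambda>i\<in>I. \<lfloor>(\<lambda>i\<in>I. real_of_int (c i)) i\<rfloor>) = c" if "c \<in> I \<rightarrow>\<^sub>E UNIV" for c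
    using PiE_arb[OF that] by (auto simp: fun_eq_iff)
  show "(\<lambda>i\<in>I. real_of_int ((\<lambda>i\<in>I. \<lfloor>x i\<rfloor>) i)) = x" if "x \<in> I \<rightarrow>\<^sub>E \<int>" for x
    using PiE_arb[OF that] PiE_mem[OF that] by (auto simp: fun_eq_iff)
qed auto

text \<open>Whatever the basis, passing from coefficients to flows and then to nontree coordinates
  matches integer vectors with integer vectors, because both steps are bijections of lattices.
  \<open>distr_unimodular\<close> needs beyond this only additivity, measurability and
  surjectivity.\<close>

lemma lattice_coordinates_unimodular:
  assumes r: "rooted E T" and w: "lattice_basis E (integer_points E (flows E T (\<lambda>_. 0))) d w"
  shows "distr (lborel_on {..<d}) (lborel_on (E - T)) (\<lambda>x. \<lambda>e\<in>E - T. \<Sum>i<d. x i * w i e) =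
    lborel_on (E - T)"
proof -
  let ?I = "{..<d}" and ?N = "E - T" and ?L = "integer_points E (flows E T (\<lambda>_. 0))"
  define M where "M x = (\<lambda>e\<in>?N. \<Sum>i<d. x i * w i e)" for x :: "nat \<Rightarrow> real"
  have fin: "finite ?N" using r by (simp add: rooted_def)
  have "bij_betw ((\<lambda>b. restrict b ?N) \<circ> (\<lambda>c. \<lambda>e\<in>E. \<Sum>i<d. real_of_int (c i) * w i e))
      (?I \<rightarrow>\<^sub>E UNIV) (?N \<rightarrow>\<^sub>E \<int>)"
    using w unfolding lattice_basis_def by (rule bij_betw_trans[OF _ bij_betw_integer_flows[OF r]])
  also have "(\<lambda>b. restrict b ?N) \<circ> (\<lambda>c. \<lambda>e\<in>E. \<Sum>i<d. real_of_int (c i) * w i e) =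
      M \<circ> (\<lambda>c. \<lambda>i\<in>?I. real_of_int (c i))"
    by (auto simp: fun_eq_iff M_def)
  finally have bij: "bij_betw M (?I \<rightarrow>\<^sub>E \<int>) (?N \<rightarrow>\<^sub>E \<int>)"
    using bij_betw_comp_iff[OF bij_betw_of_int_fun, of M ?I] by blast
  show ?thesis
    unfolding M_def[symmetric]
  proof (rule distr_unimodular[OF _ fin _ _ _ bij])
    show "M \<in> lborel_on ?I \<rightarrow>\<^sub>M lborel_on ?N"
      unfolding M_def by (intro measurable_restrict) auto
    show "M (\<lambda>i\<in>?I. x i + y i) = (\<lambda>j\<in>?N. M x j + M y j)" for x y
      by (auto simp: M_def fun_eq_iff distrib_right sum.distrib)
    show "?N \<rightarrow>\<^sub>E UNIV \<subseteq> M ` (?I \<rightarrow>\<^sub>E UNIV)"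
    proof
      fix y assume y: "y \<in> ?N \<rightarrow>\<^sub>E (UNIV :: real set)"
      \<comment> \<open>Surjectivity over the reals comes from the integers: unit vectors have
        preimages, and \<open>M\<close> is linear.\<close>
      have "\<exists>c. M c = (\<lambda>e\<in>?N. if e = f then 1 else 0)" if "f \<in> ?N" for f
      proof -
        have "(\<lambda>e\<in>?N. if e = f then 1 else 0) \<in> ?N \<rightarrow>\<^sub>E (\<int> :: real set)" by auto
        then show ?thesis using bij unfolding bij_betw_def by (metis imageE)
      qed
      then obtain c where c: "\<And>f. f \<in> ?N \<Longrightarrow> M (c f) = (\<lambda>e\<in>?N. if e = f then 1 else 0)"
        by metis
      have "M (\<lambda>i\<in>?I. \<Sum>f\<in>?N. y f * c f i) e = y e" for e
      proof (cases "e \<in> ?N")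
        case True
        then have "M (\<lambda>i\<in>?I. \<Sum>f\<in>?N. y f * c f i) e = (\<Sum>i<d. \<Sum>f\<in>?N. y f * (c f i * w i e))"
          by (simp add: M_def sum_distrib_right mult.assoc)
        also have "\<dots> = (\<Sum>f\<in>?N. \<Sum>i<d. y f * (c f i * w i e))" by (rule sum.swap)
        also have "\<dots> = (\<Sum>f\<in>?N. y f * M (c f) e)"
          using True by (simp add: M_def sum_distrib_left)
        also have "\<dots> = (\<Sum>f\<in>?N. if f = e then y e else 0)"
          using c True by (intro sum.cong) auto
        also have "\<dots> = y e" using True fin by simp
        finally show ?thesis .
      next
        case False
        then show ?thesis using PiE_arb[OF y False] by (auto simp: M_def)
      qed
      then have "M (\<lambda>i\<in>?I. \<Sum>f\<in>?N. y f * c f i) = y" by blast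
      then show "y \<in> M ` (?I \<rightarrow>\<^sub>E UNIV)" 
        by (intro image_eqI[of y M "\<lambda>i\<in>?I. \<Sum>f\<in>?N. y f * c f i"]) simp_all
    qed
  qed simp
qed

text \<open>In nontree coordinates the parametrization is a unimodular map followed by the
  translation by \<open>p\<close>, and both preserve the measure. Nonnegativity on tree arcs is
  recovered there through \<open>tree_flow\<close>.\<close>

lemma measure_lattice_coordinates:
  assumes r: "rooted E T" and w: "lattice_basis E (integer_points E (flows E T (\<lambda>_. 0))) d w"
    and p: "p \<in> flows E T a"
  shows "measure (lborel_on {..<d}) {x \<in> {..<d} \<rightarrow>\<^sub>E UNIV.
      (\<lambda>e\<in>E. p e + (\<Sum>i<d. x i * w i e)) \<in> {b \<in> flows E T a. \<forall>e\<in>E. 0 \<le> b e}} =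
    measure (lborel_on (E - T)) (reduced E T a)"
proof -
  let ?I = "{..<d}" and ?N = "E - T" and ?L = "integer_points E (flows E T (\<lambda>_. 0))"
  define M where "M = (\<lambda>x :: nat \<Rightarrow> real. \<lambda>e\<in>?N. \<Sum>i<d. x i * w i e)"
  define tr where "tr = (\<lambda>x. \<lambda>e\<in>?N. x e + p e)"
  have fin: "finite E" "T \<subseteq> E" "finite ?N" using r by (simp_all add: rooted_def)
  have M [measurable]: "M \<in> lborel_on ?I \<rightarrow>\<^sub>M lborel_on ?N"
    unfolding M_def by (intro measurable_restrict) auto
  have tr [measurable]: "tr \<in> lborel_on ?N \<rightarrow>\<^sub>M lborel_on ?N"
    unfolding tr_def by (rule measurable_translate)
  have R [measurable]: "reduced E T a \<in> sets (lborel_on ?N)"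
    by (rule sets_reduced[OF fin(1,2)])
  \<comment> \<open>\<open>lattice_basis\<close> does not speak of a single \<open>w i\<close>; it
    is reached as the image of a unit coefficient vector. Values of \<open>w i\<close> outside
    \<open>E\<close> are arbitrary, hence the restrictions.\<close>
  have w0: "divergence E (w i) j = 0" if "i < d" "j \<in> src ` T" for i j
  proof -
    let ?c = "\<lambda>k\<in>?I. if k = i then 1 else 0 :: int"
    have "?c \<in> ?I \<rightarrow>\<^sub>E UNIV" by simp
    with bij_betwE[OF w[unfolded lattice_basis_def]]
    have "(\<lambda>e\<in>E. \<Sum>k<d. real_of_int (?c k) * w k e) \<in> ?L" by (rule bspec)
    also have "(\<lambda>e\<in>E. \<Sum>k<d. real_of_int (?c k) * w k e) = (\<lambda>e\<in>E. w i e)"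
    proof (rule restrict_ext)
      fix e
      have "(\<Sum>k<d. real_of_int (?c k) * w k e) = (\<Sum>k<d. if k = i then w i e else 0)"
        by (intro sum.cong) auto
      then show "(\<Sum>k<d. real_of_int (?c k) * w k e) = w i e" using that by simp
    qed
    finally have "divergence E (\<lambda>e\<in>E. w i e) j = 0"
      unfolding integer_points_def flows_def using that by blast
    moreover have "divergence E (\<lambda>e\<in>E. w i e) j = divergence E (w i) j"
      by (rule divergence_cong) simp
    ultimately show ?thesis by simp
  qed
  have "{x \<in> ?I \<rightarrow>\<^sub>E UNIV. (\<lambda>e\<in>E. p e + (\<Sum>i<d. x i * w i e)) \<in> {b \<in> flows E T a. \<forall>e\<in>E. 0 \<le> b e}} =
      (tr \<circ> M) -` reduced E T a \<inter> space (lborel_on ?I)"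
  proof -
    have "(\<lambda>e\<in>E. p e + (\<Sum>i<d. x i * w i e)) \<in> {b \<in> flows E T a. \<forall>e\<in>E. 0 \<le> b e} \<longleftrightarrow>
        tr (M x) \<in> reduced E T a" for x
    proof -
      let ?b = "\<lambda>e\<in>E. p e + (\<Sum>i<d. x i * w i e)"
      have "divergence E ?b j = a j" if "j \<in> src ` T" for j
      proof -
        have "divergence E ?b j = divergence E (\<lambda>e. p e + (\<Sum>i<d. x i * w i e)) j"
          by (rule divergence_cong) simp
        also have "\<dots> = a j"
        proof -
          have "divergence E p j = a j" using p that by (auto simp: flows_def)
          then show ?thesis unfolding divergence_add divergence_sum using w0 that by simp
        qed
        finally show ?thesis .
      qed
      then have b: "?b \<in> flows E T a" by (auto simp: flows_def)
      have trb: "tr (M x) e = ?b e" if "e \<in> E" "e \<notin> T" for e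
        using that by (simp add: tr_def M_def)
      have "?b = flow_of E T a (tr (M x))"
        using trb by (intro flows_eq_flow_of[OF r b]) auto
      then have "(\<forall>e\<in>E. 0 \<le> ?b e) \<longleftrightarrow> (\<forall>e\<in>E. 0 \<le> flow_of E T a (tr (M x)) e)"
        by simp
      also have "\<dots> \<longleftrightarrow> (\<forall>e\<in>?N. 0 \<le> tr (M x) e) \<and> (\<forall>e\<in>T. 0 \<le> tree_flow E T a (tr (M x)) (src e))"
        using fin(2) by (auto simp: flow_of_def)
      also have "\<dots> \<longleftrightarrow> tr (M x) \<in> reduced E T a"
        by (simp add: reduced_def tr_def)
      finally show ?thesis using b by simp
    qed
    then show ?thesis by (auto simp: space_lborel_on)
  qed
  moreover have "distr (lborel_on ?I) (lborel_on ?N) (tr \<circ> M) = lborel_on ?N"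
  proof -
    have "distr (lborel_on ?I) (lborel_on ?N) (tr \<circ> M) =
        distr (distr (lborel_on ?I) (lborel_on ?N) M) (lborel_on ?N) tr"
      by (rule distr_distr[symmetric]) measurable
    also have "\<dots> = lborel_on ?N"
      unfolding M_def tr_def lattice_coordinates_unimodular[OF r w] by (rule distr_translate[OF fin(3)])
    finally show ?thesis .
  qed
  moreover have "measure (distr (lborel_on ?I) (lborel_on ?N) (tr \<circ> M)) (reduced E T a) =
      measure (lborel_on ?I) ((tr \<circ> M) -` reduced E T a \<inter> space (lborel_on ?I))"
    by (rule measure_distr) measurable
  ultimately show ?thesis by simp
qed

end

locale ascending_digraph =
  fixes G :: "(nat, 'e) pre_digraph" and n :: nat
  assumes fin_digraph: "fin_digraph G"
    and verts: "verts G = {1..n + 1}"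
    and ascending: "e \<in> arcs G \<Longrightarrow> tail G e < head G e"
begin

sublocale arc_ends "tail G" "head G" .

lemma finite_arcs [simp]: "finite (arcs G)"
  using fin_digraph by (simp add: fin_digraph_def fin_digraph_axioms_def)

lemma arc_ends_bounds:
  assumes "e \<in> arcs G"
  shows "tail G e \<in> {1..n}" "head G e \<in> {1..n + 1}"
proof -
  interpret fin_digraph G by (rule fin_digraph)
  show "head G e \<in> {1..n + 1}" using head_in_verts[OF assms] verts by simp
  then show "tail G e \<in> {1..n}" using tail_in_verts[OF assms] verts ascending[OF assms] by auto
qed

end

locale rooted_digraph = ascending_digraph G n
  for G :: "(nat, 'e) pre_digraph" and n :: nat +
  assumes out_degree_pos: "i \<in> {1..n} \<Longrightarrow> 1 \<le> out_degree G i"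
begin

definition tree :: "'e set" where
  "tree = (\<lambda>i. SOME e. e \<in> out_arcs G i) ` {1..n}"

lemma tree_arc: "i \<in> {1..n} \<Longrightarrow> (SOME e. e \<in> out_arcs G i) \<in> out_arcs G i"
  unfolding some_in_eq using out_degree_pos[of i] by (auto simp: out_degree_def)

lemma tree_props: "tree \<subseteq> arcs G" "inj_on (tail G) tree" "tail G ` tree = {1..n}" "card tree = n"
proof -
  have t: "tail G (SOME e. e \<in> out_arcs G i) = i" if "i \<in> {1..n}" for i
    using tree_arc[OF that] by simp
  show "tree \<subseteq> arcs G" using tree_arc unfolding tree_def by fastforce
  show "inj_on (tail G) tree" unfolding tree_def inj_on_def using t by auto
  show im: "tail G ` tree = {1..n}" unfolding tree_def image_image using t by simp
  then show "card tree = n" using card_image[OF \<open>inj_on (tail G) tree\<close>] by simp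
qed

lemma rooted_tree: "rooted (arcs G) tree"
  unfolding rooted_def tree_props(3) using tree_props(1,2) ascending arc_ends_bounds(1)
  by (simp add: image_subset_iff)

lemma flow_space_eq: "flow_space G n a = flows (arcs G) tree a"
  unfolding flow_space_def flows_def tree_props(3) net_flow_def divergence_def
  by (simp add: out_arcs_def in_arcs_def)

text \<open>The net flow at \<open>n + 1\<close> is not prescribed by \<open>a\<close>, so that value is replaced by 0.\<close>

theorem flow_volume_eq_lidskii_sum:
  assumes "\<And>i. i \<in> {1..n} \<Longrightarrow> 0 \<le> a i"
  shows "flow_volume G n a = fact (card (arcs G) - n) *
    lidskii_sum (arcs G) tree {1..n + 1} (a(n + 1 := 0))"
proof -
  define d where "d = card (arcs G) - n"
  have d: "d = card (arcs G - tree)"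
    using tree_props by (simp add: d_def card_Diff_subset finite_subset[OF _ finite_arcs])
  define p where "p = (SOME p. p \<in> flow_space G n a)"
  define w where
    "w = (SOME w. lattice_basis (arcs G) (integer_points (arcs G) (flow_space G n (\<lambda>_. 0))) d w)"
  have p: "p \<in> flows (arcs G) tree a"
    unfolding p_def flow_space_eq using flow_of_in_flows[OF rooted_tree] by (metis someI)
  have w: "lattice_basis (arcs G) (integer_points (arcs G) (flows (arcs G) tree (\<lambda>_. 0))) d w"
    unfolding w_def flow_space_eq using someI_ex[OF ex_lattice_basis[OF rooted_tree]] d by simp
  have nn: "0 \<le> (a(n + 1 := 0)) v" if "v \<in> {1..n + 1}" for v
    using assms that by (cases "v = n + 1") auto
  \<comment> \<open>\<open>emeasure_reduced\<close> asks for nonnegative entries at all heads,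
    \<open>n + 1\<close> included. No arc leaves \<open>n + 1\<close>, so the tree flows at vertices
    up to \<open>n\<close> never read that entry.\<close>
  have red: "reduced (arcs G) tree a = reduced (arcs G) tree (a(n + 1 := 0))"
  proof -
    have "tree_flow (arcs G) tree a x j = tree_flow (arcs G) tree (a(n + 1 := 0)) x j"
      if "j \<le> n" for x j
      using that
    proof (induction j rule: less_induct)
      case (less j)
      have "(\<Sum>e | e \<in> arcs G \<and> head G e = j \<and> tail G e < j.
          if e \<in> tree then tree_flow (arcs G) tree a x (tail G e) else x e) =
        (\<Sum>e | e \<in> arcs G \<and> head G e = j \<and> tail G e < j.
          if e \<in> tree then tree_flow (arcs G) tree (a(n + 1 := 0)) x (tail G e) else x e)"
        using less by (intro sum.cong) (auto simp del: fun_upd_apply)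
      then show ?case
        unfolding tree_flow.simps[of "arcs G" tree a x j]
          tree_flow.simps[of "arcs G" tree "a(n + 1 := 0)" x j] using less.prems by simp
    qed
    then show ?thesis
      unfolding reduced_def using tree_props(1) arc_ends_bounds
      by (intro Collect_cong conj_cong ball_cong refl) (auto simp del: fun_upd_apply)
  qed
  have "flow_volume G n a = fact d * measure (lborel_on {..<d})
      {x \<in> {..<d} \<rightarrow>\<^sub>E UNIV. (\<lambda>e\<in>arcs G. p e + (\<Sum>i<d. x i * w i e)) \<in> flow_polytope G n a}"
    unfolding flow_volume_def p_def w_def d_def Let_def ..
  also have "\<dots> = fact d * measure (lborel_on (arcs G - tree)) (reduced (arcs G) tree a)"
    unfolding flow_polytope_def flow_space_eq measure_lattice_coordinates[OF rooted_tree w p] ..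
  also have "measure (lborel_on (arcs G - tree)) (reduced (arcs G) tree a) =
      lidskii_sum (arcs G) tree {1..n + 1} (a(n + 1 := 0))"
  proof -
    have "emeasure (lborel_on (arcs G - tree)) (reduced (arcs G) tree (a(n + 1 := 0))) =
        ennreal (lidskii_sum (arcs G) tree {1..n + 1} (a(n + 1 := 0)))"
      using arc_ends_bounds nn by (intro emeasure_reduced[OF rooted_tree]) fastforce+
    moreover have "0 \<le> lidskii_sum (arcs G) tree {1..n + 1} (a(n + 1 := 0))"
      by (rule lidskii_sum_nonneg) (rule nn)
    ultimately show ?thesis
      unfolding red measure_def by (simp only: enn2real_ennreal)
  qed
  finally show ?thesis unfolding d_def .
qed

end

section \<open>Counting gravity diagrams\<close>

text \<open>The classes of a kernel relation are the nonempty fibres, one for each value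
  taken.\<close>

lemma card_quotient_kernel:
  "card (D // {(x, y). x \<in> D \<and> y \<in> D \<and> F x = F y}) = card (F ` D)"
proof -
  let ?R = "{(x, y). x \<in> D \<and> y \<in> D \<and> F x = F y}"
  have "bij_betw (\<lambda>k. {x \<in> D. F x = k}) (F ` D) (D // ?R)"
    unfolding bij_betw_def
  proof
    show "inj_on (\<lambda>k. {x \<in> D. F x = k}) (F ` D)"
      by (rule inj_onI) blast
    have "?R `` {x} = {y \<in> D. F y = F x}" if "x \<in> D" for x
      using that by auto
    then show "(\<lambda>k. {x \<in> D. F x = k}) ` F ` D = D // ?R"
      unfolding quotient_def by auto
  qed
  then show ?thesis
    by (rule bij_betw_same_card[symmetric])
qed

definition line_counts ::
    "(nat, 'e) pre_digraph \<Rightarrow> (nat \<times> nat) set set \<times> ((nat \<times> nat) set \<Rightarrow> 'e) \<Rightarrow> 'e \<Rightarrow> nat" where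
  "line_counts H = (\<lambda>(P, f). \<lambda>e\<in>arcs H. card {l \<in> P. f l = e})"

text \<open>The number of lines through column \<open>i\<close>, when \<open>\<kappa>\<close> counts
  the lines of each arc: a line of the arc (j, k) occupies the columns from j to k - 1.\<close>

definition covering :: "(nat, 'e) pre_digraph \<Rightarrow> ('e \<Rightarrow> nat) \<Rightarrow> nat \<Rightarrow> nat" where
  "covering H \<kappa> i = (\<Sum>e | e \<in> arcs H \<and> tail H e \<le> i \<and> i < head H e. \<kappa> e)"

definition arc_multiplicities :: "(nat, 'e) pre_digraph \<Rightarrow> nat \<Rightarrow> (nat \<Rightarrow> int) \<Rightarrow> ('e \<Rightarrow> nat) set" where
  "arc_multiplicities H n v =
    {\<kappa> \<in> arcs H \<rightarrow>\<^sub>E UNIV. \<forall>i\<in>{1..<n}. int (covering H \<kappa> i) = root_coeff v i}"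

lemma diagram_equiv_eq_kernel:
  "diagram_equiv H n v = {(x, y). x \<in> line_dot_diagrams H n v \<and> y \<in> line_dot_diagrams H n v \<and>
    line_counts H x = line_counts H y}"
proof -
  have "line_counts H (P, f) = line_counts H (P', f') \<longleftrightarrow>
      (\<forall>e\<in>arcs H. card {l \<in> P. f l = e} = card {l \<in> P'. f' l = e})" for P f P' f'
  proof -
    have "restrict g (arcs H) = restrict g' (arcs H) \<longleftrightarrow> (\<forall>e\<in>arcs H. g e = g' e)" for g g' :: "'a \<Rightarrow> nat"
      by (auto simp: restrict_def fun_eq_iff)
    then show ?thesis unfolding line_counts_def case_prod_conv .
  qed
  then show ?thesis
    unfolding diagram_equiv_def by auto
qed

lemma finite_dots: "finite (dots n v)"
  by (simp add: dots_def)

text \<open>Double counting in column \<open>i\<close>: every dot lies on exactly one line, and a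
  line has one dot there if its arc spans the column and none otherwise.\<close>

lemma line_counts_in_multiplicities:
  assumes fin: "finite (arcs H)" and D: "(P, f) \<in> line_dot_diagrams H n v"
  shows "line_counts H (P, f) \<in> arc_multiplicities H n v"
proof -
  have part: "partition_on (dots n v) P" and f: "f \<in> P \<rightarrow>\<^sub>E arcs H"
    and line: "\<And>l. l \<in> P \<Longrightarrow> bij_betw fst l {tail H (f l)..<head H (f l)}"
    and nn: "\<And>i. i \<in> {1..<n} \<Longrightarrow> 0 \<le> root_coeff v i"
    using D by (auto simp: line_dot_diagrams_def)
  have P: "finite P"
    using part finite_dots finite_elements by blast
  have "int (covering H (line_counts H (P, f)) i) = root_coeff v i" if i: "i \<in> {1..<n}" for i
  proof -
    define A where "A = {e \<in> arcs H. tail H e \<le> i \<and> i < head H e}"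
    define Q where "Q = {l \<in> P. f l \<in> A}"
    define C where "C = {i} \<times> {1..nat (root_coeff v i)}"
    have C: "C = {x \<in> dots n v. fst x = i}" using i by (auto simp: C_def dots_def)
    have one: "card (l \<inter> C) = 1" if l: "l \<in> Q" for l
    proof -
      have lP: "l \<in> P" using l by (simp add: Q_def)
      have "i \<in> fst ` l" using line[OF lP] l by (simp add: bij_betw_def Q_def A_def)
      then obtain x where x: "x \<in> l" "fst x = i" by auto
      have "inj_on fst l" using line[OF lP] by (simp add: bij_betw_def)
      moreover have "l \<subseteq> dots n v" using part lP by (auto simp: partition_on_def)
      ultimately have "l \<inter> C = {x}" using x unfolding C by (auto dest: inj_onD)
      then show ?thesis by simp
    qed
    have "C = (\<Union>l\<in>Q. l \<inter> C)"
    proof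
      show "C \<subseteq> (\<Union>l\<in>Q. l \<inter> C)"
      proof
        fix x assume x: "x \<in> C"
        then have "x \<in> \<Union>P" using part unfolding C by (auto simp: partition_on_def)
        then obtain l where l: "l \<in> P" "x \<in> l" by auto
        then have "fst x \<in> {tail H (f l)..<head H (f l)}"
          using line[OF l(1)] by (auto dest: bij_betwE)
        then have "l \<in> Q" using x l f by (auto simp: Q_def A_def C)
        then show "x \<in> (\<Union>l\<in>Q. l \<inter> C)" using x l by auto
      qed
    qed auto
    then have "card C = card (\<Union>l\<in>Q. l \<inter> C)" by simp
    also have "\<dots> = (\<Sum>l\<in>Q. card (l \<inter> C))"
    proof (rule card_UN_disjoint)
      show "finite Q" using P by (simp add: Q_def)
      show "\<forall>l\<in>Q. finite (l \<inter> C)" by (simp add: C_def)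
      show "\<forall>l\<in>Q. \<forall>l'\<in>Q. l \<noteq> l' \<longrightarrow> (l \<inter> C) \<inter> (l' \<inter> C) = {}"
        using part by (auto simp: partition_on_def disjoint_def Q_def)
    qed
    also have "\<dots> = card Q" using one by simp
    also have "Q = (\<Union>e\<in>A. {l \<in> P. f l = e})" by (auto simp: Q_def)
    also have "card \<dots> = (\<Sum>e\<in>A. card {l \<in> P. f l = e})"
      using P fin by (intro card_UN_disjoint) (auto simp: A_def)
    also have "\<dots> = covering H (line_counts H (P, f)) i"
      unfolding covering_def A_def by (intro sum.cong) (auto simp: line_counts_def)
    finally show ?thesis using nn[OF i] by (simp add: C_def)
  qed
  then show ?thesis
    by (auto simp: arc_multiplicities_def line_counts_def)
qed

text \<open>Take \<open>\<kappa> e\<close> copies of each arc \<open>e\<close>. In column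
  \<open>i\<close> the copies spanning it are equinumerous with the dots, so a bijection
  \<open>g i\<close> can be fixed for each column independently; the line of a copy collects its
  dots from all the columns it spans.\<close>

lemma multiplicities_in_line_counts:
  assumes fin: "finite (arcs H)"
    and arcs: "\<And>e. e \<in> arcs H \<Longrightarrow> 1 \<le> tail H e \<and> tail H e < head H e \<and> head H e \<le> n"
    and \<kappa>: "\<kappa> \<in> arc_multiplicities H n v"
  shows "\<kappa> \<in> line_counts H ` line_dot_diagrams H n v"
proof -
  define L where "L i = (SIGMA e:{e \<in> arcs H. tail H e \<le> i \<and> i < head H e}. {..<\<kappa> e})" for i
  have \<kappa>E: "\<kappa> \<in> arcs H \<rightarrow>\<^sub>E UNIV"
    and cov: "\<And>i. i \<in> {1..<n} \<Longrightarrow> int (covering H \<kappa> i) = root_coeff v i"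
    using \<kappa> by (auto simp: arc_multiplicities_def)
  have "\<exists>g. bij_betw g (L i) {1..nat (root_coeff v i)}" if i: "i \<in> {1..<n}" for i
  proof (rule finite_same_card_bij)
    show "finite (L i)" using fin by (simp add: L_def)
    have "card (L i) = covering H \<kappa> i" using fin by (simp add: L_def covering_def)
    then show "card (L i) = card {1..nat (root_coeff v i)}" using cov[OF i] by simp
  qed simp
  then obtain g where g: "\<And>i. i \<in> {1..<n} \<Longrightarrow> bij_betw (g i) (L i) {1..nat (root_coeff v i)}"
    by metis
  define S where "S = (SIGMA e:arcs H. {..<\<kappa> e})"
  define line where "line p = (\<lambda>i. (i, g i p)) ` {tail H (fst p)..<head H (fst p)}" for p
  have SL: "p \<in> L i" "i \<in> {1..<n}" if "p \<in> S" "i \<in> {tail H (fst p)..<head H (fst p)}" for p i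
    using that arcs[of "fst p"] by (auto simp: S_def L_def)
  have LS: "p \<in> S" "i \<in> {tail H (fst p)..<head H (fst p)}" if "p \<in> L i" for p i
    using that by (auto simp: S_def L_def)
  have meet: "p = q" if p: "p \<in> S" and q: "q \<in> S" and x: "x \<in> line p" "x \<in> line q" for p q x
  proof -
    obtain i where i: "i \<in> {tail H (fst p)..<head H (fst p)}" "x = (i, g i p)"
      using x(1) by (auto simp: line_def)
    then have iq: "i \<in> {tail H (fst q)..<head H (fst q)}" "g i p = g i q"
      using x(2) by (auto simp: line_def)
    show ?thesis
      using g[OF SL(2)[OF p i(1)]] SL(1)[OF p i(1)] SL(1)[OF q iq(1)] iq(2)
      by (auto simp: bij_betw_def dest: inj_onD)
  qed
  \<comment> \<open>Lines of distinct copies are disjoint, but this gives injectivity only if no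
    line is empty, which holds because tails lie below heads.\<close>
  have ne: "line p \<noteq> {}" if "p \<in> S" for p
    using that arcs by (auto simp: line_def S_def)
  have inj: "inj_on line S"
    using meet ne by (intro inj_onI) (metis all_not_in_conv)
  define P where "P = line ` S"
  define f where "f = (\<lambda>l\<in>P. fst (inv_into S line l))"
  have fl: "f (line p) = fst p" if "p \<in> S" for p
    using that inj by (simp add: f_def P_def)
  have "partition_on (dots n v) P"
  proof (rule partition_onI)
    show "\<Union>P = dots n v"
    proof (intro equalityI subsetI)
      fix x assume "x \<in> \<Union>P"
      then obtain p i where p: "p \<in> S" and i: "i \<in> {tail H (fst p)..<head H (fst p)}" "x = (i, g i p)"
        by (auto simp: P_def line_def)
      then have "g i p \<in> {1..nat (root_coeff v i)}"
        using bij_betwE[OF g] SL by blast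
      then show "x \<in> dots n v" using SL(2)[OF p i(1)] i(2) by (simp add: dots_def)
    next
      fix x assume "x \<in> dots n v"
      then obtain i j where x: "x = (i, j)" and i: "i \<in> {1..<n}" and j: "j \<in> {1..nat (root_coeff v i)}"
        by (auto simp: dots_def)
      obtain p where p: "p \<in> L i" "g i p = j"
        using g[OF i] j unfolding bij_betw_def by (metis imageE)
      have "x \<in> line p" unfolding x line_def using LS(2)[OF p(1)] p(2) by auto
      then show "x \<in> \<Union>P" using LS(1)[OF p(1)] by (auto simp: P_def)
    qed
    show "disjnt l l'" if "l \<in> P" "l' \<in> P" "l \<noteq> l'" for l l'
      using that meet unfolding P_def disjnt_def by blast
    show "{} \<notin> P"
      using ne by (auto simp: P_def)
  qed
  moreover have "f \<in> P \<rightarrow>\<^sub>E arcs H"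
    using fl by (auto simp: f_def P_def S_def)
  moreover have "bij_betw fst l {tail H (f l)..<head H (f l)}" if "l \<in> P" for l
  proof -
    obtain p where p: "p \<in> S" "l = line p" using \<open>l \<in> P\<close> unfolding P_def by blast
    show ?thesis
      unfolding p(2) fl[OF p(1)] unfolding line_def bij_betw_def
      by (auto simp: inj_on_def image_image)
  qed
  moreover have "0 \<le> root_coeff v i" if "i \<in> {1..<n}" for i
    using cov[OF that] by linarith
  ultimately have D: "(P, f) \<in> line_dot_diagrams H n v"
    by (auto simp: line_dot_diagrams_def)
  have "line_counts H (P, f) = \<kappa>"
  proof
    fix e
    show "line_counts H (P, f) e = \<kappa> e"
    proof (cases "e \<in> arcs H")
      case True
      have "{l \<in> P. f l = e} = line ` ({e} \<times> {..<\<kappa> e})"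
        using True fl by (auto simp: P_def S_def)
      also have "card \<dots> = card ({e} \<times> {..<\<kappa> e})"
        using True by (intro card_image inj_on_subset[OF inj]) (auto simp: S_def)
      finally show ?thesis using True by (simp add: line_counts_def)
    next
      case False
      then show ?thesis using PiE_arb[OF \<kappa>E False] by (simp add: line_counts_def)
    qed
  qed
  then show ?thesis using D by (metis imageI)
qed

theorem card_gravity_diagrams:
  assumes "finite (arcs H)"
    and "\<And>e. e \<in> arcs H \<Longrightarrow> 1 \<le> tail H e \<and> tail H e < head H e \<and> head H e \<le> n"
  shows "card (gravity_diagrams H n v) = card (arc_multiplicities H n v)"
proof -
  have "line_counts H ` line_dot_diagrams H n v = arc_multiplicities H n v"
    using line_counts_in_multiplicities[OF assms(1)] multiplicities_in_line_counts[OF assms] by fast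
  then show ?thesis
    unfolding gravity_diagrams_def diagram_equiv_eq_kernel card_quotient_kernel by simp
qed

section \<open>Counting labelings\<close>

text \<open>At a least disagreement \<open>x\<close>, the smaller of the two values is attained by
  the other function at some \<open>z < x\<close>. There both functions agree, so one of them takes
  the same value at \<open>z\<close> and at \<open>x\<close>.\<close>

lemma strict_mono_on_image_unique:
  fixes h h' :: "'a::wellorder \<Rightarrow> 'b::linorder"
  assumes h: "strict_mono_on C h" and h': "strict_mono_on C h'" and im: "h ` C = h' ` C"
    and x: "x \<in> C"
  shows "h x = h' x"
  using x
proof (induction x rule: less_induct)
  case (less x)
  have aux: False if f: "strict_mono_on C f" and f': "strict_mono_on C f'" and im: "f ` C = f' ` C"
    and IH: "\<And>y. y < x \<Longrightarrow> y \<in> C \<Longrightarrow> f y = f' y" and lt: "f x < f' x" for f f' :: "'a \<Rightarrow> 'b"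
  proof -
    obtain z where z: "z \<in> C" "f x = f' z" using im less.prems by blast
    then have "z < x"
      using lt f' less.prems by (metis linorder_less_linear order_less_asym strict_mono_onD)
    then have "f z = f x" using IH z by simp
    then show False using strict_mono_onD[OF f z(1) less.prems \<open>z < x\<close>] by simp
  qed
  show ?case
    using aux[OF h h' im] aux[OF h' h im[symmetric]] less.IH by (metis linorder_less_linear)
qed

lemma ex_strict_mono_bij_betw:
  fixes C B :: "nat set"
  assumes "finite C" "finite B" "card C = card B"
  shows "\<exists>h. bij_betw h C B \<and> strict_mono_on C h"
proof -
  obtain b where b: "bij_betw b {..<card B} B" "strict_mono_on {..<card B} b"
    using ex_bij_betw_strict_mono_card[OF assms(2)] .
  obtain c where c: "bij_betw c {..<card C} C" "strict_mono_on {..<card C} c"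
    using ex_bij_betw_strict_mono_card[OF assms(1)] .
  define c' where "c' = inv_into {..<card C} c"
  have c': "bij_betw c' C {..<card C}"
    unfolding c'_def by (rule bij_betw_inv_into[OF c(1)])
  have "strict_mono_on C c'"
  proof (rule strict_mono_onI)
    fix x y assume xy: "x \<in> C" "y \<in> C" "x < y"
    have "c (c' x) = x" "c (c' y) = y"
      using xy c(1) unfolding c'_def by (auto simp: bij_betw_def f_inv_into_f)
    moreover have "c' x \<in> {..<card C}" "c' y \<in> {..<card C}" using c' xy by (auto dest: bij_betwE)
    ultimately show "c' x < c' y"
      using xy(3) c(2) by (metis linorder_less_linear order_less_asym strict_mono_onD)
  qed
  then have "strict_mono_on C (b \<circ> c')"
    using b(2) c' assms(3) by (auto simp: strict_mono_on_def dest: bij_betwE)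
  moreover have "bij_betw (b \<circ> c') C B"
    using bij_betw_trans[OF c'] b(1) assms(3) by simp
  ultimately show ?thesis by blast
qed

text \<open>The label set is arbitrary, since removing the last column of a path leaves an arbitrary
  subset of the labels for the rest.\<close>

definition column_increasing_bijections :: "(nat \<Rightarrow> nat) \<Rightarrow> nat \<Rightarrow> nat set \<Rightarrow> (nat \<Rightarrow> nat) set" where
  "column_increasing_bijections s n L = {\<sigma> \<in> {1..\<Sum>i=1..n. s i} \<rightarrow>\<^sub>E L.
    bij_betw \<sigma> {1..\<Sum>i=1..n. s i} L \<and> (\<forall>i\<in>{1..n}. strict_mono_on (column_steps s i) \<sigma>)}"

lemma column_steps_subset:
  assumes "i \<in> {1..n}"
  shows "column_steps s i \<subseteq> {1..\<Sum>i=1..n. s i}"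
proof -
  have "(\<Sum>h=1..i. s h) \<le> (\<Sum>h=1..n. s h)" using assms by (intro sum_mono2) auto
  then show ?thesis by (auto simp: column_steps_def)
qed

lemma column_steps_Suc: "column_steps s (Suc n) = {(\<Sum>i=1..n. s i)<..(\<Sum>i=1..n. s i) + s (Suc n)}"
  by (simp add: column_steps_def atLeastLessThanSuc_atLeastAtMost)

text \<open>The set of labels used in the last column determines their order there, because they
  must increase; the earlier columns use the remaining labels freely.\<close>

lemma bij_betw_split_last_column:
  fixes s :: "nat \<Rightarrow> nat" and n :: nat
  assumes L: "finite L" "card L = (\<Sum>i=1..Suc n. s i)"
  shows "bij_betw (\<lambda>\<sigma>. (\<sigma> ` column_steps s (Suc n), restrict \<sigma> {1..\<Sum>i=1..n. s i}))
    (column_increasing_bijections s (Suc n) L)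
    (SIGMA B:{B. B \<subseteq> L \<and> card B = s (Suc n)}. column_increasing_bijections s n (L - B))"
proof -
  define m where "m = (\<Sum>i=1..n. s i)"
  define C where "C = column_steps s (Suc n)"
  have C: "C = {m<..m + s (Suc n)}" by (simp add: C_def m_def column_steps_Suc)
  have m': "(\<Sum>i=1..Suc n. s i) = m + s (Suc n)" by (simp add: m_def)
  have un: "{1..m + s (Suc n)} = {1..m} \<union> C" and dis: "{1..m} \<inter> C = {}" by (auto simp: C)
  have cC: "card C = s (Suc n)" by (simp add: C)
  define \<Phi> where "\<Phi> \<sigma> = (\<sigma> ` C, restrict \<sigma> {1..m})" for \<sigma> :: "nat \<Rightarrow> nat"
  let ?A = "column_increasing_bijections s (Suc n) L"
  let ?S = "SIGMA B:{B. B \<subseteq> L \<and> card B = s (Suc n)}. column_increasing_bijections s n (L - B)"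
  have A: "\<sigma> \<in> ?A \<longleftrightarrow> \<sigma> \<in> {1..m} \<union> C \<rightarrow>\<^sub>E L \<and> bij_betw \<sigma> ({1..m} \<union> C) L \<and>
      strict_mono_on C \<sigma> \<and> (\<forall>i\<in>{1..n}. strict_mono_on (column_steps s i) \<sigma>)" for \<sigma>
  proof -
    have "{1..Suc n} = insert (Suc n) {1..n}" by auto
    then show ?thesis unfolding column_increasing_bijections_def m' un C_def by auto
  qed
  have sub: "x \<in> {1..m}" if "i \<in> {1..n}" "x \<in> column_steps s i" for i x
    using column_steps_subset[OF that(1), of s] that(2) by (auto simp: m_def)
  have smr: "strict_mono_on (column_steps s i) \<tau>"
    if "i \<in> {1..n}" "strict_mono_on (column_steps s i) \<sigma>" "\<And>x. x \<in> {1..m} \<Longrightarrow> \<tau> x = \<sigma> x" for i and \<sigma> \<tau> :: "nat \<Rightarrow> nat"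
    using that sub[OF that(1)] by (auto simp: strict_mono_on_def)
  have "bij_betw \<Phi> ?A ?S"
    unfolding bij_betw_def
  proof
    show "inj_on \<Phi> ?A"
    proof (rule inj_onI)
      fix \<sigma> \<sigma>' assume \<sigma>: "\<sigma> \<in> ?A" and \<sigma>': "\<sigma>' \<in> ?A" and eq: "\<Phi> \<sigma> = \<Phi> \<sigma>'"
      show "\<sigma> = \<sigma>'"
      proof
        fix x
        consider "x \<in> {1..m}" | "x \<in> C" | "x \<notin> {1..m} \<union> C" by blast
        then show "\<sigma> x = \<sigma>' x"
        proof cases
          case 1
          then show ?thesis using eq by (auto simp: \<Phi>_def dest: fun_cong[where x=x])
        next
          case 2
          then show ?thesis
            using \<sigma> \<sigma>' eq by (intro strict_mono_on_image_unique[of C]) (auto simp: A \<Phi>_def)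
        next
          case 3
          have "\<sigma> \<in> {1..m} \<union> C \<rightarrow>\<^sub>E L" "\<sigma>' \<in> {1..m} \<union> C \<rightarrow>\<^sub>E L" using \<sigma> \<sigma>' A by blast+
          from PiE_arb[OF this(1) 3] PiE_arb[OF this(2) 3] show ?thesis by simp
        qed
      qed
    qed
    show "\<Phi> ` ?A = ?S"
    proof (intro equalityI subsetI)
      fix y assume "y \<in> \<Phi> ` ?A"
      then obtain \<sigma> where \<sigma>: "\<sigma> \<in> ?A" and y: "y = (\<sigma> ` C, restrict \<sigma> {1..m})" by (auto simp: \<Phi>_def)
      have bij: "bij_betw \<sigma> ({1..m} \<union> C) L" using \<sigma> A by blast
      then have inj: "inj_on \<sigma> ({1..m} \<union> C)" and im: "\<sigma> ` ({1..m} \<union> C) = L" by (auto simp: bij_betw_def)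
      have "\<sigma> ` C \<subseteq> L" using im by auto
      moreover have "card (\<sigma> ` C) = s (Suc n)"
        using card_image[OF inj_on_subset[OF inj]] cC by simp
      moreover have "bij_betw \<sigma> {1..m} (L - \<sigma> ` C)"
      proof -
        have "\<sigma> ` {1..m} \<inter> \<sigma> ` C = {}"
          using inj_on_image_Int[OF inj, of "{1..m}" C] dis by simp
        then have "\<sigma> ` {1..m} = L - \<sigma> ` C" using im by blast
        then show ?thesis using inj_on_subset[OF inj] by (simp add: bij_betw_def)
      qed
      then have "bij_betw (restrict \<sigma> {1..m}) {1..m} (L - \<sigma> ` C)"
        by (rule bij_betw_cong[THEN iffD1, rotated]) simp
      moreover from this have "restrict \<sigma> {1..m} \<in> {1..m} \<rightarrow>\<^sub>E L - \<sigma> ` C"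
        by (auto dest: bij_betwE)
      moreover have "strict_mono_on (column_steps s i) (restrict \<sigma> {1..m})" if "i \<in> {1..n}" for i
      proof (rule smr[OF that])
        show "strict_mono_on (column_steps s i) \<sigma>"
          using \<sigma>[unfolded A] that by (elim conjE bspec)
      qed simp
      ultimately show "y \<in> ?S"
        unfolding y column_increasing_bijections_def m_def[symmetric]
        by (intro SigmaI CollectI conjI ballI)
    next
      fix y assume "y \<in> ?S"
      then obtain B \<tau> where y: "y = (B, \<tau>)" and B: "B \<subseteq> L" "card B = s (Suc n)"
        and "\<tau> \<in> column_increasing_bijections s n (L - B)"
        by blast
      then have \<tau>: "\<tau> \<in> {1..m} \<rightarrow>\<^sub>E L - B" "bij_betw \<tau> {1..m} (L - B)"
          "\<forall>i\<in>{1..n}. strict_mono_on (column_steps s i) \<tau>"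
        unfolding column_increasing_bijections_def m_def[symmetric] by simp_all
      obtain h where h: "bij_betw h C B" "strict_mono_on C h"
        using ex_strict_mono_bij_betw[of C B] cC B L finite_subset by (auto simp: C)
      define \<sigma> where "\<sigma> x = (if x \<in> {1..m} then \<tau> x else if x \<in> C then h x else undefined)" for x
      have \<sigma>m: "\<sigma> x = \<tau> x" if "x \<in> {1..m}" for x using that by (simp add: \<sigma>_def)
      have \<sigma>C: "\<sigma> x = h x" if "x \<in> C" for x using that dis by (auto simp: \<sigma>_def)
      have "bij_betw \<sigma> {1..m} (L - B)" using bij_betw_cong[of "{1..m}" \<sigma> \<tau>] \<sigma>m \<tau>(2) by blast
      moreover have bC: "bij_betw \<sigma> C B" using bij_betw_cong[of C \<sigma> h] \<sigma>C h(1) by blast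
      ultimately have "bij_betw \<sigma> ({1..m} \<union> C) ((L - B) \<union> B)"
        by (rule bij_betw_combine) auto
      then have bij: "bij_betw \<sigma> ({1..m} \<union> C) L" using B(1) by (simp add: Un_absorb2)
      moreover have "\<sigma> \<in> {1..m} \<union> C \<rightarrow>\<^sub>E L"
      proof (rule PiE_I)
        show "\<sigma> x \<in> L" if "x \<in> {1..m} \<union> C" for x
          using bij_betwE[OF bij] that by (rule bspec)
        show "\<sigma> x = undefined" if "x \<notin> {1..m} \<union> C" for x
          using that by (auto simp: \<sigma>_def)
      qed
      moreover have "strict_mono_on C \<sigma>"
        using h(2) \<sigma>C by (auto simp: strict_mono_on_def)
      moreover have "strict_mono_on (column_steps s i) \<sigma>" if "i \<in> {1..n}" for i
        by (rule smr[OF that bspec[OF \<tau>(3) that] \<sigma>m])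
      ultimately have "\<sigma> \<in> ?A" unfolding A by blast
      moreover have "\<Phi> \<sigma> = y"
      proof -
        have "\<sigma> ` C = B" using bC by (simp add: bij_betw_def)
        moreover have "restrict \<sigma> {1..m} = \<tau>"
          using PiE_arb[OF \<tau>(1)] \<sigma>m by (auto simp: fun_eq_iff)
        ultimately show ?thesis by (simp add: \<Phi>_def y)
      qed
      ultimately show "y \<in> \<Phi> ` ?A" by blast
    qed
  qed
  then show ?thesis unfolding \<Phi>_def C_def m_def .
qed

text \<open>The multinomial coefficient, one binomial coefficient per column; the product form keeps
  it within the natural numbers.\<close>

lemma card_column_increasing_bijections:
  assumes "finite L" "card L = (\<Sum>i=1..n. s i)"
  shows "card (column_increasing_bijections s n L) * (\<Prod>i=1..n. fact (s i)) = fact (\<Sum>i=1..n. s i)"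
  using assms
proof (induction n arbitrary: L)
  case 0
  then have "column_increasing_bijections s 0 L = {\<lambda>_. undefined}"
    by (auto simp: column_increasing_bijections_def bij_betw_def)
  then show ?case by simp
next
  case (Suc n)
  define m where "m = (\<Sum>i=1..n. s i)"
  define p where "p = (\<Prod>i=1..n. fact (s i) :: nat)"
  have L: "card L = m + s (Suc n)" using Suc.prems by (simp add: m_def)
  let ?S = "{B. B \<subseteq> L \<and> card B = s (Suc n)}"
  have finS: "finite ?S" using Suc.prems(1) by simp
  have IH: "card (column_increasing_bijections s n (L - B)) * p = fact m" if "B \<in> ?S" for B
  proof -
    have "card (L - B) = m"
      using that Suc.prems(1) L by (subst card_Diff_subset) (auto intro: finite_subset)
    then show ?thesis using Suc.IH[of "L - B"] Suc.prems(1) by (simp add: m_def p_def)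
  qed
  have fin: "finite (column_increasing_bijections s n (L - B))" for B
    using Suc.prems(1) by (intro finite_subset[OF _ finite_PiE[of "{1..m}" "\<lambda>_. L - B"]])
      (auto simp: column_increasing_bijections_def m_def)
  have "card (column_increasing_bijections s (Suc n) L) =
      (\<Sum>B\<in>?S. card (column_increasing_bijections s n (L - B)))"
    using bij_betw_same_card[OF bij_betw_split_last_column[OF Suc.prems]] finS fin by simp
  then have "card (column_increasing_bijections s (Suc n) L) * p = (\<Sum>B\<in>?S. fact m)"
    using IH by (simp add: sum_distrib_right)
  also have "\<dots> = (card L choose s (Suc n)) * fact m"
    using n_subsets[OF Suc.prems(1)] by simp
  finally have "card (column_increasing_bijections s (Suc n) L) * (p * fact (s (Suc n))) =
      fact (s (Suc n)) * fact m * (m + s (Suc n) choose s (Suc n))"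
    unfolding L by (simp add: algebra_simps)
  also have "\<dots> = fact (m + s (Suc n))"
    using binomial_fact_lemma[of "s (Suc n)" "m + s (Suc n)"] by simp
  finally show ?case by (simp add: m_def p_def)
qed

text \<open>Off the set of steps a permutation is the identity and an extensional function is
  \<open>undefined\<close>; the bijection exchanges these defaults.\<close>

lemma card_labelings:
  "card {\<sigma>. \<sigma> permutes {1..\<Sum>i=1..n. s i} \<and> (\<forall>i\<in>{1..n}. strict_mono_on (column_steps s i) \<sigma>)}
    * (\<Prod>i=1..n. fact (s i)) = fact (\<Sum>i=1..n. s i)"
proof -
  let ?S = "{1..\<Sum>i=1..n. s i}"
  let ?P = "{\<sigma>. \<sigma> permutes ?S \<and> (\<forall>i\<in>{1..n}. strict_mono_on (column_steps s i) \<sigma>)}"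
  have sm: "strict_mono_on (column_steps s i) \<sigma> \<longleftrightarrow> strict_mono_on (column_steps s i) \<tau>"
    if "i \<in> {1..n}" "\<And>x. x \<in> ?S \<Longrightarrow> \<sigma> x = \<tau> x" for i and \<sigma> \<tau> :: "nat \<Rightarrow> nat"
  proof -
    have "\<sigma> x = \<tau> x" if "x \<in> column_steps s i" for x
      using that \<open>\<And>x. x \<in> ?S \<Longrightarrow> \<sigma> x = \<tau> x\<close> column_steps_subset[OF \<open>i \<in> {1..n}\<close>, of s] by blast
    then show ?thesis by (simp add: strict_mono_on_def)
  qed
  have "bij_betw (\<lambda>\<sigma>. restrict \<sigma> ?S) ?P (column_increasing_bijections s n ?S)"
  proof (rule bij_betwI[where g="\<lambda>\<tau> x. if x \<in> ?S then \<tau> x else x"])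
    show "(\<lambda>\<sigma>. restrict \<sigma> ?S) \<in> ?P \<rightarrow> column_increasing_bijections s n ?S"
    proof
      fix \<sigma> assume \<sigma>: "\<sigma> \<in> ?P"
      then have "bij_betw \<sigma> ?S ?S" by (auto dest: permutes_imp_bij)
      then have "bij_betw (restrict \<sigma> ?S) ?S ?S"
        by (rule bij_betw_cong[THEN iffD1, rotated]) simp
      moreover from this have "restrict \<sigma> ?S \<in> ?S \<rightarrow>\<^sub>E ?S"
        by (intro restrict_PiE_iff[THEN iffD2]) (auto dest: bij_betwE)
      moreover have "strict_mono_on (column_steps s i) (restrict \<sigma> ?S)" if "i \<in> {1..n}" for i
        using \<sigma> that sm[OF that, of "restrict \<sigma> ?S" \<sigma>] by simp
      ultimately show "restrict \<sigma> ?S \<in> column_increasing_bijections s n ?S"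
        unfolding column_increasing_bijections_def by blast
    qed
    show "(\<lambda>\<tau> x. if x \<in> ?S then \<tau> x else x) \<in> column_increasing_bijections s n ?S \<rightarrow> ?P"
    proof
      fix \<tau> assume \<tau>: "\<tau> \<in> column_increasing_bijections s n ?S"
      let ?\<sigma> = "\<lambda>x. if x \<in> ?S then \<tau> x else x"
      have "bij_betw \<tau> ?S ?S" using \<tau> by (auto simp: column_increasing_bijections_def)
      then have "bij_betw ?\<sigma> ?S ?S" by (rule bij_betw_cong[THEN iffD1, rotated]) simp
      then have "?\<sigma> permutes ?S" by (rule bij_imp_permutes) auto
      moreover have "strict_mono_on (column_steps s i) ?\<sigma>" if "i \<in> {1..n}" for i
        using \<tau> that sm[OF that, of ?\<sigma> \<tau>] by (auto simp: column_increasing_bijections_def)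
      ultimately show "?\<sigma> \<in> ?P" by blast
    qed
    show "(\<lambda>x. if x \<in> ?S then restrict \<sigma> ?S x else x) = \<sigma>" if "\<sigma> \<in> ?P" for \<sigma>
      using that by (auto simp: fun_eq_iff permutes_def)
    show "(\<lambda>x\<in>?S. if x \<in> ?S then \<tau> x else x) = \<tau>" if "\<tau> \<in> column_increasing_bijections s n ?S" for \<tau>
    proof -
      have "\<tau> \<in> ?S \<rightarrow>\<^sub>E ?S" using that by (simp add: column_increasing_bijections_def)
      from PiE_arb[OF this] show ?thesis by (auto simp: fun_eq_iff)
    qed
  qed
  from bij_betw_same_card[OF this] show ?thesis
    using card_column_increasing_bijections[of ?S s n] by simp
qed

section \<open>Unified diagrams and admissible multiplicities\<close>

context ascending_digraph
begin

abbreviation H :: "(nat, 'e) pre_digraph" where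
  "H \<equiv> G \<restriction> {1..n}"

definition net :: "('e \<Rightarrow> nat) \<Rightarrow> nat \<Rightarrow> int" where
  "net \<kappa> v = (\<Sum>e | e \<in> arcs H \<and> tail G e = v. int (\<kappa> e)) - (\<Sum>e | e \<in> arcs H \<and> head G e = v. int (\<kappa> e))"

lemma arcs_H: "arcs H = {e \<in> arcs G. head G e \<noteq> n + 1}"
  using arc_ends_bounds by fastforce

lemma finite_arcs_H [simp]: "finite (arcs H)"
  by (simp add: arcs_H)

lemma finite_out_arcs [simp]: "finite (out_arcs G v)"
  by (rule finite_subset[OF _ finite_arcs]) auto

lemma arc_bounds_H:
  "e \<in> arcs H \<Longrightarrow> 1 \<le> tail H e \<and> tail H e < head H e \<and> head H e \<le> n"
  using ascending by auto

lemma covering_H: "covering H \<kappa> i = (\<Sum>e | e \<in> arcs H \<and> tail G e \<le> i \<and> i < head G e. \<kappa> e)"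
  by (simp add: covering_def)

text \<open>An arc with both ends at most \<open>i\<close> cancels from the sum, and what remains
  are the arcs from a vertex up to \<open>i\<close> to one beyond it.\<close>

lemma sum_net_eq_covering: "(\<Sum>h=1..i. net \<kappa> h) = int (covering H \<kappa> i)"
proof (induction i)
  case 0
  have "{e \<in> arcs H. tail G e \<le> 0 \<and> 0 < head G e} = {}"
    using arc_bounds_H by fastforce
  then show ?case unfolding covering_H by (simp only: sum.empty) simp
next
  case (Suc i)
  let ?A = "{e \<in> arcs H. tail G e \<le> i \<and> i < head G e}"
  let ?B = "{e \<in> arcs H. tail G e \<le> Suc i \<and> Suc i < head G e}"
  let ?t = "{e \<in> arcs H. tail G e = Suc i}" and ?h = "{e \<in> arcs H. head G e = Suc i}"
  have fin: "finite {e \<in> arcs H. P e}" for P by (rule finite_subset[OF _ finite_arcs_H]) auto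
  \<comment> \<open>An arc over \<open>i\<close> either ends at \<open>Suc i\<close> or also passes
    over it; an arc over \<open>Suc i\<close> either starts there or also passes over
    \<open>i\<close>.\<close>
  have un: "?A \<union> ?t = ?B \<union> ?h"
    using arc_bounds_H by fastforce
  have "(\<Sum>e\<in>?A. int (\<kappa> e)) + (\<Sum>e\<in>?t. int (\<kappa> e)) = (\<Sum>e\<in>?A \<union> ?t. int (\<kappa> e))"
    by (rule sum.union_disjoint[symmetric, OF fin fin]) auto
  also have "\<dots> = (\<Sum>e\<in>?B. int (\<kappa> e)) + (\<Sum>e\<in>?h. int (\<kappa> e))"
    unfolding un by (rule sum.union_disjoint[OF fin fin]) auto
  finally show ?case
    using Suc unfolding covering_H net_def of_nat_sum by simp
qed

lemma covering_last: "covering H \<kappa> n = 0"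
proof -
  have "{e \<in> arcs H. tail G e \<le> n \<and> n < head G e} = {}"
    using arc_bounds_H by fastforce
  then show ?thesis unfolding covering_H by (simp only: sum.empty)
qed

text \<open>A vector is determined by its partial sums. The columns give those for
  \<open>i < n\<close>; the last one agrees because \<open>v\<close> has entry sum 0 and no arc of
  \<open>H\<close> passes beyond \<open>n\<close>.\<close>

lemma multiplicities_iff_net:
  assumes "\<kappa> \<in> arcs H \<rightarrow>\<^sub>E UNIV" and "(\<Sum>h=1..n. v h) = 0"
  shows "\<kappa> \<in> arc_multiplicities H n v \<longleftrightarrow> (\<forall>h\<in>{1..n}. net \<kappa> h = v h)"
proof
  assume \<kappa>: "\<kappa> \<in> arc_multiplicities H n v"
  have partial: "(\<Sum>h=1..i. net \<kappa> h) = (\<Sum>h=1..i. v h)" if "i \<le> n" for i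
  proof -
    consider "i = 0" | "i \<in> {1..<n}" | "i = n" using \<open>i \<le> n\<close> by fastforce
    then show ?thesis
    proof cases
      case 2
      then show ?thesis
        using \<kappa> unfolding sum_net_eq_covering unfolding root_coeff_def[symmetric] arc_multiplicities_def by blast
    next
      case 3
      show ?thesis unfolding sum_net_eq_covering 3 covering_last assms(2) by simp
    qed simp
  qed
  show "\<forall>h\<in>{1..n}. net \<kappa> h = v h"
  proof
    fix h assume h: "h \<in> {1..n}"
    then obtain i where i: "h = Suc i" by (cases h) auto
    show "net \<kappa> h = v h"
      using partial[of h] partial[of i] h by (simp add: i)
  qed
next
  assume eq: "\<forall>h\<in>{1..n}. net \<kappa> h = v h"
  have "int (covering H \<kappa> i) = root_coeff v i" if "i \<in> {1..<n}" for i
    unfolding sum_net_eq_covering[symmetric] root_coeff_def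
    using eq that by (intro sum.cong) auto
  then show "\<kappa> \<in> arc_multiplicities H n v"
    using assms(1) by (simp add: arc_multiplicities_def)
qed

lemma sum_shifted_out_degree: "(\<Sum>i=1..n. shifted_out_degree G i) = int (card (arcs G)) - int n"
proof -
  have "arcs G = (\<Union>i\<in>{1..n}. out_arcs G i)"
    using arc_ends_bounds by auto
  also have "card \<dots> = (\<Sum>i=1..n. out_degree G i)"
    unfolding out_degree_def
    by (rule card_UN_disjoint) (auto intro: finite_subset[OF _ finite_arcs])
  finally show ?thesis
    by (simp add: shifted_out_degree_def sum_subtractf)
qed

lemma no_diagrams_without_out_arcs:
  assumes i: "i \<in> {1..n}" and "out_degree G i = 0"
  shows "unified_diagrams G n a = {}"
proof -
  have False if s: "s \<in> dyck_paths n (shifted_out_degree G)"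
    and D: "D \<in> gravity_diagrams H n (\<lambda>i. int (s i) - shifted_out_degree G i)" for s D
  proof -
    let ?v = "\<lambda>i. int (s i) - shifted_out_degree G i"
    obtain P f where "(P, f) \<in> line_dot_diagrams H n ?v"
      using D unfolding gravity_diagrams_def by (elim quotientE) fastforce
    then have "line_counts H (P, f) \<in> arc_multiplicities H n ?v"
      by (rule line_counts_in_multiplicities[OF finite_arcs_H])
    moreover define \<kappa> where "\<kappa> = line_counts H (P, f)"
    ultimately have \<kappa>: "\<kappa> \<in> arc_multiplicities H n ?v" by simp
    have "net \<kappa> i = ?v i"
      using \<kappa> multiplicities_iff_net[of \<kappa> ?v] s i
      by (simp add: arc_multiplicities_def dyck_paths_def sum_subtractf)
    moreover have "out_arcs G i = {}"
      using assms(2) by (simp add: out_degree_def)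
    then have "{e \<in> arcs H. tail G e = i} = {}" by (auto simp: out_arcs_def)
    then have "net \<kappa> i \<le> 0" unfolding net_def by (simp only: sum.empty) (simp add: sum_nonneg)
    ultimately show False using assms(2) by (simp add: shifted_out_degree_def)
  qed
  then show ?thesis
    by (auto simp: unified_diagrams_def labeled_dyck_paths_def)
qed

lemma flow_volume_without_out_arcs:
  assumes "i \<in> {1..n}" "out_degree G i = 0" "0 < a i"
  shows "flow_volume G n a = 0"
proof -
  have "out_arcs G i = {}"
    using assms(2) by (simp add: out_degree_def)
  then have "net_flow G b i \<le> 0" if "\<forall>e\<in>arcs G. 0 \<le> b e" for b
    using that unfolding net_flow_def by (auto intro!: sum_nonneg)
  then have "flow_polytope G n a = {}"
    using assms by (fastforce simp: flow_polytope_def flow_space_def)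
  then show ?thesis
    by (simp add: flow_volume_def)
qed

lemma card_net_flow_labels:
  "card (\<Pi>\<^sub>E i\<in>{1..n}. {1..s i} \<rightarrow>\<^sub>E {1..a i}) = (\<Prod>i=1..n. nat (a i) ^ s i)" for a :: "nat \<Rightarrow> int"
  by (simp add: card_PiE card_funcsetE)

text \<open>For a fixed path the labelings, the net flow labels and the gravity diagrams are chosen
  independently. The factorials from the labelings turn the powers counting net flow labels into
  divided powers.\<close>

lemma card_unified_diagrams:
  assumes a: "\<And>i. i \<in> {1..n} \<Longrightarrow> 0 \<le> a i"
  shows "real (card (unified_diagrams G n a)) = fact (card (arcs G) - n) *
    (\<Sum>s\<in>dyck_paths n (shifted_out_degree G).
      real (card (arc_multiplicities H n (\<lambda>i. int (s i) - shifted_out_degree G i))) *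
      (\<Prod>i=1..n. divpow (real_of_int (a i)) (s i)))"
proof -
  let ?t = "shifted_out_degree G"
  define lab where "lab s = {\<sigma>. \<sigma> permutes {1..\<Sum>i=1..n. s i} \<and>
    (\<forall>i\<in>{1..n}. strict_mono_on (column_steps s i) \<sigma>)}" for s
  define phi where "phi s = (\<Pi>\<^sub>E i\<in>{1..n}. {1..s i} \<rightarrow>\<^sub>E {1..a i})" for s :: "nat \<Rightarrow> nat"
  define grav where "grav s = gravity_diagrams H n (\<lambda>i. int (s i) - ?t i)" for s :: "nat \<Rightarrow> nat"
  have finlab: "finite (lab s)" for s
    unfolding lab_def by (rule finite_subset[OF _ finite_permutations[of "{1..\<Sum>i=1..n. s i}"]]) auto
  have finphi: "finite (phi s)" for s
    unfolding phi_def by (intro finite_PiE finite_atLeastAtMost finite_atLeastAtMost_int)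
  have fingrav: "finite (grav s)" for s
    unfolding grav_def by (rule finite_gravity_diagrams) simp
  have "unified_diagrams G n a = (SIGMA s:dyck_paths n ?t. lab s \<times> phi s \<times> grav s)"
    by (auto simp: unified_diagrams_def labeled_dyck_paths_def lab_def phi_def grav_def)
  then have "card (unified_diagrams G n a) =
      (\<Sum>s\<in>dyck_paths n ?t. card (lab s) * (card (phi s) * card (grav s)))"
    using finlab finphi fingrav by (simp add: card_SigmaI finite_dyck_paths card_cartesian_product)
  then have "real (card (unified_diagrams G n a)) =
      (\<Sum>s\<in>dyck_paths n ?t. real (card (lab s)) * (real (card (phi s)) * real (card (grav s))))"
    by simp
  also have "\<dots> = (\<Sum>s\<in>dyck_paths n ?t. fact (card (arcs G) - n) *
      (real (card (arc_multiplicities H n (\<lambda>i. int (s i) - ?t i))) *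
      (\<Prod>i=1..n. divpow (real_of_int (a i)) (s i))))"
  proof (rule sum.cong[OF refl])
    fix s assume s: "s \<in> dyck_paths n ?t"
    have "int (\<Sum>i=1..n. s i) = int (card (arcs G)) - int n"
      using s sum_shifted_out_degree by (simp add: dyck_paths_def)
    \<comment> \<open>The sum is nonnegative, so the truncated subtraction is exact.\<close>
    then have d: "(\<Sum>i=1..n. s i) = card (arcs G) - n" by linarith
    have "real (card (lab s)) * (\<Prod>i=1..n. fact (s i)) = fact (card (arcs G) - n)"
      using arg_cong[OF card_labelings[where s=s and n=n], where f=real] unfolding lab_def d by simp
    then have "real (card (lab s)) = fact (card (arcs G) - n) / (\<Prod>i=1..n. fact (s i))"
      by (simp add: field_simps)
    moreover have "real (card (phi s)) = (\<Prod>i=1..n. real_of_int (a i) ^ s i)"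
      unfolding phi_def card_net_flow_labels using a by simp
    moreover have "card (grav s) = card (arc_multiplicities H n (\<lambda>i. int (s i) - ?t i))"
      unfolding grav_def by (rule card_gravity_diagrams[OF finite_arcs_H arc_bounds_H])
    ultimately show "real (card (lab s)) * (real (card (phi s)) * real (card (grav s))) =
        fact (card (arcs G) - n) *
        (real (card (arc_multiplicities H n (\<lambda>i. int (s i) - ?t i))) *
        (\<Prod>i=1..n. divpow (real_of_int (a i)) (s i)))"
      by (simp add: divpow_def prod_dividef)
  qed
  finally show ?thesis by (simp only: sum_distrib_left)
qed

end

context rooted_digraph
begin

lemma card_out_minus_tree:
  assumes "v \<in> {1..n}"
  shows "int (card {e \<in> arcs G. tail G e = v \<and> e \<notin> tree}) = shifted_out_degree G v"
proof -
  obtain e where e: "e \<in> tree" "tail G e = v" using assms tree_props(3) by (metis imageE)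
  have "{e \<in> arcs G. tail G e = v} = insert e {e \<in> arcs G. tail G e = v \<and> e \<notin> tree}"
    using e tree_props(1,2) by (auto dest: inj_onD)
  then have "card {e \<in> arcs G. tail G e = v} = Suc (card {e \<in> arcs G. tail G e = v \<and> e \<notin> tree})"
    using e by simp
  then show ?thesis
    by (simp add: shifted_out_degree_def out_degree_def out_arcs_def)
qed

text \<open>The nontree arcs out of \<open>v\<close> contribute 1 each, which gives the shifted
  out-degree; arcs into \<open>n + 1\<close> carry no multiplicity, so the rest lives on
  \<open>H\<close>.\<close>

lemma excess_eq_net:
  assumes v: "v \<in> {1..n}" and zero: "\<And>e. e \<in> arcs G \<Longrightarrow> head G e = n + 1 \<Longrightarrow> \<kappa> e = 0"
  shows "excess (arcs G) tree \<kappa> v = shifted_out_degree G v + net \<kappa> v"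
proof -
  have "(\<Sum>e | e \<in> arcs G \<and> tail G e = v. int (\<kappa> e) + (if e \<in> tree then 0 else 1)) =
      (\<Sum>e | e \<in> arcs G \<and> tail G e = v. int (\<kappa> e)) +
      (\<Sum>e | e \<in> arcs G \<and> tail G e = v. if e \<in> tree then 0 else 1)"
    by (rule sum.distrib)
  also have "(\<Sum>e | e \<in> arcs G \<and> tail G e = v. if e \<in> tree then 0 else 1 :: int) =
      (\<Sum>e | e \<in> arcs G \<and> tail G e = v \<and> e \<notin> tree. 1)"
    by (rule sum.mono_neutral_cong_right) auto
  also have "\<dots> = shifted_out_degree G v"
    using card_out_minus_tree[OF v] by simp
  also have "(\<Sum>e | e \<in> arcs G \<and> tail G e = v. int (\<kappa> e)) = (\<Sum>e | e \<in> arcs H \<and> tail G e = v. int (\<kappa> e))"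
    using zero unfolding arcs_H by (intro sum.mono_neutral_cong_right) auto
  finally have out: "(\<Sum>e | e \<in> arcs G \<and> tail G e = v. int (\<kappa> e) + (if e \<in> tree then 0 else 1)) =
      (\<Sum>e | e \<in> arcs H \<and> tail G e = v. int (\<kappa> e)) + shifted_out_degree G v" .
  have "{e \<in> arcs G. head G e = v} = {e \<in> arcs H. head G e = v}"
    using v unfolding arcs_H by auto
  then show ?thesis
    unfolding excess_def net_def out by simp
qed

text \<open>Arcs only enter \<open>n + 1\<close>, so its excess is minus the sum of their
  multiplicities and can be nonnegative only if all of them are 0.\<close>

lemma admissible_last_arcs:
  assumes "\<kappa> \<in> admissible (arcs G) tree" "e \<in> arcs G" "head G e = n + 1"
  shows "\<kappa> e = 0"
proof -
  have "{e \<in> arcs G. tail G e = n + 1} = {}" using arc_ends_bounds(1) by fastforce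
  then have "excess (arcs G) tree \<kappa> (n + 1) = - (\<Sum>e | e \<in> arcs G \<and> head G e = n + 1. int (\<kappa> e))"
    unfolding excess_def by (simp only: sum.empty)
  moreover have "0 \<le> excess (arcs G) tree \<kappa> (n + 1)" using assms(1) by (simp add: admissible_def)
  moreover have "int (\<kappa> e) \<le> (\<Sum>e | e \<in> arcs G \<and> head G e = n + 1. int (\<kappa> e))"
    using assms(2,3) by (intro member_le_sum) auto
  ultimately show ?thesis by simp
qed

lemma excess_last:
  assumes zero: "\<And>e. e \<in> arcs G \<Longrightarrow> head G e = n + 1 \<Longrightarrow> \<kappa> e = 0" and v: "v \<notin> {1..n}"
  shows "excess (arcs G) tree \<kappa> v = 0"
proof -
  have "{e \<in> arcs G. tail G e = v} = {}" using arc_ends_bounds(1) v by fastforce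
  moreover have "(\<Sum>e | e \<in> arcs G \<and> head G e = v. int (\<kappa> e)) = 0"
  proof (rule sum.neutral, rule ballI)
    fix e assume "e \<in> {e \<in> arcs G. head G e = v}"
    then have "e \<in> arcs G" "head G e = n + 1" using arc_ends_bounds(2)[of e] v by auto
    then show "int (\<kappa> e) = 0" using zero by simp
  qed
  ultimately show ?thesis unfolding excess_def by (simp only: sum.empty)
qed

text \<open>The excess vector is the Dyck path, and the inequalities come for free: the partial sums
  of s - t are coverings, hence nonnegative, and the last covering is 0. Conversely, a gravity
  diagram's multiplicities extend by 0 to the arcs into \<open>n + 1\<close>.\<close>

lemma bij_betw_admissible:
  "bij_betw (\<lambda>\<kappa>. (\<lambda>i\<in>{1..n}. nat (excess (arcs G) tree \<kappa> i), restrict \<kappa> (arcs H)))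
    (admissible (arcs G) tree)
    (SIGMA s:dyck_paths n (shifted_out_degree G).
      arc_multiplicities H n (\<lambda>i. int (s i) - shifted_out_degree G i))"
proof -
  let ?t = "shifted_out_degree G"
  let ?E = "\<lambda>\<kappa>. excess (arcs G) tree \<kappa>"
  let ?S = "SIGMA s:dyck_paths n ?t. arc_multiplicities H n (\<lambda>i. int (s i) - ?t i)"
  define ext where "ext \<kappa> = (\<lambda>e\<in>arcs G. if e \<in> arcs H then \<kappa> e else 0)" for \<kappa> :: "'e \<Rightarrow> nat"
  have HG: "arcs H \<subseteq> arcs G" by (auto simp: arcs_H)
  have net_res: "net (restrict \<kappa> (arcs H)) = net \<kappa>" for \<kappa>
    unfolding net_def by (intro ext arg_cong2[where f="(-)"] sum.cong) auto
  have net_ext: "net (ext \<kappa>) = net \<kappa>" for \<kappa>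
    unfolding net_def ext_def using HG by (intro HOL.ext arg_cong2[where f="(-)"] sum.cong) auto
  have zero_ext: "ext \<kappa> e = 0" if "e \<in> arcs G" "head G e = n + 1" for \<kappa> e
    using that by (simp add: ext_def arcs_H)
  have inverse_props: "s \<in> {1..n} \<rightarrow>\<^sub>E UNIV" "\<kappa> \<in> arcs H \<rightarrow>\<^sub>E UNIV" "\<And>v. v \<in> {1..n} \<Longrightarrow> ?E (ext \<kappa>) v = int (s v)"
    if "(s, \<kappa>) \<in> ?S" for s \<kappa>
  proof -
    show "s \<in> {1..n} \<rightarrow>\<^sub>E UNIV" and \<kappa>: "\<kappa> \<in> arcs H \<rightarrow>\<^sub>E UNIV"
      using that by (auto simp: dyck_paths_def arc_multiplicities_def)
    have "(\<Sum>h=1..n. int (s h) - ?t h) = 0"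
      using that by (auto simp: dyck_paths_def sum_subtractf)
    then have "net \<kappa> v = int (s v) - ?t v" if "v \<in> {1..n}" for v
      using multiplicities_iff_net[OF \<kappa>] \<open>(s, \<kappa>) \<in> ?S\<close> that by auto
    then show "?E (ext \<kappa>) v = int (s v)" if "v \<in> {1..n}" for v
      using excess_eq_net[OF that zero_ext] that by (simp add: net_ext)
  qed
  show ?thesis
  proof (rule bij_betwI[where g="\<lambda>(s, \<kappa>). ext \<kappa>"])
    show "(\<lambda>\<kappa>. (\<lambda>i\<in>{1..n}. nat (?E \<kappa> i), restrict \<kappa> (arcs H))) \<in> admissible (arcs G) tree \<rightarrow> ?S"
    proof
      fix \<kappa> assume \<kappa>: "\<kappa> \<in> admissible (arcs G) tree"
      define s where "s = (\<lambda>i\<in>{1..n}. nat (?E \<kappa> i))"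
      have "0 \<le> ?E \<kappa> i" for i using \<kappa> by (simp add: admissible_def)
      then have s: "int (s i) = ?t i + net \<kappa> i" if "i \<in> {1..n}" for i
      proof -
        have "?E \<kappa> i = ?t i + net \<kappa> i"
          by (rule excess_eq_net[OF that]) (rule admissible_last_arcs[OF \<kappa>])
        then show ?thesis using \<open>0 \<le> ?E \<kappa> i\<close> that by (simp add: s_def)
      qed
      have partial: "(\<Sum>i=1..k. int (s i)) = (\<Sum>i=1..k. ?t i) + int (covering H \<kappa> k)" if "k \<le> n" for k
      proof -
        have "(\<Sum>i=1..k. int (s i)) = (\<Sum>i=1..k. ?t i + net \<kappa> i)"
          using that by (intro sum.cong s) auto
        then show ?thesis by (simp only: sum.distrib sum_net_eq_covering)
      qed
      have total: "(\<Sum>i=1..n. int (s i)) = (\<Sum>i=1..n. ?t i)"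
        using partial[OF order_refl] by (simp only: covering_last of_nat_0 add_0_right)
      have "s \<in> {1..n} \<rightarrow>\<^sub>E UNIV" by (simp add: s_def)
      then have "s \<in> dyck_paths n ?t"
        using partial total by (simp add: dyck_paths_def)
      moreover have "restrict \<kappa> (arcs H) \<in> arc_multiplicities H n (\<lambda>i. int (s i) - ?t i)"
      proof (subst multiplicities_iff_net)
        show "(\<Sum>h=1..n. int (s h) - ?t h) = 0"
          using total by (simp add: sum_subtractf)
        show "\<forall>h\<in>{1..n}. net (restrict \<kappa> (arcs H)) h = int (s h) - ?t h"
          unfolding net_res using s by simp
      qed auto
      ultimately show "(\<lambda>i\<in>{1..n}. nat (?E \<kappa> i), restrict \<kappa> (arcs H)) \<in> ?S"
        by (simp add: s_def)
    qed
    show "(\<lambda>(s, \<kappa>). ext \<kappa>) \<in> ?S \<rightarrow> admissible (arcs G) tree"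
    proof
      fix p assume p: "p \<in> ?S"
      obtain s \<kappa> where sk: "p = (s, \<kappa>)" by (cases p)
      have "0 \<le> ?E (ext \<kappa>) v" for v
        using inverse_props(3)[OF p[unfolded sk], of v] excess_last[of "ext \<kappa>" v, OF zero_ext] by (cases "v \<in> {1..n}") auto
      then show "(\<lambda>(s, \<kappa>). ext \<kappa>) p \<in> admissible (arcs G) tree"
        by (simp add: sk admissible_def ext_def)
    qed
    show "(\<lambda>(s, \<kappa>). ext \<kappa>) (\<lambda>i\<in>{1..n}. nat (?E \<kappa> i), restrict \<kappa> (arcs H)) = \<kappa>"
      if \<kappa>: "\<kappa> \<in> admissible (arcs G) tree" for \<kappa>
    proof -
      have "\<kappa> \<in> arcs G \<rightarrow>\<^sub>E UNIV" using \<kappa> by (simp add: admissible_def)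
      from PiE_arb[OF this] admissible_last_arcs[OF \<kappa>] show ?thesis
        unfolding ext_def arcs_H case_prod_conv by (auto simp: fun_eq_iff)
    qed
    show "(\<lambda>i\<in>{1..n}. nat (?E ((\<lambda>(s, \<kappa>). ext \<kappa>) p) i), restrict ((\<lambda>(s, \<kappa>). ext \<kappa>) p) (arcs H)) = p"
      if p: "p \<in> ?S" for p
    proof -
      obtain s \<kappa> where sk: "p = (s, \<kappa>)" by (cases p)
      note b = inverse_props[OF p[unfolded sk]]
      have "(\<lambda>i\<in>{1..n}. nat (?E (ext \<kappa>) i)) = s"
        using PiE_arb[OF b(1)] b(3) by (intro HOL.ext) (simp add: restrict_def)
      moreover have "restrict (ext \<kappa>) (arcs H) = \<kappa>"
        using PiE_arb[OF b(2)] HG by (auto simp: ext_def fun_eq_iff)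
      ultimately show ?thesis by (simp add: sk)
    qed
  qed
qed

lemma lidskii_sum_eq_sum_dyck_paths:
  "lidskii_sum (arcs G) tree {1..n + 1} (a(n + 1 := 0)) =
    (\<Sum>s\<in>dyck_paths n (shifted_out_degree G).
      real (card (arc_multiplicities H n (\<lambda>i. int (s i) - shifted_out_degree G i))) *
      (\<Prod>i=1..n. divpow (a i) (s i)))"
proof -
  let ?t = "shifted_out_degree G"
  let ?K = "\<lambda>s. arc_multiplicities H n (\<lambda>i. int (s i) - ?t i)"
  have "finite (SIGMA s:dyck_paths n ?t. ?K s)"
    using bij_betw_finite[OF bij_betw_admissible] finite_admissible[OF rooted_tree] by simp
  then have fin: "finite (?K s)" if "s \<in> dyck_paths n ?t" for s
    using that by (rule_tac finite_subset[of _ "snd ` (SIGMA s:dyck_paths n ?t. ?K s)"]) force+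
  have "lidskii_sum (arcs G) tree {1..n + 1} (a(n + 1 := 0)) =
      (\<Sum>\<kappa>\<in>admissible (arcs G) tree.
        \<Prod>i=1..n. divpow (a i) ((\<lambda>i\<in>{1..n}. nat (excess (arcs G) tree \<kappa> i)) i))"
    unfolding lidskii_sum_def
  proof (rule sum.cong[OF refl])
    fix \<kappa> assume \<kappa>: "\<kappa> \<in> admissible (arcs G) tree"
    \<comment> \<open>The factor at \<open>n + 1\<close> has exponent 0, so it equals 1 although the
      net flow there was set to 0.\<close>
    have last: "excess (arcs G) tree \<kappa> (n + 1) = 0"
      by (rule excess_last) (use admissible_last_arcs[OF \<kappa>] in auto)
    have "{1..n + 1} = insert (n + 1) {1..n}" by auto
    then have "(\<Prod>v\<in>{1..n + 1}. divpow ((a(n + 1 := 0)) v) (nat (excess (arcs G) tree \<kappa> v))) =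
        (\<Prod>v\<in>{1..n}. divpow ((a(n + 1 := 0)) v) (nat (excess (arcs G) tree \<kappa> v)))"
      using last by simp
    also have "\<dots> = (\<Prod>i=1..n. divpow (a i) ((\<lambda>i\<in>{1..n}. nat (excess (arcs G) tree \<kappa> i)) i))"
      by (rule prod.cong) auto
    finally show "(\<Prod>v\<in>{1..n + 1}. divpow ((a(n + 1 := 0)) v) (nat (excess (arcs G) tree \<kappa> v))) =
        (\<Prod>i=1..n. divpow (a i) ((\<lambda>i\<in>{1..n}. nat (excess (arcs G) tree \<kappa> i)) i))" .
  qed
  also have "\<dots> = (\<Sum>(s, \<kappa>)\<in>(SIGMA s:dyck_paths n ?t. ?K s). \<Prod>i=1..n. divpow (a i) (s i))"
    using sum.reindex_bij_betw[OF bij_betw_admissible, of "\<lambda>(s, \<kappa>). \<Prod>i=1..n. divpow (a i) (s i)"]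
    by (simp only: prod.case)
  also have "\<dots> = (\<Sum>s\<in>dyck_paths n ?t. \<Sum>\<kappa>\<in>?K s. \<Prod>i=1..n. divpow (a i) (s i))"
    using fin by (intro sum.Sigma[symmetric] finite_dyck_paths) auto
  finally show ?thesis by simp
qed

end

text \<open>The last hypothesis excludes a vertex \<open>i \<le> n\<close> with
  \<open>a i = 0\<close> and no outgoing arc, where equality can fail. For n = 2, arcs (1,2) and
  (1,3) and net flow (1, 0), the polytope is a single point in dimension m - n = 0, of volume 1,
  whereas t = (1, -1) admits no Dyck path.\<close>

theorem theorem4p4:
  fixes G :: "(nat, 'e) pre_digraph" and n :: nat and a :: "nat \<Rightarrow> int"
  assumes "fin_digraph G"
    and "verts G = {1..n + 1}"
    and "\<And>e. e \<in> arcs G \<Longrightarrow> tail G e < head G e"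
    and "Digraph_Component.connected G"
    and "\<And>i. i \<in> {1..n} \<Longrightarrow> 0 \<le> a i"
    and "\<And>i. i \<in> {1..n} \<Longrightarrow> a i = 0 \<Longrightarrow> 1 \<le> out_degree G i"
  shows "flow_volume G n (\<lambda>i. real_of_int (a i)) = real (card (unified_diagrams G n a))"
proof -
  interpret ascending_digraph G n
    by unfold_locales (use assms in \<open>auto simp: fin_digraph_def wf_digraph_def fin_digraph_axioms_def\<close>)
  show ?thesis
  proof (cases "\<forall>i\<in>{1..n}. 1 \<le> out_degree G i")
    case True
    then interpret rooted_digraph G n
      by unfold_locales auto
    show ?thesis
      using flow_volume_eq_lidskii_sum[of "\<lambda>i. real_of_int (a i)"] assms(5)
      by (simp only: card_unified_diagrams lidskii_sum_eq_sum_dyck_paths of_int_0_le_iff)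
  next
    case False
    then obtain i where i: "i \<in> {1..n}" "out_degree G i = 0" by auto
    then have "0 < real_of_int (a i)" using assms(5,6)[of i] by fastforce
    then show ?thesis
      using flow_volume_without_out_arcs[OF i, of "\<lambda>i. real_of_int (a i)"]
        no_diagrams_without_out_arcs[OF i] by simp
  qed
qed

end
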